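(* Let $G$ be a finite, simple, connected graph on $n$ vertices such that $\Delta(\mathrm{EV}(G))\le 3$. Then either $\mathrm{pn}(G)\le\lfloor n/2\rfloor$ (i.e. $G$ is a Gallai graph), or $G$ is a SET graph.
   Context: All graphs are finite and simple. A path decomposition of a graph $G$ is a collection of edge-disjoint paths of $G$ whose union covers $E(G)$; $\mathrm{pn}(G)$ is the minimum cardinality of a path decomposition of $G$. The E-subgraph $\mathrm{EV}(G)$ is the subgraph of $G$ induced by the vertices of even degree in $G$, and $\Delta$ denotes maximum degree. A vertex is even (odd) if its degree in $G$ is even (odd). A graph $G$ is a SET graph if $\mathrm{EV}(G)$ is a triangle and every odd vertex of $G$ has at least two even neighbors. *)

theory Defs
  imports Main
begin

record 'a ugraph =
  verts :: "'a set"
  edges :: "'a set set"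

definition simple_graph :: "'a ugraph \<Rightarrow> bool" where
  "simple_graph G \<longleftrightarrow> finite (verts G) \<and>
     edges G \<subseteq> {{u, v} | u v. u \<in> verts G \<and> v \<in> verts G \<and> u \<noteq> v}"

definition neighbors :: "'a ugraph \<Rightarrow> 'a \<Rightarrow> 'a set" where
  "neighbors G v = {u \<in> verts G. {v, u} \<in> edges G}"

definition degree :: "'a ugraph \<Rightarrow> 'a \<Rightarrow> nat" where
  "degree G v = card (neighbors G v)"

text \<open>The inserted 0 makes the maximum degree of the graph without vertices 0;
  it has no effect on any other graph.\<close>

definition max_degree :: "'a ugraph \<Rightarrow> nat" where
  "max_degree G = Max (insert 0 (degree G ` verts G))"

definition induced_subgraph :: "'a ugraph \<Rightarrow> 'a set \<Rightarrow> 'a ugraph" where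
  "induced_subgraph G S =
     \<lparr>verts = verts G \<inter> S, edges = {e \<in> edges G. e \<subseteq> S}\<rparr>"

definition even_vertices :: "'a ugraph \<Rightarrow> 'a set" where
  "even_vertices G = {v \<in> verts G. even (degree G v)}"

definition EV :: "'a ugraph \<Rightarrow> 'a ugraph" where
  "EV G = induced_subgraph G (even_vertices G)"

text \<open>A path is given by the list of its vertices in order, so each path with an edge is given
  by two lists, one the reverse of the other. In a decomposition these cannot both
  occur, because they share their edges. One-vertex paths are admitted; they contribute no edge
  and hence do not affect the minimum size of a decomposition.\<close>

fun path_edges :: "'a list \<Rightarrow> 'a set set" where
  "path_edges (u # v # p) = insert {u, v} (path_edges (v # p))"
| "path_edges _ = {}"

definition is_path :: "'a ugraph \<Rightarrow> 'a list \<Rightarrow> bool" where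
  "is_path G p \<longleftrightarrow> p \<noteq> [] \<and> distinct p \<and> set p \<subseteq> verts G \<and> path_edges p \<subseteq> edges G"

definition connected_graph :: "'a ugraph \<Rightarrow> bool" where
  "connected_graph G \<longleftrightarrow> verts G \<noteq> {} \<and>
     (\<forall>u \<in> verts G. \<forall>v \<in> verts G. \<exists>p. is_path G p \<and> hd p = u \<and> last p = v)"

definition path_decomposition :: "'a ugraph \<Rightarrow> 'a list set \<Rightarrow> bool" where
  "path_decomposition G D \<longleftrightarrow> finite D \<and> (\<forall>p \<in> D. is_path G p) \<and>
     (\<forall>p \<in> D. \<forall>q \<in> D. p \<noteq> q \<longrightarrow> path_edges p \<inter> path_edges q = {}) \<and>
     (\<Union>p \<in> D. path_edges p) = edges G"

definition pn :: "'a ugraph \<Rightarrow> nat" where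
  "pn G = (LEAST k. \<exists>D. path_decomposition G D \<and> card D = k)"

definition is_triangle :: "'a ugraph \<Rightarrow> bool" where
  "is_triangle G \<longleftrightarrow> (\<exists>a b c. a \<noteq> b \<and> b \<noteq> c \<and> a \<noteq> c \<and>
     verts G = {a, b, c} \<and> edges G = {{a, b}, {b, c}, {a, c}})"

definition SET_graph :: "'a ugraph \<Rightarrow> bool" where
  "SET_graph G \<longleftrightarrow> is_triangle (EV G) \<and>
     (\<forall>v \<in> verts G. odd (degree G v) \<longrightarrow> card (neighbors G v \<inter> even_vertices G) \<ge> 2)"

definition Gallai_graph :: "'a ugraph \<Rightarrow> bool" where
  "Gallai_graph G \<longleftrightarrow> pn G \<le> card (verts G) div 2"

text \<open>The single edges form a path decomposition, so the minimum in the path number is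
  attained.\<close>

lemma path_decomposition_exists:
  assumes "simple_graph G"
  shows "\<exists>D. path_decomposition G D"
proof -
  have fin: "finite (edges G)"
    using assms by (auto simp: simple_graph_def intro!: finite_subset[of "edges G" "Pow (verts G)"])
  have "\<forall>e \<in> edges G. \<exists>p. is_path G p \<and> path_edges p = {e}"
  proof
    fix e assume e: "e \<in> edges G"
    then obtain u v where "e = {u, v}" "u \<in> verts G" "v \<in> verts G" "u \<noteq> v"
      using assms unfolding simple_graph_def by blast
    with e have "is_path G [u, v] \<and> path_edges [u, v] = {e}"
      by (simp add: is_path_def)
    then show "\<exists>p. is_path G p \<and> path_edges p = {e}" by blast
  qed
  then obtain f where f: "\<And>e. e \<in> edges G \<Longrightarrow> is_path G (f e) \<and> path_edges (f e) = {e}"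
    by metis
  have "path_decomposition G (f ` edges G)"
    unfolding path_decomposition_def using fin f by auto
  then show ?thesis by blast
qed

lemma pn_attained:
  assumes "simple_graph G"
  shows "\<exists>D. path_decomposition G D \<and> card D = pn G"
  unfolding pn_def using path_decomposition_exists[OF assms] by (rule exE) (rule LeastI_ex, blast)

end

theory Submission
  imports Defs
begin

text \<open>
  Count, for a path decomposition, the path ends at each vertex; a vertex of odd degree has at
  least one. Lovasz' rotation argument at a vertex \<open>v\<close> adds a missing edge \<open>vx\<close> without new paths, at
  the cost of one end at \<open>x\<close> and with the gain of one end at \<open>v\<close>, as soon as \<open>x\<close> has more ends than
  \<open>v\<close> has neighbours without ends. Hence at least half of a set of missing edges at \<open>v\<close> can be
  added if all neighbours involved have an end.

  By induction on the size of the graph, one removes some edges and adds them again in a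
  suitable order. If an even vertex \<open>x\<close> has three even neighbours, the edges to them are removed. Two of
  them come back at \<open>x\<close>, which then has three ends, and this suffices to add the last one at its
  other end. Even vertices with one even neighbour, and paths on four even vertices whose inner
  vertices have no further even neighbours, are treated similarly. There remain graphs whose even
  vertices induce isolated vertices and triangles. There the edges from one odd vertex to its even
  neighbours are removed, unless these are two or three vertices of one triangle. If this
  obstruction occurs at every odd vertex with an even neighbour, then the graph is a SET graph, or two odd
  vertices can be treated together. If all vertices are odd, a leaf or a cycle is removed.
\<close>

section \<open>Path systems\<close>

text \<open>A removal is chosen so that the vertices whose ends matter become odd: parity then gives
  each of them an end, whatever decomposition the induction hypothesis returns. Two obstacles shape
  the proof. A removal may split off a SET component, so the induction runs over all graphs without
  SET components, and each removal must be shown not to create one. And a removed edge is sure to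
  return at \<open>v\<close> only while the ends at its other endpoint outnumber the neighbours of
  \<open>v\<close> without ends, so the order of return and the parity at the centre decide. The
  bound 3 arises here: the third even neighbour of \<open>x\<close> has at most two further even
  neighbours, against three ends at \<open>x\<close>. The tight case is an odd vertex
  \<open>b\<close> joined to all of one triangle: losing three edges makes \<open>b\<close> even, so
  only two ends at \<open>b\<close> are certain when the last vertex, whose two mates may lack ends,
  has to be joined. Removing one more edge at \<open>b\<close> repairs the parity; its other
  endpoint is the second odd vertex.\<close>

lemma path_edges_subset: "e \<in> path_edges p \<Longrightarrow> e \<subseteq> set p"
  by (induction p rule: path_edges.induct) auto

lemma path_edges_append:
  "path_edges (xs @ x # y # ys) = insert {x, y} (path_edges (xs @ [x]) \<union> path_edges (y # ys))"
proof (induction xs)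
  case (Cons a xs)
  then show ?case by (cases xs) auto
qed simp

lemma path_edges_rev [simp]: "path_edges (rev p) = path_edges p"
proof (induction p rule: path_edges.induct)
  case (1 u v p)
  have "path_edges (rev (u # v # p)) = path_edges (rev p @ v # u # [])" by simp
  also have "\<dots> = insert {v, u} (path_edges (rev (v # p)))"
    by (subst path_edges_append) simp
  finally show ?case using 1 by (simp add: insert_commute)
qed auto

lemma path_edges_split:
  "{u, v} \<in> path_edges p \<Longrightarrow> \<exists>xs ys. p = xs @ u # v # ys \<or> p = xs @ v # u # ys"
proof (induction p rule: path_edges.induct)
  case (1 a b p)
  show ?case
  proof (cases "{u, v} = {a, b}")
    case True
    then have "a # b # p = [] @ u # v # p \<or> a # b # p = [] @ v # u # p"
      by (auto simp: doubleton_eq_iff)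
    then show ?thesis by blast
  next
    case False
    with 1 obtain xs ys where "b # p = xs @ u # v # ys \<or> b # p = xs @ v # u # ys" by auto
    then have "a # b # p = (a # xs) @ u # v # ys \<or> a # b # p = (a # xs) @ v # u # ys" by auto
    then show ?thesis by blast
  qed
qed auto

lemma path_edges_doubleton:
  "e \<in> path_edges p \<Longrightarrow> distinct p \<Longrightarrow> \<exists>u v. e = {u, v} \<and> u \<noteq> v"
  by (induction p rule: path_edges.induct) auto

lemma rev_neq_self: "distinct p \<Longrightarrow> 2 \<le> length p \<Longrightarrow> rev p \<noteq> p"
proof
  assume "distinct p" "2 \<le> length p" "rev p = p"
  then obtain x xs where p: "p = x # xs" "xs \<noteq> []" "x \<notin> set xs" by (cases p) (auto simp: Suc_le_eq)
  then have "hd (rev p) = last xs" by (simp add: hd_rev)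
  with p \<open>rev p = p\<close> last_in_set[of xs] show False by simp
qed

text \<open>A path system contains every path of a decomposition in both directions, so that the path ends
  at a vertex \<open>x\<close> correspond to the members that start at \<open>x\<close>.\<close>

definition path_system :: "'a set set \<Rightarrow> 'a list set \<Rightarrow> bool" where
  "path_system E P \<longleftrightarrow> finite P \<and> (\<forall>p\<in>P. distinct p \<and> 2 \<le> length p \<and> rev p \<in> P) \<and>
     (\<forall>p\<in>P. \<forall>q\<in>P. path_edges p \<inter> path_edges q \<noteq> {} \<longrightarrow> q = p \<or> q = rev p) \<and>
     (\<Union>p\<in>P. path_edges p) = E"

definition ends_at :: "'a list set \<Rightarrow> 'a \<Rightarrow> nat" where
  "ends_at P x = card {p \<in> P. hd p = x}"

definition nb :: "'a set set \<Rightarrow> 'a \<Rightarrow> 'a set" where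
  "nb E v = {u. {v, u} \<in> E}"

lemma path_systemD:
  assumes "path_system E P"
  shows "finite P" "p \<in> P \<Longrightarrow> distinct p" "p \<in> P \<Longrightarrow> 2 \<le> length p" "p \<in> P \<Longrightarrow> rev p \<in> P"
    "p \<in> P \<Longrightarrow> p \<noteq> []" "p \<in> P \<Longrightarrow> rev p \<noteq> p" "p \<in> P \<Longrightarrow> path_edges p \<subseteq> E"
    "p \<in> P \<Longrightarrow> q \<in> P \<Longrightarrow> e \<in> path_edges p \<Longrightarrow> e \<in> path_edges q \<Longrightarrow> q = p \<or> q = rev p"
    "e \<in> E \<Longrightarrow> \<exists>p\<in>P. e \<in> path_edges p"
proof -
  note d = assms[unfolded path_system_def]
  show "finite P" "p \<in> P \<Longrightarrow> distinct p" "p \<in> P \<Longrightarrow> 2 \<le> length p" "p \<in> P \<Longrightarrow> rev p \<in> P"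
    "p \<in> P \<Longrightarrow> path_edges p \<subseteq> E" "e \<in> E \<Longrightarrow> \<exists>p\<in>P. e \<in> path_edges p"
    using d by blast+
  show "p \<in> P \<Longrightarrow> p \<noteq> []" using d by fastforce
  show "p \<in> P \<Longrightarrow> rev p \<noteq> p" using d rev_neq_self by blast
  show "p \<in> P \<Longrightarrow> q \<in> P \<Longrightarrow> e \<in> path_edges p \<Longrightarrow> e \<in> path_edges q \<Longrightarrow> q = p \<or> q = rev p"
    using d by blast
qed

lemma ends_at_split:
  assumes "finite P" "p \<in> P" "rev p \<in> P" "rev p \<noteq> p" "p \<noteq> []"
  shows "ends_at P u = ends_at (P - {p, rev p}) u + of_bool (hd p = u) + of_bool (last p = u)"
proof -
  have "{q \<in> P. hd q = u} = {q \<in> P - {p, rev p}. hd q = u} \<union>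
      ((if hd p = u then {p} else {}) \<union> (if last p = u then {rev p} else {}))"
    using assms by (auto simp: hd_rev)
  then have "ends_at P u = card {q \<in> P - {p, rev p}. hd q = u} +
      card ((if hd p = u then {p} else {}) \<union> (if last p = u then {rev p} else {}))"
    unfolding ends_at_def using assms(1) by (subst card_Un_disjoint[symmetric]) auto
  then show ?thesis
    using assms(4) by (auto simp: ends_at_def)
qed

text \<open>Both operations on a path system, lengthening a path by an edge and rotating a path at an
  interior vertex, replace one path by another.\<close>

lemma path_system_replace:
  assumes PS: "path_system E P" and p: "p \<in> P" and p': "distinct p'" "2 \<le> length p'"
    and sub: "path_edges p' \<subseteq> insert e (path_edges p)" and e: "e \<in> path_edges p'" "e \<notin> E"
  obtains P' where "P' = (P - {p, rev p}) \<union> {p', rev p'}"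
    and "path_system ((E - path_edges p) \<union> path_edges p') P'"
    and "card P' = card P"
    and "\<And>u. ends_at P' u + of_bool (hd p = u) + of_bool (last p = u) =
         ends_at P u + of_bool (hd p' = u) + of_bool (last p' = u)"
proof -
  note D = path_systemD[OF PS]
  define R where "R = P - {p, rev p}"
  define P' where "P' = R \<union> {p', rev p'}"
  \<comment> \<open>The new edge \<open>e\<close> occurs in no member of \<open>P\<close>, so
    \<open>p'\<close> and its reverse are new, and exchanging two members for two keeps the
    cardinality.\<close>
  have p'R: "p' \<notin> P" "rev p' \<notin> P"
    using D(7)[of p'] D(7)[of "rev p'"] e by auto
  have p'n: "rev p' \<noteq> p'" "p' \<noteq> []" using rev_neq_self[OF p'] p'(2) by auto
  have Rdis: "path_edges q \<inter> path_edges p = {}" if "q \<in> R" for q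
    using D(8)[OF p, of q] that unfolding R_def by blast
  have Rdis': "path_edges q \<inter> path_edges p' = {}" if "q \<in> R" for q
    using Rdis[OF that] sub e D(7)[of q] that unfolding R_def by blast
  have UR: "(\<Union>q\<in>R. path_edges q) = E - path_edges p"
  proof (intro equalityI subsetI)
    fix f assume "f \<in> (\<Union>q\<in>R. path_edges q)"
    then show "f \<in> E - path_edges p" using Rdis D(7) unfolding R_def by blast
  next
    fix f assume f: "f \<in> E - path_edges p"
    then obtain q where "q \<in> P" "f \<in> path_edges q" using D(9) by blast
    then show "f \<in> (\<Union>q\<in>R. path_edges q)" using f unfolding R_def by auto
  qed
  have 1: "path_system ((E - path_edges p) \<union> path_edges p') P'"
    unfolding path_system_def
  proof (intro conjI ballI impI)
    show "finite P'" using D(1) by (simp add: P'_def R_def)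
    show "(\<Union>p\<in>P'. path_edges p) = E - path_edges p \<union> path_edges p'"
      using UR by (auto simp: P'_def)
  next
    fix q assume "q \<in> P'"
    then show "distinct q" "2 \<le> length q" "rev q \<in> P'"
      using D(2,3,4)[of q] p' by (auto simp: P'_def R_def)
  next
    fix q r assume q: "q \<in> P'" and r: "r \<in> P'" and i: "path_edges q \<inter> path_edges r \<noteq> {}"
    show "r = q \<or> r = rev q"
    proof (cases "q \<in> R")
      case True
      then have "r \<in> R" using i r Rdis'[OF True] unfolding P'_def by auto
      then show ?thesis using True i D(8)[of q r] unfolding R_def by blast
    next
      case False
      then have q': "q = p' \<or> q = rev p'" using q by (auto simp: P'_def)
      then have "r \<notin> R" using Rdis'[of r] i by (auto simp: Int_commute)
      then show ?thesis using q' r by (auto simp: P'_def)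
    qed
  qed
  have E0: "ends_at P u = ends_at R u + of_bool (hd p = u) + of_bool (last p = u)" for u
    using ends_at_split[OF D(1) p D(4)[OF p] D(6)[OF p] D(5)[OF p]] by (simp add: R_def)
  have PR: "P' - {p', rev p'} = R" using p'R by (auto simp: P'_def R_def)
  have E1: "ends_at P' u = ends_at R u + of_bool (hd p' = u) + of_bool (last p' = u)" for u
    using ends_at_split[of P' p' u] p'n D(1) PR by (auto simp: P'_def R_def)
  have "card P = card R + 2"
  proof -
    have "P = R \<union> {p, rev p}" using p D(4)[OF p] by (auto simp: R_def)
    moreover have "card (R \<union> {p, rev p}) = card R + card {p, rev p}"
      using D(1) by (intro card_Un_disjoint) (auto simp: R_def)
    ultimately show ?thesis using D(6)[OF p] by simp
  qed
  moreover have "card P' = card R + 2"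
    unfolding P'_def using p'R p'n D(1) by (subst card_Un_disjoint) (auto simp: R_def)
  ultimately have 2: "card P' = card P" by simp
  show ?thesis
    by (rule that[of P']) (use 1 2 E0 E1 in \<open>auto simp: P'_def R_def\<close>)
qed

section \<open>Rotations\<close>

lemma even_card_rev_closed:
  assumes "finite S" "\<And>p. p \<in> S \<Longrightarrow> rev p \<in> S \<and> rev p \<noteq> p"
  shows "even (card S)"
  using assms
proof (induction "card S" arbitrary: S rule: less_induct)
  case less
  show ?case
  proof (cases "S = {}")
    case False
    then obtain p where p: "p \<in> S" by blast
    define S' where "S' = S - {p, rev p}"
    have S: "S = S' \<union> {p, rev p}" using p less.prems(2)[OF p] by (auto simp: S'_def)
    have c: "card S = card S' + 2"
      unfolding S using less.prems(1) less.prems(2)[OF p] p by (subst card_Un_disjoint) (auto simp: S'_def)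
    moreover have "even (card S')"
    proof (rule less.hyps)
      show "card S' < card S" using c by simp
      show "finite S'" using less.prems by (simp add: S'_def)
      fix q assume q: "q \<in> S'"
      then have "q \<in> S" by (simp add: S'_def)
      with q less.prems(2)[of q] show "rev q \<in> S' \<and> rev q \<noteq> q" by (auto simp: S'_def)
    qed
    ultimately show ?thesis by simp
  qed simp
qed

text \<open>The vertex from which \<open>p\<close> enters \<open>v\<close>. This reading requires
  that \<open>v\<close> occurs in \<open>p\<close>, but not first: a path starting at
  \<open>v\<close> yields \<open>last []\<close>, a path avoiding \<open>v\<close> its own last
  vertex.\<close>

definition pred_of :: "'a \<Rightarrow> 'a list \<Rightarrow> 'a" where
  "pred_of v p = last (takeWhile (\<lambda>u. u \<noteq> v) p)"

lemma pred_of_split: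
  assumes "v \<in> set p" "hd p \<noteq> v"
  obtains xs ys where "p = xs @ pred_of v p # v # ys"
proof -
  let ?t = "takeWhile (\<lambda>u. u \<noteq> v) p"
  from assms(1) obtain as bs where p: "p = as @ v # bs" "v \<notin> set as" by (meson split_list_first)
  then have t: "?t = as" by (subst p(1), subst takeWhile_append2) auto
  have "as \<noteq> []" using assms(2) p by (cases as) auto
  then have "as = butlast as @ [pred_of v p]" using t by (simp add: pred_of_def)
  then show ?thesis using p(1) that[of "butlast as" bs] by (metis append.assoc append_Cons append_Nil)
qed

lemma pred_of_eq:
  assumes "distinct (xs @ w # v # ys)"
  shows "pred_of v (xs @ w # v # ys) = w"
proof -
  have "takeWhile (\<lambda>u. u \<noteq> v) ((xs @ [w]) @ v # ys) = xs @ [w]"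
    using assms by (subst takeWhile_append2) auto
  then show ?thesis by (simp add: pred_of_def)
qed

lemma path_edges_neighbour: "{w, v} \<in> path_edges (xs @ w # v # ys)"
  by (simp add: path_edges_append)

lemma not_both_orders:
  assumes "distinct p" "p = xs @ w # v # ys" "p = as @ v # w # bs"
  shows False
proof -
  have d: "distinct (as @ v # w # bs)" using assms by simp
  have "takeWhile (\<lambda>u. u \<noteq> v) p = as" using d by (subst assms(3), subst takeWhile_append2) auto
  moreover have "takeWhile (\<lambda>u. u \<noteq> v) ((xs @ [w]) @ v # ys) = xs @ [w]"
    using assms(1,2) by (subst takeWhile_append2) auto
  ultimately have "as = xs @ [w]" using assms(2) by simp
  then show False using d by simp
qed

text \<open>Up to reversal one member carries the edge \<open>vw\<close>, and exactly one of its
  orientations runs from \<open>w\<close> to \<open>v\<close>. Neighbours of \<open>v\<close> thus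
  count the oriented paths that enter \<open>v\<close>, which turns the rotation argument into a
  comparison of cardinalities.\<close>

lemma pred_of_bij:
  assumes PS: "path_system E P"
  shows "bij_betw (pred_of v) {p \<in> P. v \<in> set p \<and> hd p \<noteq> v} (nb E v)"
  unfolding bij_betw_def
proof (intro conjI equalityI subsetI)
  note D = path_systemD[OF PS]
  show "inj_on (pred_of v) {p \<in> P. v \<in> set p \<and> hd p \<noteq> v}"
  proof (rule inj_onI, clarify)
    fix p q assume *: "p \<in> P" "v \<in> set p" "hd p \<noteq> v" "q \<in> P" "v \<in> set q" "hd q \<noteq> v"
      "pred_of v p = pred_of v q"
    define w where "w = pred_of v p"
    obtain xs ys where p: "p = xs @ w # v # ys" using pred_of_split[OF *(2,3)] by (metis w_def)
    obtain as bs where q: "q = as @ w # v # bs" using pred_of_split[OF *(5,6)] *(7) by (metis w_def)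
    have "{w, v} \<in> path_edges p" "{w, v} \<in> path_edges q" by (simp_all add: p q path_edges_neighbour)
    then have "q = p \<or> q = rev p" using D(8) * by blast
    moreover have "q \<noteq> rev p"
    proof
      assume "q = rev p"
      then have "q = rev ys @ v # w # rev xs" by (simp add: p)
      with q show False using not_both_orders[OF D(2)[OF *(4)]] by blast
    qed
    ultimately show "p = q" by simp
  qed
  fix w assume "w \<in> pred_of v ` {p \<in> P. v \<in> set p \<and> hd p \<noteq> v}"
  then obtain p where p: "p \<in> P" "v \<in> set p" "hd p \<noteq> v" "w = pred_of v p" by blast
  then obtain xs ys where "p = xs @ w # v # ys" using pred_of_split by metis
  then have "{w, v} \<in> E" using D(7)[OF p(1)] path_edges_neighbour[of w v xs ys] by blast
  then show "w \<in> nb E v" by (simp add: nb_def insert_commute)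
next
  note D = path_systemD[OF PS]
  fix w assume "w \<in> nb E v"
  then obtain p where p: "p \<in> P" "{v, w} \<in> path_edges p" using D(9) by (auto simp: nb_def)
  obtain xs ys where "p = xs @ v # w # ys \<or> p = xs @ w # v # ys" using path_edges_split[OF p(2)] by blast
  then have "p = xs @ w # v # ys \<or> rev p = rev ys @ w # v # rev xs" by auto
  then obtain q as bs where q: "q \<in> P" "q = as @ w # v # bs" using p(1) D(4)[OF p(1)] by metis
  then have d: "distinct (as @ w # v # bs)" using D(2) by blast
  have "w = pred_of v q" using pred_of_eq[OF d] q(2) by simp
  moreover have "v \<in> set q" "hd q \<noteq> v" using d q(2) by (auto simp: hd_append)
  ultimately show "w \<in> pred_of v ` {p \<in> P. v \<in> set p \<and> hd p \<noteq> v}" using q(1) by blast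
qed

lemma finite_nb: "path_system E P \<Longrightarrow> finite (nb E v)"
  using bij_betw_finite[OF pred_of_bij[of E P v]] path_systemD(1)[of E P] by simp

lemma not_in_nb: "path_system E P \<Longrightarrow> v \<notin> nb E v"
  using path_systemD(9)[of E P "{v}"] path_edges_doubleton[of "{v}"] path_systemD(2)[of E P]
  by (auto simp: nb_def)

text \<open>Members through \<open>v\<close> come in reversed pairs. Those not starting at
  \<open>v\<close> are as many as the neighbours of \<open>v\<close>, the others are its
  ends.\<close>

lemma even_degree_plus_ends:
  assumes PS: "path_system E P"
  shows "even (card (nb E v) + ends_at P v)"
proof -
  note D = path_systemD[OF PS]
  let ?S = "{p \<in> P. v \<in> set p}" and ?T = "{p \<in> P. v \<in> set p \<and> hd p \<noteq> v}" and ?U = "{p \<in> P. hd p = v}"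
  have "?S = ?T \<union> ?U" using D(5) hd_in_set by fastforce
  then have "card ?S = card ?T + card ?U" using D(1) by (subst card_Un_disjoint[symmetric]) auto
  moreover have "card ?T = card (nb E v)" using bij_betw_same_card[OF pred_of_bij[OF PS]] .
  moreover have "even (card ?S)"
    using D(1,4,6) by (intro even_card_rev_closed) auto
  ultimately show ?thesis by (simp add: ends_at_def)
qed

lemma odd_degree_ends: "path_system E P \<Longrightarrow> odd (card (nb E v)) \<Longrightarrow> 1 \<le> ends_at P v"
  using even_degree_plus_ends[of E P v] by (cases "ends_at P v") auto

lemma even_card_path_system: "path_system E P \<Longrightarrow> even (card P)"
  by (intro even_card_rev_closed) (auto dest: path_systemD)

section \<open>The rotation argument of Lovasz\<close>

definition shifts_end :: "'a list set \<Rightarrow> 'a list set \<Rightarrow> 'a \<Rightarrow> 'a \<Rightarrow> bool" where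
  "shifts_end P P' x v \<longleftrightarrow> card P' = card P \<and> ends_at P' v = ends_at P v + 1 \<and>
     ends_at P' x + 1 = ends_at P x \<and> (\<forall>u. u \<noteq> v \<longrightarrow> u \<noteq> x \<longrightarrow> ends_at P' u = ends_at P u)"

text \<open>A chain encodes a sequence of rotations at \<open>v\<close>: each path but the last is turned around so
  that the edge at \<open>v\<close> moves from the next start vertex to its own start, and the
  last path avoids \<open>v\<close> and is lengthened.\<close>

fun chain :: "'a list set \<Rightarrow> 'a \<Rightarrow> 'a \<Rightarrow> 'a list list \<Rightarrow> bool" where
  "chain P v x [] \<longleftrightarrow> False"
| "chain P v x [p] \<longleftrightarrow> p \<in> P \<and> hd p = x \<and> v \<notin> set p"
| "chain P v x (p # q # ps) \<longleftrightarrow> p \<in> P \<and> hd p = x \<and> v \<in> set p \<and> chain P v (pred_of v p) (q # ps)"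

lemma chain_suffix:
  "chain P v x (ps @ q # qs) \<Longrightarrow> chain P v (hd q) (q # qs)"
proof (induction ps arbitrary: x)
  case Nil
  then show ?case by (cases qs) auto
next
  case (Cons a ps)
  then show ?case by (cases "ps @ q # qs") auto
qed

text \<open>A rotation changes a single path in both orientations; this carries the rest of a chain
  over to the new system.\<close>

lemma chain_map:
  assumes "chain P v x ps" "\<And>q. q \<in> set ps \<Longrightarrow> q \<in> P \<Longrightarrow> f q \<in> P' \<and> hd (f q) = hd q \<and> set (f q) = set q
    \<and> pred_of v (f q) = pred_of v q"
  shows "chain P' v x (map f ps)"
  using assms by (induction P v x ps rule: chain.induct) auto

text \<open>One rotation trades the missing edge \<open>vx\<close> for a missing edge
  \<open>vw\<close>, where \<open>w\<close> precedes \<open>v\<close> on the first path, and moves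
  an end from \<open>x\<close> to \<open>w\<close>. The tail of the chain starts at \<open>w\<close>
  and by induction moves that end on to \<open>v\<close>.\<close>

lemma chain_imp_add:
  assumes "path_system E P" "{v, x} \<notin> E" "v \<noteq> x" "chain P v x ps"
  shows "\<exists>P'. path_system (insert {v, x} E) P' \<and> shifts_end P P' x v"
  using assms
proof (induction "length ps" arbitrary: ps E P x rule: less_induct)
  case less
  note PS = less.prems(1)
  note D = path_systemD[OF PS]
  obtain p rest where ps: "ps = p # rest" using less.prems(4) by (cases ps) auto
  have p: "p \<in> P" "hd p = x" using less.prems(4) ps by (cases rest; auto)+
  consider "rest = []" | "p \<in> set rest" | "rest \<noteq> []" "p \<notin> set rest" by blast
  then show ?case
  proof cases
    case 1
    then have v: "v \<notin> set p" using less.prems(4) ps by simp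
    obtain y ys where py: "p = y # ys" "y = x" using p D(5)[OF p(1)] by (cases p) auto
    have e: "path_edges (v # p) = insert {v, x} (path_edges p)" using py by simp
    obtain P' where P': "path_system ((E - path_edges p) \<union> path_edges (v # p)) P'" "card P' = card P"
      "\<And>u. ends_at P' u + of_bool (hd p = u) + of_bool (last p = u) =
         ends_at P u + of_bool (hd (v # p) = u) + of_bool (last (v # p) = u)"
      by (rule path_system_replace[OF PS p(1), of "v # p" "{v, x}"])
        (use v e less.prems(2) D(2,3)[OF p(1)] in auto)
    have "(E - path_edges p) \<union> path_edges (v # p) = insert {v, x} E" using e D(7)[OF p(1)] by auto
    moreover have "last (v # p) = last p" using py by simp
    then have c: "ends_at P' u + of_bool (x = u) = ends_at P u + of_bool (v = u)" for u
      using P'(3)[of u] p(2) by simp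
    have "shifts_end P P' x v"
      unfolding shifts_end_def
    proof (intro conjI allI impI)
      fix u assume "u \<noteq> v" "u \<noteq> x"
      then show "ends_at P' u = ends_at P u" using c[of u] by simp
    qed (use P'(2) less.prems(3) c[of v] c[of x] in auto)
    ultimately show ?thesis using P'(1) by auto
  next
    case 2
    \<comment> \<open>The rotated path must not occur again in the same orientation; if it does, the
      chain is cut down to the later occurrence.\<close>
    then obtain as bs where "rest = as @ p # bs" by (meson split_list)
    then have "chain P v x (p # bs)" using chain_suffix[of P v x "p # as" p bs] less.prems(4) ps p(2) by simp
    moreover have "length (p # bs) < length ps" using ps \<open>rest = as @ p # bs\<close> by simp
    ultimately show ?thesis using less.hyps less.prems(1-3) by blast
  next
    case 3
    define w where "w = pred_of v p"
    from 3 have v: "v \<in> set p" and ch: "chain P v w rest"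
      using less.prems(4) ps by (cases rest; auto simp: w_def)+
    obtain ys zs where pyz: "p = ys @ w # v # zs"
      using pred_of_split[OF v] p(2) less.prems(3) by (metis w_def)
    have dp: "distinct p" using D(2)[OF p(1)] .
    have wE: "{v, w} \<in> E" using D(7)[OF p(1)] path_edges_neighbour[of w v ys zs]
      by (auto simp: pyz insert_commute)
    then have "w \<noteq> x" using less.prems(2) by auto
    then obtain ys' where ys: "ys = x # ys'" using p(2) pyz by (cases ys) auto
    \<comment> \<open>\<open>p\<close> runs from \<open>x\<close> through \<open>w\<close> to
      \<open>v\<close>; \<open>p'\<close> runs back from \<open>w\<close> to \<open>x\<close> and
      continues with \<open>v\<close>, so \<open>vx\<close> replaces \<open>wv\<close> and the part
      after \<open>v\<close> stays.\<close>
    define p' where "p' = (w # rev ys') @ x # v # zs"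
    have dp': "distinct p'" "2 \<le> length p'" and sp: "set p' = set p"
      using dp unfolding pyz ys p'_def by auto
    have pe: "path_edges p = insert {v, w} (path_edges (ys @ [w]) \<union> path_edges (v # zs))"
      unfolding pyz path_edges_append by (simp add: insert_commute)
    have pe': "path_edges p' = insert {v, x} (path_edges (ys @ [w]) \<union> path_edges (v # zs))"
    proof -
      have "path_edges p' = insert {x, v} (path_edges ((w # rev ys') @ [x]) \<union> path_edges (v # zs))"
        unfolding p'_def path_edges_append ..
      moreover have "(w # rev ys') @ [x] = rev (ys @ [w])" by (simp add: ys)
      ultimately show ?thesis by (simp only: path_edges_rev) (simp add: insert_commute)
    qed
    have nw: "{v, w} \<notin> path_edges (ys @ [w]) \<union> path_edges (v # zs)"
      using path_edges_subset[of "{v, w}" "ys @ [w]"] path_edges_subset[of "{v, w}" "v # zs"] dp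
      unfolding pyz by auto
    obtain P1 where P1: "P1 = (P - {p, rev p}) \<union> {p', rev p'}"
      "path_system ((E - path_edges p) \<union> path_edges p') P1" "card P1 = card P"
      "\<And>u. ends_at P1 u + of_bool (hd p = u) + of_bool (last p = u) =
         ends_at P u + of_bool (hd p' = u) + of_bool (last p' = u)"
      by (rule path_system_replace[OF PS p(1) dp', of "{v, x}"]) (use pe pe' less.prems(2) in auto)
    define E1 where "E1 = (E - path_edges p) \<union> path_edges p'"
    have E1: "insert {v, w} E1 = insert {v, x} E" "{v, w} \<notin> E1"
      using pe pe' nw D(7)[OF p(1)] wE less.prems(2) \<open>w \<noteq> x\<close> unfolding E1_def by (auto simp: doubleton_eq_iff)
    have hl: "hd p' = w" "last p' = last p" by (auto simp: p'_def pyz)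
    \<comment> \<open>The reversed path may still occur in the tail. It enters \<open>v\<close> from
      the side that the rotation leaves alone, so \<open>rev p'\<close> can take its place.\<close>
    define f where "f = (\<lambda>q. if q = rev p then rev p' else q)"
    have "chain P1 v w (map f rest)"
    proof (rule chain_map[OF ch])
      fix q assume q: "q \<in> set rest" "q \<in> P"
      show "f q \<in> P1 \<and> hd (f q) = hd q \<and> set (f q) = set q \<and> pred_of v (f q) = pred_of v q"
      proof (cases "q = rev p")
        case True
        have "v \<notin> set zs" using dp pyz by simp
        then have "pred_of v (rev p') = pred_of v (rev p)"
          by (simp add: p'_def pyz pred_of_def takeWhile_append2 takeWhile_tail)
        moreover have "hd (rev p') = hd (rev p)" using hl(2) by (simp add: hd_rev)
        ultimately show ?thesis using True sp P1(1) by (simp add: f_def)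
      next
        case False
        then show ?thesis using q 3 P1(1) by (auto simp: f_def)
      qed
    qed
    moreover have "length (map f rest) < length ps" by (simp add: ps)
    moreover have "v \<noteq> w" using dp pyz by auto
    ultimately obtain P2 where P2: "path_system (insert {v, w} E1) P2" "shifts_end P1 P2 w v"
      using less.hyps[of "map f rest" E1 P1 w] P1(2) E1(2) unfolding E1_def by blast
    have c: "ends_at P1 u + of_bool (x = u) = ends_at P u + of_bool (w = u)" for u
      using P1(4)[of u] hl p(2) by simp
    have "shifts_end P P2 x v"
      unfolding shifts_end_def
    proof (intro conjI allI impI)
      show "card P2 = card P" using P2(2) P1(3) by (simp add: shifts_end_def)
      show "ends_at P2 v = ends_at P v + 1"
        using P2(2) c[of v] \<open>v \<noteq> w\<close> less.prems(3) by (simp add: shifts_end_def)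
      show "ends_at P2 x + 1 = ends_at P x"
        using P2(2) c[of x] \<open>w \<noteq> x\<close> less.prems(3) by (simp add: shifts_end_def)
      fix u assume "u \<noteq> v" "u \<noteq> x"
      then show "ends_at P2 u = ends_at P u"
        using P2(2) c[of u] by (cases "u = w") (auto simp: shifts_end_def)
    qed
    then show ?thesis using P2(1) E1(1) by auto
  qed
qed

text \<open>If no chain starts in \<open>X\<close>, every oriented path that starts in \<open>X\<close> or in a
  neighbour of \<open>v\<close> without chain leads to a neighbour without chain. This map is injective, and
  there are too many such paths.\<close>

lemma chain_exists:
  assumes PS: "path_system E P" and X: "finite X" "v \<notin> X" "\<And>x. x \<in> X \<Longrightarrow> {v, x} \<notin> E"
    and less: "card {w \<in> nb E v. ends_at P w = 0} < (\<Sum>x\<in>X. ends_at P x)"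
  shows "\<exists>x\<in>X. \<exists>ps. chain P v x ps"
proof (rule ccontr)
  assume none: "\<not> ?thesis"
  note D = path_systemD[OF PS]
  define W where "W = {w \<in> nb E v. \<nexists>ps. chain P v w ps}"
  define R where "R = {p \<in> P. hd p \<in> X \<union> W}"
  have fW: "finite W" using finite_nb[OF PS] by (simp add: W_def)
  have vXW: "v \<notin> X \<union> W" using X(2) not_in_nb[OF PS] by (simp add: W_def)
  have XW: "X \<inter> W = {}" using X(3) by (auto simp: W_def nb_def)
  have R: "v \<in> set p \<and> hd p \<noteq> v \<and> pred_of v p \<in> W" if "p \<in> R" for p
  proof -
    from that have p: "p \<in> P" "hd p \<in> X \<union> W" by (auto simp: R_def)
    then have no: "\<nexists>ps. chain P v (hd p) ps" using none by (auto simp: W_def)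
    then have v: "v \<in> set p" using p(1) chain.simps(2)[of P v "hd p" p] by blast
    have h: "hd p \<noteq> v" using p(2) vXW by auto
    have "pred_of v p \<in> nb E v" using pred_of_bij[OF PS, of v] p(1) v h by (auto simp: bij_betw_def)
    moreover have "\<nexists>ps. chain P v (pred_of v p) ps"
    proof
      assume "\<exists>ps. chain P v (pred_of v p) ps"
      then obtain ps where ps: "chain P v (pred_of v p) ps" by blast
      then obtain q qs where "ps = q # qs" by (cases ps) auto
      then have "chain P v (hd p) (p # q # qs)" using ps p(1) v by simp
      with no show False by blast
    qed
    ultimately show ?thesis using v h by (simp add: W_def)
  qed
  have "inj_on (pred_of v) R"
    by (rule inj_on_subset[OF bij_betw_imp_inj_on[OF pred_of_bij[OF PS, of v]]])
      (use R in \<open>auto simp: R_def\<close>)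
  then have "card R \<le> card W" using R fW by (intro card_inj_on_le[of "pred_of v"]) auto
  moreover have "card R = (\<Sum>y\<in>X \<union> W. ends_at P y)"
  proof -
    have "R = (\<Union>y\<in>X \<union> W. {p \<in> P. hd p = y})" by (auto simp: R_def)
    then show ?thesis
      unfolding ends_at_def using X(1) fW D(1) by (simp only:) (subst card_UN_disjoint, auto)
  qed
  moreover have "\<dots> = (\<Sum>x\<in>X. ends_at P x) + (\<Sum>w\<in>W. ends_at P w)"
    using X(1) fW XW by (simp add: sum.union_disjoint)
  \<comment> \<open>A neighbour with an end pays for itself, so only neighbours without ends can
    offset the ends in \<open>X\<close>.\<close>
  moreover have "card W \<le> card {w \<in> nb E v. ends_at P w = 0} + (\<Sum>w\<in>W. ends_at P w)"
  proof -
    let ?Z = "{w \<in> W. ends_at P w = 0}" and ?N = "{w \<in> W. ends_at P w \<noteq> 0}"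
    have "card W = card ?Z + card ?N"
      using fW by (subst card_Un_disjoint[symmetric]) (auto intro: arg_cong[where f = card])
    moreover have "card ?Z \<le> card {w \<in> nb E v. ends_at P w = 0}"
      using finite_nb[OF PS] by (intro card_mono) (auto simp: W_def)
    moreover have "card ?N \<le> (\<Sum>w\<in>?N. ends_at P w)"
      using sum_mono[of ?N "\<lambda>_. 1" "ends_at P"] by (simp add: Suc_le_eq)
    moreover have "(\<Sum>w\<in>?N. ends_at P w) \<le> (\<Sum>w\<in>W. ends_at P w)"
      using fW by (intro sum_mono2) auto
    ultimately show ?thesis by linarith
  qed
  ultimately show False using less by linarith
qed

text \<open>Which \<open>x\<close> succeeds is beyond control; in exchange the ends of all
  candidates are counted together.\<close>

lemma add_some_edge:
  assumes "path_system E P" "finite X" "v \<notin> X" "\<And>x. x \<in> X \<Longrightarrow> {v, x} \<notin> E"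
    and "card {w \<in> nb E v. ends_at P w = 0} < (\<Sum>x\<in>X. ends_at P x)"
  shows "\<exists>x\<in>X. \<exists>P'. path_system (insert {v, x} E) P' \<and> shifts_end P P' x v"
  using chain_exists[OF assms] chain_imp_add[OF assms(1)] assms(3,4) by metis

lemma add_edge:
  assumes "path_system E P" "{v, x} \<notin> E" "v \<noteq> x"
    and "card {w \<in> nb E v. ends_at P w = 0} < ends_at P x"
  obtains P' where "path_system (insert {v, x} E) P'" "shifts_end P P' x v"
  using add_some_edge[OF assms(1), of "{x}" v] assms(2-4) by auto

lemma add_edge_good:
  assumes "path_system E P" "{v, x} \<notin> E" "v \<noteq> x" "1 \<le> ends_at P x"
    and "\<And>w. w \<in> nb E v \<Longrightarrow> 1 \<le> ends_at P w"
  obtains P' where "path_system (insert {v, x} E) P'" "shifts_end P P' x v"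
proof -
  have "{w \<in> nb E v. ends_at P w = 0} = {}" using assms(5) by force
  then have "card {w \<in> nb E v. ends_at P w = 0} < ends_at P x" using assms(4) by (simp only:) simp
  then show ?thesis using add_edge[OF assms(1-3)] that by blast
qed

section \<open>Reductions of connected graphs\<close>

definition star :: "'a \<Rightarrow> 'a set \<Rightarrow> 'a set set" where
  "star v X = (\<lambda>x. {v, x}) ` X"

lemma nb_empty [simp]: "nb {} t = {}"
  by (simp add: nb_def)

lemma nb_Un [simp]: "nb (A \<union> B) t = nb A t \<union> nb B t"
  by (auto simp: nb_def)

lemma nb_Diff: "nb (A - B) t = nb A t - nb B t"
  by (auto simp: nb_def)

lemma nb_insert: "a \<noteq> x \<Longrightarrow> nb (insert {a, x} S) t =
    (if t = a then insert x (nb S t) else if t = x then insert a (nb S t) else nb S t)"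
  by (auto simp: nb_def doubleton_eq_iff)

lemma nb_star: "v \<notin> X \<Longrightarrow> nb (star v X) t = (if t = v then X else if t \<in> X then {v} else {})"
  by (auto simp: nb_def star_def doubleton_eq_iff)

lemma star_empty [simp]: "star v {} = {}"
  by (simp add: star_def)

lemma star_insert [simp]: "star v (insert x X) = insert {v, x} (star v X)"
  by (simp add: star_def)

lemma star_Un: "star v (X \<union> Y) = star v X \<union> star v Y"
  by (simp add: star_def image_Un)

lemma in_nb_sym: "u \<in> nb E v \<longleftrightarrow> v \<in> nb E u"
  by (simp add: nb_def insert_commute)

lemma edge_iff_nb: "{v, u} \<in> E \<longleftrightarrow> u \<in> nb E v"
  by (simp add: nb_def)

text \<open>Take a largest addable \<open>A\<close>. Edges added at \<open>v\<close> take ends only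
  from vertices of \<open>A\<close>, so at most \<open>card A\<close> neighbours of \<open>v\<close>
  lack ends, while every vertex of \<open>X - A\<close> still has one. If \<open>X - A\<close> were
  larger than \<open>A\<close>, a further edge could be added.\<close>

lemma add_star:
  assumes PS: "path_system E P" and X: "finite X" "v \<notin> X" "X \<inter> nb E v = {}"
    and ge: "\<And>x. x \<in> X \<Longrightarrow> 1 \<le> ends_at P x" "\<And>w. w \<in> nb E v \<Longrightarrow> 1 \<le> ends_at P w"
  obtains A P' where "A \<subseteq> X" "card (X - A) \<le> card A" "path_system (E \<union> star v A) P'"
    "card P' = card P" "ends_at P' v = ends_at P v + card A"
    "\<And>u. u \<noteq> v \<Longrightarrow> u \<notin> A \<Longrightarrow> ends_at P' u = ends_at P u"
proof -
  let ?Q = "\<lambda>A P'. A \<subseteq> X \<and> path_system (E \<union> star v A) P' \<and> card P' = card P \<and>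
    ends_at P' v = ends_at P v + card A \<and> (\<forall>u. u \<noteq> v \<longrightarrow> u \<notin> A \<longrightarrow> ends_at P' u = ends_at P u)"
  let ?S = "{A. \<exists>P'. ?Q A P'}"
  have "finite ?S" by (rule finite_subset[of _ "Pow X"]) (use X(1) in auto)
  moreover have "{} \<in> ?S" using PS by auto
  ultimately have "Max (card ` ?S) \<in> card ` ?S" by (intro Max_in) blast+
  then obtain A where A: "A \<in> ?S" "card A = Max (card ` ?S)" by (metis (no_types, lifting) imageE)
  have max: "card A' \<le> card A" if "A' \<in> ?S" for A'
    unfolding A(2) using that \<open>finite ?S\<close> by (intro Max_ge) auto
  from A obtain P1 where P1: "?Q A P1" by blast
  have fA: "finite A" using P1 X(1) finite_subset by blast
  have "card (X - A) \<le> card A"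
  proof (rule ccontr)
    assume "\<not> ?thesis"
    then have lt: "card A < card (X - A)" by simp
    have vA: "v \<notin> A" using P1 X(2) by blast
    have nbv: "nb (E \<union> star v A) v = nb E v \<union> A" using vA by (simp add: nb_star)
    have zeros: "{w \<in> nb (E \<union> star v A) v. ends_at P1 w = 0} \<subseteq> A"
    proof
      fix w assume w: "w \<in> {w \<in> nb (E \<union> star v A) v. ends_at P1 w = 0}"
      show "w \<in> A"
      proof (rule ccontr)
        assume "w \<notin> A"
        then have "w \<in> nb E v" "w \<noteq> v" using w nbv not_in_nb[OF PS] by auto
        then show False using P1 w \<open>w \<notin> A\<close> ge(2)[of w] by auto
      qed
    qed
    have "card {w \<in> nb (E \<union> star v A) v. ends_at P1 w = 0} \<le> card A"
      using zeros fA card_mono by blast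
    also have "\<dots> < card (X - A)" by (rule lt)
    also have "\<dots> \<le> (\<Sum>x\<in>X - A. ends_at P1 x)"
    proof -
      have "1 \<le> ends_at P1 x" if "x \<in> X - A" for x
        using that P1 ge(1)[of x] X(2) by (metis Diff_iff)
      then show ?thesis using sum_mono[of "X - A" "\<lambda>_. 1" "ends_at P1"] by simp
    qed
    finally obtain x P2 where x: "x \<in> X - A" "path_system (insert {v, x} (E \<union> star v A)) P2" "shifts_end P1 P2 x v"
      using add_some_edge[of "E \<union> star v A" P1 "X - A" v] P1 X nbv by (auto simp: edge_iff_nb)
    have "?Q (insert x A) P2"
    proof (intro conjI allI impI)
      show "insert x A \<subseteq> X" using x P1 by auto
      show "path_system (E \<union> star v (insert x A)) P2" using x(2) by simp
      show "card P2 = card P" "ends_at P2 v = ends_at P v + card (insert x A)"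
        using x P1 fA by (auto simp: shifts_end_def)
      fix u assume "u \<noteq> v" "u \<notin> insert x A"
      then show "ends_at P2 u = ends_at P u" using x(3) P1 by (auto simp: shifts_end_def)
    qed
    then have "insert x A \<in> ?S" by blast
    then have "card (insert x A) \<le> card A" by (rule max)
    then show False using x(1) fA by simp
  qed
  then show ?thesis using P1 that by blast
qed

text \<open>Here the edges return at the leaves and \<open>b\<close> pays. Before the last one
  \<open>b\<close> still has \<open>t + 1\<close> ends, more than there are neighbours without ends
  at that leaf. Until then no new vertex without ends appears, because only \<open>b\<close> loses
  ends and it has some left.\<close>

lemma add_leaves:
  assumes "finite L" "path_system E P" "b \<notin> L" "L \<inter> nb E b = {}"
    and "\<And>a. a \<in> L \<Longrightarrow> card {w \<in> nb E a. ends_at P w = 0} \<le> t"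
    and "card L + t \<le> ends_at P b"
  shows "\<exists>P'. path_system (E \<union> star b L) P' \<and> card P' = card P \<and> ends_at P' b + card L = ends_at P b \<and>
    (\<forall>a\<in>L. ends_at P' a = ends_at P a + 1) \<and> (\<forall>u. u \<noteq> b \<longrightarrow> u \<notin> L \<longrightarrow> ends_at P' u = ends_at P u)"
  using assms
proof (induction L arbitrary: E P rule: finite_induct)
  case empty
  then show ?case by auto
next
  case (insert a L)
  have ab: "a \<noteq> b" "a \<notin> nb E b" using insert.prems by auto
  have "card {w \<in> nb E a. ends_at P w = 0} < ends_at P b"
    using insert.prems(4)[of a] insert.prems(5) insert.hyps by simp
  then obtain P1 where P1: "path_system (insert {a, b} E) P1" "shifts_end P P1 b a"
    using add_edge[of E P a b] insert.prems(1) ab by (metis edge_iff_nb in_nb_sym)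
  note s = P1(2)[unfolded shifts_end_def]
  have "\<exists>P'. path_system (insert {a, b} E \<union> star b L) P' \<and> card P' = card P1 \<and>
    ends_at P' b + card L = ends_at P1 b \<and>
    (\<forall>a\<in>L. ends_at P' a = ends_at P1 a + 1) \<and> (\<forall>u. u \<noteq> b \<longrightarrow> u \<notin> L \<longrightarrow> ends_at P' u = ends_at P1 u)"
  proof (rule insert.IH[OF P1(1)])
    show "b \<notin> L" using insert.prems(2) by simp
    show "L \<inter> nb (insert {a, b} E) b = {}" using insert.prems(3) insert.hyps ab by (auto simp: nb_insert)
    show b: "card L + t \<le> ends_at P1 b" using s insert.prems(5) insert.hyps by simp
    fix a' assume a': "a' \<in> L"
    then have "0 < card L" using insert.hyps by (auto simp: card_gt_0_iff)
    then have b0: "ends_at P1 b \<noteq> 0" using b by simp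
    have nba: "nb (insert {a, b} E) a' = nb E a'"
      using a' insert.hyps(2) insert.prems(2) ab by (auto simp: nb_insert)
    have "ends_at P w = 0" if "ends_at P1 w = 0" for w
      using s that b0 by (cases "w = a"; cases "w = b") auto
    then have "{w \<in> nb (insert {a, b} E) a'. ends_at P1 w = 0} \<subseteq> {w \<in> nb E a'. ends_at P w = 0}"
      by (auto simp: nba)
    then have "card {w \<in> nb (insert {a, b} E) a'. ends_at P1 w = 0} \<le> card {w \<in> nb E a'. ends_at P w = 0}"
      using finite_nb[OF insert.prems(1)] by (intro card_mono) auto
    then show "card {w \<in> nb (insert {a, b} E) a'. ends_at P1 w = 0} \<le> t"
      using insert.prems(4)[of a'] a' by simp
  qed
  then obtain P' where P': "path_system (insert {a, b} E \<union> star b L) P'" "card P' = card P1"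
    "ends_at P' b + card L = ends_at P1 b" "\<And>a. a \<in> L \<Longrightarrow> ends_at P' a = ends_at P1 a + 1"
    "\<And>u. u \<noteq> b \<Longrightarrow> u \<notin> L \<Longrightarrow> ends_at P' u = ends_at P1 u" by blast
  have "insert {a, b} E \<union> star b L = E \<union> star b (insert a L)" by (auto simp: insert_commute)
  moreover have "\<forall>a'\<in>insert a L. ends_at P' a' = ends_at P a' + 1"
  proof
    fix a' assume "a' \<in> insert a L"
    then consider "a' = a" | "a' \<in> L" "a' \<noteq> a" "a' \<noteq> b" using insert.prems(2) insert.hyps(2) by auto
    then show "ends_at P' a' = ends_at P a' + 1"
      by cases (use P'(4)[of a'] P'(5)[of a] s ab(1) insert.hyps(2) in auto)
  qed
  moreover have "\<forall>u. u \<noteq> b \<longrightarrow> u \<notin> insert a L \<longrightarrow> ends_at P' u = ends_at P u"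
    using P'(5) s by auto
  moreover have "ends_at P' b + card (insert a L) = ends_at P b" using P'(3) s insert.hyps by simp
  ultimately show ?case using P'(1,2) s by auto
qed

section \<open>Edge sets on a vertex set, closed parts and SET parts\<close>

definition graph_on :: "'a set \<Rightarrow> 'a set set \<Rightarrow> bool" where
  "graph_on V E \<longleftrightarrow> finite V \<and> E \<subseteq> {{u, v} | u v. u \<in> V \<and> v \<in> V \<and> u \<noteq> v}"

definition evens :: "'a set \<Rightarrow> 'a set set \<Rightarrow> 'a set" where
  "evens V E = {v \<in> V. even (card (nb E v))}"

definition sparse_evens :: "'a set \<Rightarrow> 'a set set \<Rightarrow> bool" where
  "sparse_evens V E \<longleftrightarrow> (\<forall>v\<in>evens V E. card (nb E v \<inter> evens V E) \<le> 3)"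

definition closed_part :: "'a set set \<Rightarrow> 'a set \<Rightarrow> bool" where
  "closed_part E C \<longleftrightarrow> (\<forall>u\<in>C. nb E u \<subseteq> C)"

text \<open>For closed \<open>C\<close> such a part is automatically a single component, since each
  of its further vertices has a neighbour in the triangle.\<close>

definition SET_part :: "'a set \<Rightarrow> 'a set set \<Rightarrow> 'a set \<Rightarrow> bool" where
  "SET_part V E C \<longleftrightarrow> (\<exists>a b c. a \<noteq> b \<and> b \<noteq> c \<and> a \<noteq> c \<and> {a, b} \<in> E \<and> {b, c} \<in> E \<and> {a, c} \<in> E \<and>
     C \<inter> evens V E = {a, b, c} \<and> (\<forall>v\<in>C - {a, b, c}. 2 \<le> card (nb E v \<inter> {a, b, c})))"

definition SET_free :: "'a set \<Rightarrow> 'a set set \<Rightarrow> bool" where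
  "SET_free V E \<longleftrightarrow> (\<forall>C\<subseteq>V. closed_part E C \<longrightarrow> \<not> SET_part V E C)"

text \<open>Every path is counted in both directions, so \<open>card V\<close> stands for \<open>card V div 2\<close> paths.\<close>

definition decomposable :: "'a set \<Rightarrow> 'a set set \<Rightarrow> bool" where
  "decomposable V E \<longleftrightarrow> (\<exists>P. path_system E P \<and> card P \<le> card V)"

lemma graph_onD:
  assumes "graph_on V E"
  shows "finite V" "finite E" "u \<in> nb E v \<Longrightarrow> u \<in> V" "u \<in> nb E v \<Longrightarrow> v \<in> V" "v \<notin> nb E v"
    "finite (nb E v)" "B \<subseteq> E \<Longrightarrow> graph_on V B" "B \<subseteq> E \<Longrightarrow> finite (nb B v)"
proof -
  show V: "finite V" using assms by (simp add: graph_on_def)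
  have "E \<subseteq> Pow V" using assms by (auto simp: graph_on_def)
  then show "finite E" using V finite_subset by blast
  show *: "u \<in> nb E v \<Longrightarrow> u \<in> V" for u using assms by (auto simp: graph_on_def nb_def doubleton_eq_iff)
  show "u \<in> nb E v \<Longrightarrow> v \<in> V" "v \<notin> nb E v"
    using assms by (auto simp: graph_on_def nb_def doubleton_eq_iff)
  show f: "finite (nb E v)" using V * finite_subset[of "nb E v" V] by blast
  show "B \<subseteq> E \<Longrightarrow> graph_on V B" using assms by (auto simp: graph_on_def)
  show "B \<subseteq> E \<Longrightarrow> finite (nb B v)" using f by (rule rev_finite_subset) (auto simp: nb_def)
qed

lemma evens_Diff:
  assumes "graph_on V E" "B \<subseteq> E"
  shows "t \<in> evens V (E - B) \<longleftrightarrow> t \<in> V \<and> (t \<in> evens V E \<longleftrightarrow> even (card (nb B t)))"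
proof -
  have "nb B t \<subseteq> nb E t" using assms(2) by (auto simp: nb_def)
  then have "card (nb (E - B) t) = card (nb E t) - card (nb B t)" "card (nb B t) \<le> card (nb E t)"
    using graph_onD(6,8)[OF assms(1)] assms(2) by (auto simp: nb_Diff card_Diff_subset card_mono)
  then show ?thesis by (auto simp: evens_def)
qed

lemma evens_in_V: "v \<in> evens V E \<Longrightarrow> v \<in> V"
  by (simp add: evens_def)

text \<open>The setting of one induction step. Connectedness is phrased through closed parts, to
  match \<open>SET_free\<close>. The hypothesis ranges over vertex sets too, because removing a leaf
  also removes a vertex.\<close>

locale connected_step =
  fixes V :: "'a set" and E :: "'a set set"
  assumes gr: "graph_on V E"
    and conn: "\<And>C. C \<subseteq> V \<Longrightarrow> closed_part E C \<Longrightarrow> C = {} \<or> C = V"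
    and IH: "\<And>(V' :: 'a set) E'. graph_on V' E' \<Longrightarrow> card E' + card V' < card E + card V \<Longrightarrow>
      sparse_evens V' E' \<Longrightarrow> SET_free V' E' \<Longrightarrow> decomposable V' E'"
begin

abbreviation F :: "'a set" where "F \<equiv> evens V E"

lemmas grD = graph_onD[OF gr]

lemma IH_Diff:
  assumes "B \<subseteq> E" "B \<noteq> {}" "sparse_evens V (E - B)" "SET_free V (E - B)"
  shows "\<exists>P. path_system (E - B) P \<and> card P \<le> card V"
proof -
  have "card (E - B) < card E" using assms(1,2) grD(2) by (intro psubset_card_mono) auto
  then show ?thesis
    using IH[of V "E - B"] assms grD(7)[of "E - B"] unfolding decomposable_def by auto
qed

text \<open>A part that meets no removed edge would be closed in \<open>E\<close> already, hence all
  of \<open>V\<close>, which contains the endpoints of the removed edges.\<close>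

lemma touched:
  assumes "B \<subseteq> E" "B \<noteq> {}" "closed_part (E - B) K" "K \<subseteq> V" "K \<noteq> {}"
  shows "\<exists>t\<in>K. nb B t \<noteq> {}"
proof (rule ccontr)
  assume n: "\<not> ?thesis"
  then have "closed_part E K" using assms(3) unfolding closed_part_def nb_Diff by blast
  then have "K = V" using conn[OF assms(4)] assms(5) by blast
  obtain e where e: "e \<in> B" using assms(2) by blast
  then obtain u v where "e = {u, v}" "u \<in> V" using assms(1) gr by (auto simp: graph_on_def)
  then have "v \<in> nb B u" "u \<in> K" using e \<open>K = V\<close> by (auto simp: nb_def)
  then show False using n by blast
qed

text \<open>By \<open>touched\<close>, a SET part created by the removal contains an endpoint
  \<open>t\<close> of a removed edge. If \<open>t\<close> is even afterwards, it lies in the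
  triangle and has even neighbours; if it is odd, it sees two vertices of the triangle, which by
  symmetry may be called \<open>a\<close> and \<open>b\<close>. Only these two local patterns have
  to be excluded.\<close>

lemma SET_freeI:
  assumes "B \<subseteq> E" "B \<noteq> {}"
    and "\<And>a b c t. a \<noteq> b \<Longrightarrow> b \<noteq> c \<Longrightarrow> a \<noteq> c \<Longrightarrow> b \<in> nb (E - B) a \<Longrightarrow> c \<in> nb (E - B) b \<Longrightarrow>
      c \<in> nb (E - B) a \<Longrightarrow> {a, b, c} \<subseteq> evens V (E - B) \<Longrightarrow> nb B t \<noteq> {} \<Longrightarrow> a \<in> nb (E - B) t \<Longrightarrow> b \<in> nb (E - B) t \<Longrightarrow>
      t \<notin> evens V (E - B) \<Longrightarrow> False"
    and "\<And>t. nb B t \<noteq> {} \<Longrightarrow> t \<in> evens V (E - B) \<Longrightarrow> nb (E - B) t \<inter> evens V (E - B) = {}"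
  shows "SET_free V (E - B)"
  unfolding SET_free_def
proof (intro allI impI notI)
  fix C assume C: "C \<subseteq> V" "closed_part (E - B) C" "SET_part V (E - B) C"
  then obtain a b c where abc: "a \<noteq> b" "b \<noteq> c" "a \<noteq> c" "b \<in> nb (E - B) a" "c \<in> nb (E - B) b"
    "c \<in> nb (E - B) a" "C \<inter> evens V (E - B) = {a, b, c}"
    and two: "\<And>v. v \<in> C - {a, b, c} \<Longrightarrow> 2 \<le> card (nb (E - B) v \<inter> {a, b, c})"
    unfolding SET_part_def nb_def by auto
  have sym: "a \<in> nb (E - B) b" "b \<in> nb (E - B) c" "a \<in> nb (E - B) c" using abc in_nb_sym by fast+
  have "C \<noteq> {}" using abc(7) by auto
  then obtain t where t: "t \<in> C" "nb B t \<noteq> {}" using touched[OF assms(1,2) C(2,1)] by blast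
  have sub: "{a, b, c} \<subseteq> evens V (E - B)" using abc(7) by blast
  show False
  proof (cases "t \<in> evens V (E - B)")
    case True
    then have "t \<in> {a, b, c}" using t abc(7) by blast
    then have "nb (E - B) t \<inter> {a, b, c} \<noteq> {}" using abc sym by blast
    then show False using assms(4)[OF t(2) True] sub by blast
  next
    case False
    then have "t \<in> C - {a, b, c}" using t abc(7) by blast
    then have "2 \<le> card (nb (E - B) t \<inter> {a, b, c})" by (rule two)
    moreover have "card S \<le> 1" if "S \<subseteq> {a, b, c}" "\<not> {a, b} \<subseteq> S" "\<not> {b, c} \<subseteq> S" "\<not> {a, c} \<subseteq> S" for S
    proof -
      have "S \<subseteq> {a} \<or> S \<subseteq> {b} \<or> S \<subseteq> {c}" using that by auto
      then show ?thesis using card_mono[of "{a}" S] card_mono[of "{b}" S] card_mono[of "{c}" S] by auto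
    qed
    note small = this
    have "card (nb (E - B) t \<inter> {a, b, c}) \<le> 1"
      if hyp: "\<not> ({a, b} \<subseteq> nb (E - B) t \<or> {b, c} \<subseteq> nb (E - B) t \<or> {a, c} \<subseteq> nb (E - B) t)"
      by (rule small) (use hyp in auto)
    ultimately consider "{a, b} \<subseteq> nb (E - B) t" | "{b, c} \<subseteq> nb (E - B) t" | "{a, c} \<subseteq> nb (E - B) t"
      by fastforce
    then show False
    proof cases
      case 1
      then show ?thesis using assms(3)[of a b c t] abc sub t(2) False by auto
    next
      case 2
      then show ?thesis using assms(3)[of b c a t] abc sym sub t(2) False by auto
    next
      case 3
      then show ?thesis using assms(3)[of a c b t] abc sym sub t(2) False by auto
    qed
  qed
qed

text \<open>Under the condition on \<open>t\<close>, adjacent even vertices of the remaining graph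
  are untouched and were even before, so no new adjacency between even vertices arises. A new SET
  part would contain a touched odd vertex that was even before; a triangle vertex next to it then
  had three even neighbours.\<close>

lemma reduce_two:
  assumes le2: "\<And>u. u \<in> F \<Longrightarrow> card (nb E u \<inter> F) \<le> 2" and B: "B \<subseteq> E" "B \<noteq> {}"
    and t: "\<And>t. nb B t \<noteq> {} \<Longrightarrow>
      nb (E - B) t \<inter> evens V (E - B) = {} \<or> (t \<in> F \<and> t \<notin> evens V (E - B))"
  obtains P where "path_system (E - B) P" "card P \<le> card V"
proof -
  let ?F' = "evens V (E - B)"
  have untouched: "u \<in> ?F' \<longleftrightarrow> u \<in> F" if "nb B u = {}" for u
    using that by (simp add: evens_def nb_Diff)
  have inF: "u \<in> F" if "u \<in> ?F'" "w \<in> nb (E - B) u" "w \<in> ?F'" for u w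
    using that t[of u] untouched[of u] by (cases "nb B u = {}") auto
  have sub: "nb (E - B) u \<inter> ?F' \<subseteq> nb E u \<inter> F" if "u \<in> ?F'" for u
    using that inF[of _ u] by (auto simp: in_nb_sym[of u] nb_Diff)
  have "sparse_evens V (E - B)"
    unfolding sparse_evens_def
  proof
    fix u assume u: "u \<in> ?F'"
    show "card (nb (E - B) u \<inter> ?F') \<le> 3"
    proof (cases "nb (E - B) u \<inter> ?F' = {}")
      case False
      then have "u \<in> F" using inF[OF u] by blast
      then show ?thesis using le2[of u] card_mono[OF _ sub[OF u]] grD(6)[of u] by force
    qed simp
  qed
  moreover have "SET_free V (E - B)"
  proof (rule SET_freeI[OF B])
    fix s assume "nb B s \<noteq> {}" "s \<in> ?F'"
    then show "nb (E - B) s \<inter> ?F' = {}" using t by blast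
  next
    fix a b c s assume abc: "a \<noteq> b" "b \<noteq> c" "a \<noteq> c" "b \<in> nb (E - B) a" "c \<in> nb (E - B) b"
      "c \<in> nb (E - B) a" "{a, b, c} \<subseteq> ?F'" "nb B s \<noteq> {}" "a \<in> nb (E - B) s" "b \<in> nb (E - B) s" "s \<notin> ?F'"
    then have "s \<in> F" using t[of s] by blast
    have "{a, b, c} \<subseteq> F" using inF[of a b] inF[of b a] inF[of c a] abc in_nb_sym by fast
    moreover have "s \<in> nb E a" "b \<in> nb E a" "c \<in> nb E a" using abc in_nb_sym[of s E a] by (auto simp: nb_Diff)
    ultimately have "{s, b, c} \<subseteq> nb E a \<inter> F" using \<open>s \<in> F\<close> by auto
    then have "card {s, b, c} \<le> card (nb E a \<inter> F)" using grD(6) by (intro card_mono) auto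
    moreover have "s \<noteq> b" "s \<noteq> c" using abc(7,11) by auto
    then have "card {s, b, c} = 3" using abc(2) by simp
    ultimately show False using le2[of a] \<open>{a, b, c} \<subseteq> F\<close> by simp
  qed
  ultimately show ?thesis using IH_Diff[OF B] that by blast
qed

lemma ends_odd:
  assumes "path_system E' P" "u \<in> V" "u \<notin> evens V E'"
  shows "1 \<le> ends_at P u"
  using odd_degree_ends[OF assms(1)] assms(2,3) by (simp add: evens_def)

lemma decomposableI: "path_system E P \<Longrightarrow> card P \<le> card V \<Longrightarrow> decomposable V E"
  by (auto simp: decomposable_def)

text \<open>Two triangles of even vertices sharing the edge \<open>ab\<close>; whether
  \<open>cd\<close> is an edge is left open.\<close>

definition diamond :: "'a \<Rightarrow> 'a \<Rightarrow> 'a \<Rightarrow> 'a \<Rightarrow> bool" where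
  "diamond a b c d \<longleftrightarrow> {a, b, c, d} \<subseteq> F \<and> c \<noteq> d \<and> b \<in> nb E a \<and> {a, b} \<subseteq> nb E c \<and> {a, b} \<subseteq> nb E d"

text \<open>A SET component that arises here gives a diamond; therefore \<open>x\<close> is taken in a diamond if there is
  one, and then such a component would give an even vertex with four even neighbours.\<close>

lemma case_degree_three:
  assumes sp: "sparse_evens V E" and x: "x \<in> F" "card (nb E x \<inter> F) = 3"
    and dia: "(\<forall>a b c d. \<not> diamond a b c d) \<or> (\<forall>v\<in>nb E x \<inter> F. nb E v \<inter> nb E x \<inter> F \<noteq> {})"
  shows "decomposable V E"
proof -
  define N where "N = nb E x \<inter> F"
  define B where "B = star x N"
  have N: "finite N" "x \<notin> N" "card N = 3" using grD(5,6) x by (auto simp: N_def)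
  have BE: "B \<subseteq> E" "B \<noteq> {}" using N(3) by (auto simp: B_def star_def N_def nb_def)
  have nbB: "nb B t = (if t = x then N else if t \<in> N then {x} else {})" for t
    using N(2) by (simp add: B_def nb_star)
  have F': "evens V (E - B) = F - insert x N"
  proof -
    have "t \<in> evens V (E - B) \<longleftrightarrow> t \<in> F - insert x N" for t
      unfolding evens_Diff[OF gr BE(1)] nbB using x(1) N(3) evens_in_V[of t V E] by (auto simp: N_def)
    then show ?thesis by blast
  qed
  have nb': "nb (E - B) t = nb E t - (if t = x then N else if t \<in> N then {x} else {})" for t
    by (simp add: nb_Diff nbB)
  have le3: "card (nb E u \<inter> F) \<le> 3" if "u \<in> F" for u using sp that by (auto simp: sparse_evens_def)
  have "sparse_evens V (E - B)"
    unfolding sparse_evens_def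
  proof
    fix u assume "u \<in> evens V (E - B)"
    then have "u \<in> F" by (simp add: F')
    have "card (nb (E - B) u \<inter> evens V (E - B)) \<le> card (nb E u \<inter> F)"
      using grD(6) by (intro card_mono) (auto simp: F' nb_Diff)
    then show "card (nb (E - B) u \<inter> evens V (E - B)) \<le> 3" using le3[OF \<open>u \<in> F\<close>] by simp
  qed
  moreover have "SET_free V (E - B)"
  proof (rule SET_freeI[OF BE])
    fix t assume "nb B t \<noteq> {}" "t \<in> evens V (E - B)"
    then show "nb (E - B) t \<inter> evens V (E - B) = {}" by (auto simp: nbB F' split: if_splits)
  next
    fix a b c t assume abc: "a \<noteq> b" "b \<noteq> c" "a \<noteq> c" "b \<in> nb (E - B) a" "c \<in> nb (E - B) b"
      "c \<in> nb (E - B) a" "{a, b, c} \<subseteq> evens V (E - B)" "nb B t \<noteq> {}" "a \<in> nb (E - B) t"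
      "b \<in> nb (E - B) t" "t \<notin> evens V (E - B)"
    have nE: "b \<in> nb E a" "c \<in> nb E b" "c \<in> nb E a" "a \<in> nb E t" "b \<in> nb E t"
      using abc by (auto simp: nb_Diff)
    have notN: "{a, b, c} \<inter> insert x N = {}" "{a, b, c} \<subseteq> F" using abc(7) by (auto simp: F')
    have "t \<noteq> x" using notN nE by (auto simp: N_def)
    then have t: "t \<in> N" using abc(8) by (auto simp: nbB split: if_splits)
    then have xt: "x \<in> nb E t" "t \<in> F" using in_nb_sym[of x] by (auto simp: N_def)
    have "diamond a b c t"
      using nE notN t xt in_nb_sym[of a E c] in_nb_sym[of b E c] by (auto simp: diamond_def)
    then obtain v where v: "v \<in> nb E t" "v \<in> N" using dia t by (auto simp: N_def)
    then have "{x, v, a, b} \<subseteq> nb E t \<inter> F" using nE notN xt x by (auto simp: N_def)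
    then have "card {x, v, a, b} \<le> card (nb E t \<inter> F)" using grD(6) by (intro card_mono) auto
    moreover have "card {x, v, a, b} = 4" using v(2) notN N(2) abc(1) by (auto simp: card_insert_if)
    ultimately show False using le3[OF xt(2)] by simp
  qed
  ultimately obtain P where P: "path_system (E - B) P" "card P \<le> card V" using IH_Diff[OF BE] by blast
  have good: "1 \<le> ends_at P u" if "u \<in> V" "u \<notin> F - insert x N" for u
    using ends_odd[OF P(1) that(1)] that(2) by (simp add: F')
  obtain A P1 where A: "A \<subseteq> N" "card (N - A) \<le> card A" "path_system (E - B \<union> star x A) P1"
    "card P1 = card P" "ends_at P1 x = ends_at P x + card A"
    "\<And>u. u \<noteq> x \<Longrightarrow> u \<notin> A \<Longrightarrow> ends_at P1 u = ends_at P u"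
  proof (rule add_star[OF P(1) N(1,2)])
    show "N \<inter> nb (E - B) x = {}" by (simp add: nb' Int_Diff)
    show "1 \<le> ends_at P v" if "v \<in> N" for v using good[of v] that by (auto simp: N_def evens_def)
    show "1 \<le> ends_at P v" if "v \<in> nb (E - B) x" for v
      using good[of v] that grD(3)[of v x] by (auto simp: nb' N_def)
  qed blast
  define E1 where "E1 = E - B \<union> star x A"
  define L where "L = N - A"
  have fA: "finite A" using A(1) N(1) finite_subset by blast
  have cA: "card A + card L = 3"
    using card_mono[OF N(1) A(1)] A(1) N(3) fA by (simp add: L_def card_Diff_subset)
  then have cL: "card L \<le> 1" using A(2) by (simp add: L_def)
  \<comment> \<open>After losing three edges \<open>x\<close> is odd and has an end; with those
    gained from \<open>A\<close> it has at least three. An edge left over goes to a vertex with at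
    most two even neighbours besides \<open>x\<close>, so the bound 3 is just enough.\<close>
  have "1 \<le> ends_at P x" using good[of x] x by (simp add: evens_def)
  have xA: "x \<notin> A" using A(1) N(2) by blast
  have E1': "nb E1 x \<inter> L = {}"
    using xA by (auto simp: E1_def nb_star L_def nb')
  have "\<exists>P'. path_system (E1 \<union> star x L) P' \<and> card P' = card P1 \<and> ends_at P' x + card L = ends_at P1 x \<and>
    (\<forall>a\<in>L. ends_at P' a = ends_at P1 a + 1) \<and> (\<forall>u. u \<noteq> x \<longrightarrow> u \<notin> L \<longrightarrow> ends_at P' u = ends_at P1 u)"
  proof (rule add_leaves[where t = 2])
    show "finite L" "path_system E1 P1" "x \<notin> L" "L \<inter> nb E1 x = {}"
      using N A(3) E1' by (auto simp: L_def E1_def)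
    show "card L + 2 \<le> ends_at P1 x"
      using A(5) cA cL \<open>1 \<le> ends_at P x\<close> by simp
    fix a assume a: "a \<in> L"
    then have aN: "a \<in> N" "a \<noteq> x" "a \<in> F" using N(2) by (auto simp: L_def N_def)
    have nba: "nb E1 a = nb E a - {x}" using a aN xA by (auto simp: E1_def nb' nb_star L_def)
    have "{w \<in> nb E1 a. ends_at P1 w = 0} \<subseteq> (nb E a \<inter> F) - {x}"
    proof
      fix w assume w: "w \<in> {w \<in> nb E1 a. ends_at P1 w = 0}"
      then have "w \<in> nb E a" "w \<noteq> x" by (auto simp: nba)
      moreover have "w \<in> F"
      proof (rule ccontr)
        assume "w \<notin> F"
        then have "w \<notin> A" using A(1) by (auto simp: N_def)
        then show False using A(6)[OF \<open>w \<noteq> x\<close>] w good[of w] \<open>w \<notin> F\<close> grD(3)[OF \<open>w \<in> nb E a\<close>] by auto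
      qed
      ultimately show "w \<in> (nb E a \<inter> F) - {x}" by blast
    qed
    then have "card {w \<in> nb E1 a. ends_at P1 w = 0} \<le> card ((nb E a \<inter> F) - {x})"
      using grD(6) by (intro card_mono) auto
    moreover have "x \<in> nb E a \<inter> F" using aN(1) x in_nb_sym[of x E a] by (auto simp: N_def)
    ultimately show "card {w \<in> nb E1 a. ends_at P1 w = 0} \<le> 2" using le3[OF aN(3)] by simp
  qed
  then obtain P2 where "path_system (E1 \<union> star x L) P2" "card P2 = card P1" by blast
  moreover have "star x A \<union> star x L = B" using A(1) by (simp flip: star_Un add: L_def B_def Un_absorb1)
  then have "E1 \<union> star x L = E" using BE(1) unfolding E1_def by blast
  ultimately show ?thesis using A(4) P(2) decomposableI[of P2] by simp
qed

text \<open>Removing \<open>ax\<close> makes both vertices odd. All other neighbours of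
  \<open>a\<close> are odd and untouched, so none of them lacks an end when the edge returns at
  \<open>a\<close>.\<close>

lemma case_degree_one:
  assumes le2: "\<And>u. u \<in> F \<Longrightarrow> card (nb E u \<inter> F) \<le> 2" and a: "a \<in> F" "nb E a \<inter> F = {x}"
  shows "decomposable V E"
proof -
  define B where "B = {{a, x}}"
  have ax: "x \<in> nb E a" "x \<in> F" "a \<noteq> x" using a grD(5) by auto
  have BE: "B \<subseteq> E" "B \<noteq> {}" using ax by (auto simp: B_def nb_def)
  have nbB: "nb B t = (if t = a then {x} else if t = x then {a} else {})" for t
    using ax by (simp add: B_def nb_insert)
  have F': "evens V (E - B) = F - {a, x}"
    using a(1) ax by (auto dest: evens_in_V simp: evens_Diff[OF gr BE(1)] nbB split: if_splits)
  obtain P where P: "path_system (E - B) P" "card P \<le> card V"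
    by (rule reduce_two[OF le2 BE]) (use a(1) ax F' in \<open>auto simp: nbB split: if_splits\<close>)
  have good: "1 \<le> ends_at P u" if "u \<in> V" "u \<notin> F - {a, x}" for u
    using ends_odd[OF P(1) that(1)] that(2) by (simp add: F')
  obtain P' where "path_system (insert {a, x} (E - B)) P'" "shifts_end P P' x a"
  proof (rule add_edge_good[OF P(1)])
    show "{a, x} \<notin> E - B" "a \<noteq> x" "1 \<le> ends_at P x"
      using ax good[of x] by (auto simp: B_def evens_def)
    show "1 \<le> ends_at P w" if "w \<in> nb (E - B) a" for w
      using good[of w] that a(2) grD(3)[of w a] by (auto simp: nb_Diff)
  qed blast
  moreover have "insert {a, x} (E - B) = E" using BE by (auto simp: B_def)
  ultimately show ?thesis using P(2) by (auto intro: decomposableI simp: shifts_end_def)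
qed

text \<open>On the path \<open>z\<close>, \<open>x\<close>, \<open>u\<close>, \<open>y\<close> the
  two outer edges are removed, which makes all four vertices odd. \<open>uy\<close> returns at
  \<open>u\<close>, where \<open>x\<close> has an end. Only \<open>y\<close> may have lost its last
  end, and \<open>y\<close> is not adjacent to \<open>x\<close>, so \<open>xz\<close> can return at
  \<open>x\<close>.\<close>

lemma case_path:
  assumes le2: "\<And>u. u \<in> F \<Longrightarrow> card (nb E u \<inter> F) \<le> 2" and u: "u \<in> F" "nb E u \<inter> F = {x, y}"
    and x: "nb E x \<inter> F = {z, u}" and ne: "x \<noteq> y" "z \<noteq> u" "y \<noteq> z"
  shows "decomposable V E"
proof -
  define B where "B = {{x, z}, {u, y}}"
  have inF: "x \<in> F" "y \<in> F" "z \<in> F" using u x by auto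
  have ad: "x \<in> nb E u" "y \<in> nb E u" "z \<in> nb E x" "u \<in> nb E x" using u x by auto
  have d: "x \<noteq> z" "u \<noteq> y" "u \<noteq> x" using ad grD(5) by auto
  have BE: "B \<subseteq> E" "B \<noteq> {}" using ad by (auto simp: B_def nb_def)
  have nbB: "nb B t = (if t = u then {y} else if t = y then {u} else if t = x then {z} else if t = z then {x} else {})" for t
    using d ne by (auto simp: B_def nb_insert)
  have F': "evens V (E - B) = F - {u, x, y, z}"
    using inF u(1) by (auto dest: evens_in_V simp: evens_Diff[OF gr BE(1)] nbB split: if_splits)
  obtain P where P: "path_system (E - B) P" "card P \<le> card V"
    by (rule reduce_two[OF le2 BE]) (use u(1) inF F' in \<open>auto simp: nbB split: if_splits\<close>)
  have good: "1 \<le> ends_at P w" if "w \<in> V" "w \<notin> F - {u, x, y, z}" for w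
    using ends_odd[OF P(1) that(1)] that(2) by (simp add: F')
  have inV: "u \<in> V" "x \<in> V" "y \<in> V" "z \<in> V" using inF u(1) by (auto simp: evens_def)
  obtain P1 where P1: "path_system (insert {u, y} (E - B)) P1" "shifts_end P P1 y u"
  proof (rule add_edge_good[OF P(1)])
    show "{u, y} \<notin> E - B" "u \<noteq> y" "1 \<le> ends_at P y" using d good[of y] inV by (auto simp: B_def)
    show "1 \<le> ends_at P w" if "w \<in> nb (E - B) u" for w
      using good[of w] that u(2) grD(3)[of w u] by (auto simp: nb_Diff)
  qed blast
  note s = P1(2)[unfolded shifts_end_def]
  obtain P2 where "path_system (insert {x, z} (insert {u, y} (E - B))) P2" "shifts_end P1 P2 z x"
  proof (rule add_edge_good[OF P1(1)])
    show "{x, z} \<notin> insert {u, y} (E - B)" "x \<noteq> z"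
      using d ne by (auto simp: B_def doubleton_eq_iff)
    show "1 \<le> ends_at P1 z" using s ne good[of z] inV by auto
    fix w assume "w \<in> nb (insert {u, y} (E - B)) x"
    then have w: "w \<in> nb E x" "w \<noteq> z" using d ne by (auto simp: nb_insert nb_Diff nbB split: if_splits)
    show "1 \<le> ends_at P1 w"
    proof (cases "w = u")
      case False
      then have "w \<notin> F" using w x by auto
      then show ?thesis using good[of w] grD(3)[OF w(1)] s False inF by auto
    qed (use s in simp)
  qed blast
  moreover have "insert {x, z} (insert {u, y} (E - B)) = E" using BE by (auto simp: B_def)
  ultimately show ?thesis using P(2) s by (auto intro: decomposableI simp: shifts_end_def)
qed

end

section \<open>Even vertices inducing triangles\<close>

locale triangle_step = connected_step +
  assumes tri: "\<And>u. u \<in> evens V E \<Longrightarrow> nb E u \<inter> evens V E = {} \<or>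
    (\<exists>s t. s \<noteq> t \<and> nb E u \<inter> evens V E = {s, t} \<and> t \<in> nb E s)"
begin

definition mates :: "'a \<Rightarrow> 'a set" where
  "mates u = nb E u \<inter> F"

text \<open>By \<open>tri\<close> this is the component of \<open>u\<close> in the graph induced by
  the even vertices: a single vertex or a triangle.\<close>

definition cell :: "'a \<Rightarrow> 'a set" where
  "cell u = insert u (mates u)"

lemma mates_sym: "u \<in> F \<Longrightarrow> s \<in> mates u \<Longrightarrow> u \<in> mates s"
  by (auto simp: mates_def in_nb_sym)

lemma matesD: "s \<in> mates u \<Longrightarrow> s \<in> F \<and> s \<in> nb E u \<and> s \<noteq> u"
  using grD(5) by (auto simp: mates_def)

lemma mates_pair:
  assumes "u \<in> F" "s \<in> mates u"
  obtains t where "t \<noteq> s" "mates u = {s, t}" "mates s = {u, t}" "mates t = {u, s}"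
proof -
  have two: "\<exists>t. t \<noteq> s \<and> mates u = {s, t} \<and> t \<in> nb E s" if us: "u \<in> F" "s \<in> mates u" for u s
  proof -
    from us tri[of u] obtain x y where "x \<noteq> y" "mates u = {x, y}" "y \<in> nb E x"
      by (auto simp: mates_def)
    then show ?thesis using us in_nb_sym[of y E x] by auto
  qed
  obtain t where t: "t \<noteq> s" "mates u = {s, t}" "t \<in> nb E s" using two[OF assms] by blast
  have F: "s \<in> F" "t \<in> F" "s \<noteq> u" "t \<noteq> u" using t(2) matesD by blast+
  have "u \<in> mates s" "u \<in> mates t" "t \<in> mates s" "s \<in> mates t"
    using t mates_sym[OF assms(1)] F in_nb_sym[of t E s] by (auto simp: mates_def)
  then have "mates s = {u, t}" "mates t = {u, s}"
    using two[of s u] two[of t u] F t(1) by auto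
  then show ?thesis using that t by blast
qed

lemma card_mates: "u \<in> F \<Longrightarrow> mates u \<noteq> {} \<Longrightarrow> card (mates u) = 2"
  using mates_pair[of u] by (metis all_not_in_conv card_2_iff)

lemma cell_eq: "u \<in> F \<Longrightarrow> s \<in> cell u \<Longrightarrow> cell s = cell u"
  unfolding cell_def using mates_pair[of u s] by (metis insertE insert_commute)

lemma le2: "u \<in> F \<Longrightarrow> card (nb E u \<inter> F) \<le> 2"
  using card_mates[of u] by (cases "mates u = {}") (auto simp: mates_def)

lemma finite_F: "finite F"
  using grD(1) by (simp add: evens_def)

text \<open>\<open>L\<close> has at most one vertex in each triangle, so the pairs of mates are
  disjoint. This is the count behind the assumption \<open>H\<close> of
  \<open>star_reduction\<close>.\<close>

lemma card_UN_mates: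
  assumes "L \<subseteq> F" "\<And>a. a \<in> L \<Longrightarrow> mates a \<noteq> {}" "\<And>a. a \<in> L \<Longrightarrow> mates a \<inter> L = {}"
  shows "card (\<Union>a\<in>L. mates a) = 2 * card L"
proof -
  have "finite L" using assms(1) finite_F finite_subset by blast
  moreover have "mates a \<inter> mates a' = {}" if "a \<in> L" "a' \<in> L" "a \<noteq> a'" for a a'
  proof (rule ccontr)
    assume "mates a \<inter> mates a' \<noteq> {}"
    then obtain s where "s \<in> cell a" "s \<in> cell a'" by (auto simp: cell_def)
    then have "cell a = cell a'" using that assms(1) cell_eq by blast
    then have "a' \<in> mates a" using that by (auto simp: cell_def)
    then show False using assms(3)[of a] that by blast
  qed
  moreover have "finite (mates a)" for a using finite_F by (simp add: mates_def)
  ultimately have "card (\<Union>a\<in>L. mates a) = (\<Sum>a\<in>L. card (mates a))"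
    by (subst card_UN_disjoint) auto
  also have "\<dots> = (\<Sum>a\<in>L. 2)" using assms card_mates by (intro sum.cong) auto
  finally show ?thesis by simp
qed

text \<open>The edges from \<open>b\<close> to \<open>X\<close> are removed. Each \<open>m\<close> in \<open>M\<close> lies in a triangle of even vertices that is
  not contained in the neighbourhood of \<open>b\<close>; the opposite edge is removed too and added first,
  at \<open>qq m\<close>, which leaves only \<open>rr m\<close> without ends. This needs an end at \<open>b\<close> if \<open>qq m\<close> is a
  neighbour of \<open>b\<close>, whence the assumption \<open>par\<close>. When a part \<open>A\<close> of the edges has been added at \<open>b\<close>, each of
  the others can be added at its other end, at the cost of one end at \<open>b\<close>. The last one
  causes trouble only if it has two neighbours without ends, which is what \<open>H\<close> deals with.\<close>

lemma star_reduction: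
  assumes b: "b \<in> V" "b \<notin> F" and N: "N = nb E b \<inter> F"
    and X: "X \<subseteq> N" "X \<noteq> {}" "M \<subseteq> X" "N - X \<subseteq> qq ` M"
    and M: "\<And>m. m \<in> M \<Longrightarrow> mates m = {qq m, rr m} \<and> qq m \<noteq> rr m \<and> rr m \<notin> N \<and> qq m \<notin> X"
    and inj: "\<And>m m'. m \<in> M \<Longrightarrow> m' \<in> M \<Longrightarrow> m \<noteq> m' \<Longrightarrow> cell m \<inter> cell m' = {}"
    and par: "\<And>m. m \<in> M \<Longrightarrow> qq m \<in> N \<Longrightarrow> even (card X)"
    and H: "\<And>A. A \<subseteq> X \<Longrightarrow> card (X - A) \<le> card A \<Longrightarrow> X - A \<noteq> {} \<Longrightarrow>
      (\<And>a. a \<in> X - A \<Longrightarrow> a \<notin> M \<and> mates a \<noteq> {} \<and> mates a \<inter> X \<subseteq> A) \<Longrightarrow>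
      card (X - A) + 2 \<le> card A + of_bool (even (card X))"
  shows "decomposable V E"
proof -
  define Q where "Q = (\<lambda>S. (\<lambda>m. {qq m, rr m}) ` S)"
  define B where "B = star b X \<union> Q M"
  have XF: "X \<subseteq> F" "N \<subseteq> F" using X(1) N by auto
  have MF: "m \<in> F" if "m \<in> M" for m using that X(3) XF by blast
  have fX: "finite X" using XF finite_F finite_subset by blast
  have bX: "b \<notin> X" using XF b by blast
  have Mm: "qq m \<in> F" "rr m \<in> F" "qq m \<noteq> m" "rr m \<noteq> m" "mates (qq m) = {m, rr m}" "mates (rr m) = {m, qq m}"
    "rr m \<in> nb E (qq m)" "cell m = {m, qq m, rr m}" if m: "m \<in> M" for m
  proof -
    note d = M[OF m]
    then have q: "qq m \<in> mates m" "rr m \<in> mates m" by auto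
    obtain t where t: "t \<noteq> qq m" "mates m = {qq m, t}" "mates (qq m) = {m, t}" "mates t = {m, qq m}"
      using mates_pair[OF MF[OF m] q(1)] .
    have [simp]: "t = rr m" using t(1,2) d by auto
    show "mates (qq m) = {m, rr m}" "mates (rr m) = {m, qq m}" using t by simp_all
    then have "rr m \<in> mates (qq m)" by simp
    then show "rr m \<in> nb E (qq m)" using matesD by blast
    show "qq m \<in> F" "rr m \<in> F" "qq m \<noteq> m" "rr m \<noteq> m" using q matesD by blast+
    show "cell m = {m, qq m, rr m}" using d by (simp add: cell_def)
  qed
  have sep: "qq m \<noteq> rr m'" "m \<noteq> rr m'" "m \<noteq> m' \<Longrightarrow> rr m \<noteq> rr m'" "m \<noteq> m' \<Longrightarrow> qq m \<noteq> qq m'"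
    "m \<noteq> m' \<Longrightarrow> {qq m, rr m} \<noteq> {qq m', rr m'}"
    if "m \<in> M" "m' \<in> M" for m m'
    using inj[OF that] Mm(8)[OF that(1)] Mm(8)[OF that(2)] M[OF that(1)] Mm(3,4)[OF that(1)]
    by (cases "m = m'"; fastforce simp: doubleton_eq_iff)+
  have QE: "Q M \<subseteq> E" using Mm(7) by (auto simp: Q_def nb_def)
  have BE: "B \<subseteq> E" "B \<noteq> {}" using X(1,2) QE N by (auto simp: B_def star_def nb_def)
  have nbQ1: "nb (Q S) t = {}" if "S \<subseteq> M" "t \<notin> qq ` S \<union> rr ` S" for S t
    using that by (auto simp: Q_def nb_def doubleton_eq_iff)
  have nbQq: "nb (Q S) (qq m) = {rr m}" "nb (Q S) (rr m) = {qq m}" if "S \<subseteq> M" "m \<in> S" for S m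
  proof -
    have mM: "m \<in> M" using that by blast
    have uniq: "m' = m" if "m' \<in> S" "{qq m, rr m} \<inter> {qq m', rr m'} \<noteq> {}" for m'
    proof (rule ccontr)
      have m': "m' \<in> M" using that(1) \<open>S \<subseteq> M\<close> by blast
      assume "m' \<noteq> m"
      then have "cell m \<inter> cell m' = {}" using inj[OF mM m'] by simp
      then show False using that(2) Mm(8)[OF mM] Mm(8)[OF m'] by blast
    qed
    have ne: "qq m \<noteq> rr m" using M[OF mM] by blast
    show "nb (Q S) (qq m) = {rr m}"
    proof (intro equalityI subsetI)
      fix u assume "u \<in> nb (Q S) (qq m)"
      then obtain m' where m': "m' \<in> S" "{qq m, u} = {qq m', rr m'}" by (auto simp: Q_def nb_def)
      then have "m' = m" using uniq[of m'] by blast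
      then show "u \<in> {rr m}" using m'(2) ne by (simp add: doubleton_eq_iff)
    qed (use that(2) in \<open>simp add: Q_def nb_def\<close>)
    show "nb (Q S) (rr m) = {qq m}"
    proof (intro equalityI subsetI)
      fix u assume "u \<in> nb (Q S) (rr m)"
      then obtain m' where m': "m' \<in> S" "{rr m, u} = {qq m', rr m'}" by (auto simp: Q_def nb_def)
      then have "m' = m" using uniq[of m'] by blast
      then show "u \<in> {qq m}" using m'(2) ne by (simp add: doubleton_eq_iff)
    qed (use that(2) in \<open>simp add: Q_def nb_def insert_commute\<close>)
  qed
  have qrX: "qq m \<notin> X" "rr m \<notin> X" "qq m \<noteq> b" "rr m \<noteq> b" if "m \<in> M" for m
    using M[OF that] X(1) Mm(1,2)[OF that] b(2) by auto
  have nbBb: "nb B b = X" using nbQ1[of M b] qrX bX by (auto simp: B_def nb_star)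
  have nbBX: "nb B x = {b}" if "x \<in> X" for x
    using nbQ1[of M x] qrX that bX by (auto simp: B_def nb_star)
  have nbBq: "nb B (qq m) = {rr m}" "nb B (rr m) = {qq m}" if "m \<in> M" for m
    using nbQq[of M m] qrX that bX by (auto simp: B_def nb_star)
  have nbB0: "nb B t = {}" if "t \<noteq> b" "t \<notin> X" "t \<notin> qq ` M \<union> rr ` M" for t
    using nbQ1[of M t] that bX by (auto simp: B_def nb_star)
  have F'F: "t \<in> F \<and> t \<notin> X \<union> qq ` M \<union> rr ` M" if "t \<in> evens V (E - B)" "t \<noteq> b" for t
  proof -
    have t: "t \<in> F \<longleftrightarrow> even (card (nb B t))" using that(1) evens_Diff[OF gr BE(1)] by blast
    have "t \<notin> X \<union> qq ` M \<union> rr ` M"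
      using t nbBX[of t] nbBq XF Mm(1,2) by (auto simp: subset_iff)
    then show ?thesis using t nbB0[of t] that(2) by auto
  qed
  have bF': "b \<notin> evens V (E - B)" if "even (card X)"
    using that b evens_Diff[OF gr BE(1), of b] nbBb by auto
  obtain P where P: "path_system (E - B) P" "card P \<le> card V"
  proof (rule reduce_two[OF le2 BE])
    fix t assume t: "nb B t \<noteq> {}"
    show "nb (E - B) t \<inter> evens V (E - B) = {} \<or> t \<in> F \<and> t \<notin> evens V (E - B)"
    proof (cases "t = b")
      case True
      \<comment> \<open>Even neighbours of \<open>b\<close> outside \<open>X\<close> are of the form
        \<open>qq m\<close>, and these became odd with the removal of the opposite edge.\<close>
      have "w \<notin> evens V (E - B)" if "w \<in> nb E b - X" for w
      proof
        assume w: "w \<in> evens V (E - B)"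
        have "w \<noteq> b" using that grD(5) by auto
        then have "w \<in> F" "w \<notin> X \<union> qq ` M" using F'F[OF w] by auto
        then show False using X(4) that N by blast
      qed
      then show ?thesis using True nbBb by (auto simp: nb_Diff)
    next
      case False
      then have "t \<in> X \<union> qq ` M \<union> rr ` M" using nbB0 t by blast
      then have "t \<in> F" using XF Mm(1,2) by auto
      then show ?thesis using F'F[OF _ False] \<open>t \<in> X \<union> qq ` M \<union> rr ` M\<close> by blast
    qed
  qed auto
  have good: "1 \<le> ends_at P u" if "u \<in> V" "u \<noteq> b" "u \<notin> F \<or> u \<in> X \<union> qq ` M \<union> rr ` M" for u
    using ends_odd[OF P(1) that(1)] that F'F[of u] by blast
  have goodb: "1 \<le> ends_at P b" if "even (card X)"
    using ends_odd[OF P(1) b(1)] bF'[OF that] by blast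
  have "\<exists>P1. path_system (E - B \<union> Q S) P1 \<and> card P1 = card P \<and> (\<forall>u. u \<notin> rr ` S \<longrightarrow> ends_at P u \<le> ends_at P1 u)"
    if "finite S" "S \<subseteq> M" for S
    using that
  proof (induction S rule: finite_induct)
    case empty
    then show ?case using P(1) by (auto simp: Q_def)
  next
    case (insert m S)
    then obtain P1 where P1: "path_system (E - B \<union> Q S) P1" "card P1 = card P"
      "\<And>u. u \<notin> rr ` S \<Longrightarrow> ends_at P u \<le> ends_at P1 u" by auto
    have m: "m \<in> M" and SM: "S \<subseteq> M" using insert.prems by auto
    have Fr: "rr ` S \<subseteq> F" using Mm(2) SM by auto
    have rS: "rr m \<notin> rr ` S" "m \<notin> rr ` S" "qq m \<notin> rr ` S" "qq m \<notin> qq ` S"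
      using sep m SM insert.hyps(2) by (auto simp: image_iff) (metis subsetD)+
    have nq: "nb (E - B \<union> Q S) (qq m) = nb E (qq m) - {rr m}"
      using nbQ1[OF SM, of "qq m"] rS nbBq[OF m] by (auto simp: nb_Diff)
    obtain P2 where P2: "path_system (insert {qq m, rr m} (E - B \<union> Q S)) P2" "shifts_end P1 P2 (rr m) (qq m)"
    proof (rule add_edge_good[OF P1(1)])
      show "{qq m, rr m} \<notin> E - B \<union> Q S" unfolding edge_iff_nb nq by simp
      show "qq m \<noteq> rr m" using M[OF m] by blast
      have "rr m \<in> V" using Mm(2)[OF m] evens_in_V by metis
      then show "1 \<le> ends_at P1 (rr m)"
        using good[of "rr m"] P1(3)[OF rS(1)] qrX[OF m] m by force
      fix w assume "w \<in> nb (E - B \<union> Q S) (qq m)"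
      then have w: "w \<in> nb E (qq m)" "w \<noteq> rr m" using nq by auto
      have wV: "w \<in> V" using w grD(3) by blast
      show "1 \<le> ends_at P1 w"
      proof (cases "w \<in> F")
        case True
        then have "w \<in> mates (qq m)" using w by (simp add: mates_def)
        then have "w = m" using Mm(5)[OF m] w(2) by auto
        then show ?thesis using good[of m] P1(3)[OF rS(2)] wV m X(3) bX by force
      next
        case False
        then have le: "ends_at P w \<le> ends_at P1 w" using P1(3) Fr by blast
        show ?thesis
        proof (cases "w = b")
          case True
          then have "qq m \<in> N" using w(1) Mm(1)[OF m] in_nb_sym[of b E] N by auto
          then show ?thesis using par[OF m] goodb le True by simp
        next
          case False
          then show ?thesis using good[OF wV] \<open>w \<notin> F\<close> le by force
        qed
      qed
    qed blast
    note s = P2(2)[unfolded shifts_end_def]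
    have "ends_at P u \<le> ends_at P2 u" if "u \<notin> rr ` insert m S" for u
      using that P1(3)[of u] s by (cases "u = qq m") auto
    moreover have "insert {qq m, rr m} (E - B \<union> Q S) = E - B \<union> Q (insert m S)" by (auto simp: Q_def)
    ultimately show ?case using P2(1) s P1(2) by (intro exI[of _ P2]) simp
  qed
  then obtain P1 where P1: "path_system (E - B \<union> Q M) P1" "card P1 = card P"
    "\<And>u. u \<notin> rr ` M \<Longrightarrow> ends_at P u \<le> ends_at P1 u"
    using finite_subset[OF X(3) fX] by blast
  have SQ: "star b X \<inter> Q M = {}" using qrX by (auto simp: star_def Q_def doubleton_eq_iff)
  define E1 where "E1 = E - star b X"
  have E1: "E - B \<union> Q M = E1" using SQ QE by (auto simp: B_def E1_def)
  have rF: "rr ` M \<subseteq> F" using Mm(2) by auto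
  have rN: "rr ` M \<inter> N = {}" using M by blast
  have nbE1: "nb E1 t = nb E t - (if t = b then X else if t \<in> X then {b} else {})" for t
    using bX by (simp add: E1_def nb_Diff nb_star)
  have good1: "1 \<le> ends_at P1 u" if "u \<in> V" "u \<noteq> b" "u \<notin> F \<or> u \<in> X \<union> qq ` M" for u
  proof -
    have "qq ` M \<inter> rr ` M = {}" using sep(1) by auto
    then have "u \<notin> rr ` M" using that(3) rF rN X(1) by blast
    then show ?thesis using P1(3)[of u] good[of u] that by force
  qed
  obtain A P2 where A: "A \<subseteq> X" "card (X - A) \<le> card A" "path_system (E1 \<union> star b A) P2"
    "card P2 = card P1" "ends_at P2 b = ends_at P1 b + card A"
    "\<And>u. u \<noteq> b \<Longrightarrow> u \<notin> A \<Longrightarrow> ends_at P2 u = ends_at P1 u"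
  proof (rule add_star[OF P1(1)[unfolded E1] fX bX])
    show "X \<inter> nb E1 b = {}" by (auto simp: nbE1)
    show "1 \<le> ends_at P1 x" if "x \<in> X" for x
      using good1[of x] that XF bX by (auto simp: evens_def)
    show "1 \<le> ends_at P1 w" if "w \<in> nb E1 b" for w
    proof (rule good1)
      have w: "w \<in> nb E b" "w \<notin> X" using that by (auto simp: nbE1)
      show "w \<in> V" "w \<noteq> b" using grD(3)[OF w(1)] w(1) grD(5)[of b] by auto
      show "w \<notin> F \<or> w \<in> X \<union> qq ` M" using w N X(4) by blast
    qed
  qed blast
  define L where "L = X - A"
  define E2 where "E2 = E1 \<union> star b A"
  note PS2 = A(3)[folded E2_def]
  have bL: "b \<notin> L" "b \<notin> A" "finite L" "finite A" using bX A(1) fX finite_subset by (auto simp: L_def)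
  have cX: "card X = card A + card L"
    using card_mono[OF fX A(1)] A(1) bL(4) by (simp add: L_def card_Diff_subset)
  have "card L \<le> card A" using A(2) by (simp add: L_def)
  have E2E: "E2 \<union> star b L = E"
  proof -
    have "star b A \<union> star b L = star b X" using A(1) by (simp flip: star_Un add: L_def Un_absorb1)
    moreover have "star b X \<subseteq> E" using BE(1) by (simp add: B_def)
    ultimately show ?thesis unfolding E2_def E1_def by blast
  qed
  have nbE2b: "L \<inter> nb E2 b = {}" using bL by (auto simp: E2_def nbE1 nb_star L_def)
  have nbE2: "nb E2 a = nb E a - {b}" if "a \<in> L" for a
    using that bL by (auto simp: E2_def nbE1 nb_star L_def)
  \<comment> \<open>The edges to \<open>A\<close> bring \<open>card A\<close> ends to
    \<open>b\<close>; if \<open>card X\<close> is even, then \<open>b\<close> has stayed odd and had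
    one end before.\<close>
  have endb: "card A + of_bool (even (card X)) \<le> ends_at P2 b"
  proof -
    have "b \<notin> rr ` M" using rF b by blast
    then show ?thesis using A(5) P1(3)[of b] goodb by auto
  qed
  have zeros: "{w \<in> nb E2 a. ends_at P2 w = 0} \<subseteq> {w \<in> mates a. ends_at P2 w = 0}" if a: "a \<in> L" for a
  proof
    fix w assume w: "w \<in> {w \<in> nb E2 a. ends_at P2 w = 0}"
    then have w1: "w \<in> nb E a" "w \<noteq> b" using nbE2[OF a] by auto
    have "w \<in> F"
    proof (rule ccontr)
      assume "w \<notin> F"
      then have "w \<notin> A" using A(1) XF by blast
      then show False using A(6)[OF w1(2)] good1[of w] grD(3)[OF w1(1)] w1(2) \<open>w \<notin> F\<close> w by auto
    qed
    then show "w \<in> {w \<in> mates a. ends_at P2 w = 0}" using w w1 by (simp add: mates_def)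
  qed
  have fm: "finite (mates a)" for a using finite_F by (simp add: mates_def)
  have z2: "card {w \<in> nb E2 a. ends_at P2 w = 0} \<le> 2" if "a \<in> L" for a
  proof -
    have "card {w \<in> nb E2 a. ends_at P2 w = 0} \<le> card (mates a)"
      using zeros[OF that] fm by (intro card_mono) auto
    moreover have "a \<in> F" using that XF by (auto simp: L_def)
    ultimately show ?thesis using le2[of a] by (simp add: mates_def)
  qed
  \<comment> \<open>With enough ends at \<open>b\<close>, two neighbours without ends can be
    tolerated at every leaf. Otherwise \<open>H\<close> yields a leaf \<open>a\<close> with at most
    one such neighbour; adding it last saves one end.\<close>
  consider "card L + 2 \<le> ends_at P2 b" | a where "a \<in> L" "a \<in> M \<or> mates a = {} \<or> \<not> mates a \<inter> X \<subseteq> A"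
    | "L = {}"
    using H[OF A(1,2)] endb unfolding L_def by fastforce
  then show ?thesis
  proof cases
    case 1
    obtain P3 where "path_system (E2 \<union> star b L) P3" "card P3 = card P2"
      using add_leaves[OF bL(3) PS2 bL(1) nbE2b z2 1] by blast
    then show ?thesis using decomposableI[of P3] E2E A(4) P1(2) P(2) by simp
  next
    case (2 a)
    have aF: "a \<in> F" "a \<in> X" "a \<notin> A" using 2(1) XF by (auto simp: L_def)
    have z1: "card {w \<in> nb E2 a. ends_at P2 w = 0} \<le> 1"
    proof -
      \<comment> \<open>For \<open>a\<close> in \<open>M\<close> the vertex \<open>qq a\<close> has
        an end, so only \<open>rr a\<close> can lack one. Otherwise \<open>a\<close> has no mates,
        or it has a mate in \<open>X - A\<close>, which has kept its end.\<close>
      have "\<exists>r. {w \<in> mates a. ends_at P2 w = 0} \<subseteq> {r}"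
      proof (cases "a \<in> M \<or> mates a = {}")
        case True
        have "ends_at P2 (qq a) \<noteq> 0" if "a \<in> M"
        proof -
          have "qq a \<notin> A" using qrX[OF that] A(1) by blast
          then show ?thesis using good1[of "qq a"] A(6)[of "qq a"] that qrX[OF that] Mm(1)[OF that]
            by (auto simp: evens_def)
        qed
        then show ?thesis using True M[of a] by (intro exI[of _ "rr a"]) auto
      next
        case False
        then obtain s where s: "s \<in> mates a" "s \<in> X" "s \<notin> A" using 2 by blast
        have "s \<in> V" "s \<noteq> b" using s(2) XF(1) bX by (auto simp: evens_def)
        then have "ends_at P2 s \<noteq> 0"
          using good1[of s] A(6)[of s] s by auto
        moreover obtain t where "mates a = {s, t}" using mates_pair[OF aF(1) s(1)] by metis
        ultimately show ?thesis by (intro exI[of _ t]) auto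
      qed
      then obtain r where "{w \<in> nb E2 a. ends_at P2 w = 0} \<subseteq> {r}" using zeros[OF 2(1)] by blast
      then show ?thesis using card_mono[of "{r}"] by fastforce
    qed
    define L' where "L' = L - {a}"
    have L': "finite L'" "b \<notin> L'" "L' \<inter> nb E2 b = {}" "a \<notin> L'" "L = insert a L'"
      using bL nbE2b 2(1) by (auto simp: L'_def)
    have cL': "card L = card L' + 1" using L'(1,4,5) by simp
    \<comment> \<open>If \<open>card A = card L\<close>, then \<open>card X\<close> is even and
      \<open>b\<close> has its extra end; otherwise \<open>A\<close> is strictly larger.\<close>
    have "card L + 1 \<le> card A + of_bool (even (card X))"
      using \<open>card L \<le> card A\<close> cX by (cases "card A = card L") auto
    then have "card L' + 2 \<le> ends_at P2 b" using endb cL' by simp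
    then obtain P3 where P3: "path_system (E2 \<union> star b L') P3" "card P3 = card P2"
      "ends_at P3 b + card L' = ends_at P2 b" "\<And>a. a \<in> L' \<Longrightarrow> ends_at P3 a = ends_at P2 a + 1"
      "\<And>u. u \<noteq> b \<Longrightarrow> u \<notin> L' \<Longrightarrow> ends_at P3 u = ends_at P2 u"
      using add_leaves[OF L'(1) PS2 L'(2,3), of 2] z2 L'(5) by blast
    have ab: "a \<noteq> b" using bL 2(1) by blast
    have nba: "nb (E2 \<union> star b L') a = nb E2 a" using L'(2,4) ab by (simp add: nb_star)
    have "{w \<in> nb E2 a. ends_at P3 w = 0} \<subseteq> {w \<in> nb E2 a. ends_at P2 w = 0}"
    proof
      fix w assume w: "w \<in> {w \<in> nb E2 a. ends_at P3 w = 0}"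
      then have "w \<noteq> b" "w \<notin> L'" using nbE2[OF 2(1)] P3(4) by auto
      then show "w \<in> {w \<in> nb E2 a. ends_at P2 w = 0}" using w P3(5) by auto
    qed
    then have "card {w \<in> nb E2 a. ends_at P3 w = 0} \<le> card {w \<in> nb E2 a. ends_at P2 w = 0}"
      using finite_nb[OF PS2] by (intro card_mono) auto
    then have "card {w \<in> nb (E2 \<union> star b L') a. ends_at P3 w = 0} < ends_at P3 b"
      unfolding nba using z1 P3(3) \<open>card L' + 2 \<le> ends_at P2 b\<close> by simp
    moreover have "{a, b} \<notin> E2 \<union> star b L'" unfolding edge_iff_nb nba nbE2[OF 2(1)] by simp
    ultimately obtain P4 where P4: "path_system (insert {a, b} (E2 \<union> star b L')) P4" "shifts_end P3 P4 b a"
      using add_edge[OF P3(1) _ ab] by blast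
    have "insert {a, b} (E2 \<union> star b L') = E" using E2E L'(5) by (simp add: insert_commute)
    then show ?thesis
      using decomposableI[of P4] P4 P3(2) A(4) P1(2) P(2) by (simp add: shifts_end_def)
  next
    case 3
    then show ?thesis using decomposableI[of P2] E2E PS2 A(4) P1(2) P(2) by simp
  qed
qed

text \<open>Isolated even vertices and triangles inside \<open>N\<close> are put into
  \<open>X\<close> completely. A triangle that meets \<open>N\<close> only partly contributes a
  single representative, collected in \<open>M\<close>; it is unique because \<open>pk\<close>
  depends on the cell alone. Its mate \<open>rr m\<close> is a vertex missing from \<open>N\<close>,
  and \<open>qq m\<close> is the third vertex, the only one of the triangle that can lie in
  \<open>N - X\<close>. With this choice the loss of ends is confined to vertices that
  \<open>b\<close> does not see.\<close>

lemma case_star: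
  assumes b: "b \<in> V" "b \<notin> F" and N: "N = nb E b \<inter> F" "N \<noteq> {}"
    and not_tri: "\<And>u. u \<in> N \<Longrightarrow> N \<subseteq> cell u \<Longrightarrow> card N < 2"
  shows "decomposable V E"
proof -
  define pk where "pk = (\<lambda>C. SOME p. p \<in> C \<inter> N)"
  define rr where "rr = (\<lambda>m. SOME r. r \<in> mates m - N)"
  define qq where "qq = (\<lambda>m. SOME q. q \<in> mates m - {rr m})"
  define M where "M = {m \<in> N. \<not> mates m \<subseteq> N \<and> m = pk (cell m)}"
  define X where "X = {u \<in> N. mates u \<subseteq> N} \<union> M"
  have NF: "N \<subseteq> F" using N by auto
  have fN: "finite N" using NF finite_F finite_subset by blast
  have XN: "X \<subseteq> N" by (auto simp: X_def M_def)
  have MN: "M \<subseteq> N" by (auto simp: M_def)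
  have Mm: "mates m = {qq m, rr m}" "qq m \<noteq> rr m" "rr m \<notin> N" "rr m \<in> mates m" "qq m \<in> mates m"
    if m: "m \<in> M" for m
  proof -
    have "mates m - N \<noteq> {}" "m \<in> F" using m NF by (auto simp: M_def)
    then have r: "rr m \<in> mates m - N" unfolding rr_def by (simp only: some_in_eq simp_thms)
    obtain t where t: "t \<noteq> rr m" "mates m = {rr m, t}" using mates_pair[OF \<open>m \<in> F\<close> DiffD1[OF r]] by metis
    then have "mates m - {rr m} \<noteq> {}" by auto
    then have "qq m \<in> mates m - {rr m}" unfolding qq_def by (simp only: some_in_eq simp_thms)
    then show "mates m = {qq m, rr m}" "qq m \<noteq> rr m" "rr m \<notin> N" "rr m \<in> mates m" "qq m \<in> mates m"
      using r t by auto
  qed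
  have uniq: "m = m'" if "m \<in> M" "m' \<in> cell m" "m' \<in> M" for m m'
  proof -
    have "m \<in> F" using that(1) NF MN by blast
    then have "cell m' = cell m" using cell_eq that(2) by blast
    then show ?thesis using that(1,3) by (simp add: M_def)
  qed
  have qX: "qq m \<notin> X" if m: "m \<in> M" for m
  proof
    assume q: "qq m \<in> X"
    have qm: "qq m \<in> cell m" "qq m \<noteq> m" using Mm(5)[OF m] matesD by (auto simp: cell_def)
    then have "qq m \<notin> M" using uniq[OF m qm(1)] by metis
    then have "mates (qq m) \<subseteq> N" using q by (auto simp: X_def)
    moreover have "m \<in> F" using m NF MN by blast
    then have "cell (qq m) = cell m" using cell_eq[OF _ qm(1)] by blast
    then have "rr m \<in> cell (qq m)" using Mm(4)[OF m] by (simp add: cell_def)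
    then have "rr m \<in> mates (qq m)" using Mm(2)[OF m] by (auto simp: cell_def)
    ultimately show False using Mm(3)[OF m] by blast
  qed
  have NX: "\<exists>m\<in>M. u = qq m" if u: "u \<in> N - X" for u
  proof -
    have uF: "u \<in> F" and nm: "\<not> mates u \<subseteq> N" using u NF by (auto simp: X_def)
    have "cell u \<inter> N \<noteq> {}" using u by (auto simp: cell_def)
    then have p: "pk (cell u) \<in> cell u \<inter> N" unfolding pk_def by (simp only: some_in_eq simp_thms)
    define m where "m = pk (cell u)"
    have cm: "cell m = cell u" using cell_eq[OF uF] p by (simp add: m_def)
    have "\<not> cell m \<subseteq> N" using nm unfolding cm by (auto simp: cell_def)
    then have "\<not> mates m \<subseteq> N" using p by (auto simp: m_def cell_def)
    then have mM: "m \<in> M" using p cm by (auto simp: M_def m_def)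
    have "u \<noteq> m" using mM u by (auto simp: X_def)
    moreover have "u \<in> cell m" unfolding cm by (simp add: cell_def)
    ultimately have "u \<in> mates m" by (simp add: cell_def)
    then have "u = qq m" using Mm(1,3)[OF mM] u by auto
    then show ?thesis using mM by blast
  qed
  have X0: "X \<noteq> {}"
  proof -
    obtain u where "u \<in> N" using N(2) by blast
    then have "u \<in> X \<or> (\<exists>m\<in>M. u = qq m)" using NX[of u] by blast
    then show ?thesis by (auto simp: X_def)
  qed
  have inj: "cell m \<inter> cell m' = {}" if "m \<in> M" "m' \<in> M" "m \<noteq> m'" for m m'
  proof (rule ccontr)
    assume "cell m \<inter> cell m' \<noteq> {}"
    then obtain s where "s \<in> cell m" "s \<in> cell m'" by blast
    moreover have "m \<in> F" "m' \<in> F" using that NF MN by blast+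
    ultimately have "cell m = cell m'" using cell_eq[of m s] cell_eq[of m' s] by simp
    then have "m' \<in> cell m" by (simp add: cell_def)
    then show False using uniq[OF that(1) _ that(2)] that(3) by blast
  qed
  have full: "mates a \<subseteq> X \<and> cell a \<inter> M = {}" if "a \<in> X" "a \<notin> M" for a
  proof -
    have a: "a \<in> F" "cell a \<subseteq> N" using that NF by (auto simp: X_def cell_def)
    have "mates s \<subseteq> N" if "s \<in> cell a" for s
      using cell_eq[OF a(1) that] a(2) by (auto simp: cell_def)
    then show ?thesis using a by (auto simp: X_def M_def cell_def)
  qed
  have fX: "finite X" using fN XN finite_subset by blast
  have XF: "X \<subseteq> F" using XN NF by blast
  show ?thesis
  proof (cases "even (card X) \<or> (\<forall>m\<in>M. qq m \<notin> N)")
    case True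
    show ?thesis
    proof (rule star_reduction[OF b N(1) XN X0, of M qq rr])
      show "M \<subseteq> X" by (simp add: X_def)
      show "N - X \<subseteq> qq ` M" using NX by blast
      show "mates m = {qq m, rr m} \<and> qq m \<noteq> rr m \<and> rr m \<notin> N \<and> qq m \<notin> X" if "m \<in> M" for m
        using Mm[OF that] qX[OF that] by blast
      show "cell m \<inter> cell m' = {}" if "m \<in> M" "m' \<in> M" "m \<noteq> m'" for m m' using inj that .
      show "even (card X)" if "m \<in> M" "qq m \<in> N" for m using True that by blast
      fix A assume A: "A \<subseteq> X" "card (X - A) \<le> card A" "X - A \<noteq> {}"
        "\<And>a. a \<in> X - A \<Longrightarrow> a \<notin> M \<and> mates a \<noteq> {} \<and> mates a \<inter> X \<subseteq> A"
      define L where "L = X - A"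
      have fA: "finite A" using A(1) fX finite_subset by blast
      \<comment> \<open>The vertices left over lie in full triangles with both mates in
        \<open>A\<close>, different ones in different triangles. So \<open>card A\<close> is at
        least \<open>2 * card L\<close>, which suffices unless \<open>card L = 1\<close> and
        \<open>card A = 2\<close>. Then \<open>X\<close> is one full triangle containing
        \<open>N\<close>, against \<open>not_tri\<close>.\<close>
      have sub: "(\<Union>a\<in>L. mates a) \<subseteq> A" using A(4) full unfolding L_def by blast
      have "card (\<Union>a\<in>L. mates a) = 2 * card L"
      proof (rule card_UN_mates)
        show "L \<subseteq> F" using XF by (auto simp: L_def)
        show "mates a \<noteq> {}" if "a \<in> L" for a using A(4) that by (auto simp: L_def)
        show "mates a \<inter> L = {}" if "a \<in> L" for a using sub that by (auto simp: L_def)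
      qed
      then have cA: "2 * card L \<le> card A" using card_mono[OF fA sub] by simp
      have "card L \<noteq> 0" using A(3) fX by (simp add: L_def)
      have "\<not> (card L = 1 \<and> card A = 2)"
      proof
        assume c: "card L = 1 \<and> card A = 2"
        then obtain a where a: "L = {a}" by (auto simp: card_1_singleton_iff)
        then have aX: "a \<in> X - A" by (auto simp: L_def)
        have aF: "a \<in> F" using aX XF by blast
        have "mates a \<subseteq> A" "card (mates a) = 2" using sub a A(4)[OF aX] card_mates[OF aF] by auto
        then have mA: "mates a = A" using fA c by (simp add: card_subset_eq)
        have XC: "X = cell a" using A(1) a mA unfolding L_def cell_def by blast
        then have "M = {}" using full[of a] A(4)[OF aX] aX by (auto simp: X_def)
        then have "N \<subseteq> cell a" using NX XC by blast
        moreover have "card N \<ge> 2" using card_mono[OF fN XN] c A(1) card_mono[OF fX A(1)] by simp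
        ultimately show False using not_tri[of a] aX XN by auto
      qed
      then show "card (X - A) + 2 \<le> card A + of_bool (even (card X))"
        using cA \<open>card L \<noteq> 0\<close> unfolding L_def[symmetric] by linarith
    qed
  next
    case False
    \<comment> \<open>From one triangle with two neighbours of \<open>b\<close> both edges to \<open>b\<close> are removed, for parity.\<close>
    then obtain m0 where m0: "m0 \<in> M" "qq m0 \<in> N" and odd: "odd (card X)" by blast
    define q0 where "q0 = qq m0"
    define X' where "X' = insert q0 X"
    define M' where "M' = M - {m0}"
    have q0X: "q0 \<notin> X" using qX[OF m0(1)] by (simp add: q0_def)
    have cX': "card X' = card X + 1" using q0X fX by (simp add: X'_def)
    have fX': "finite X'" using fX by (simp add: X'_def)
    have X'N: "X' \<subseteq> N" using XN m0 by (auto simp: X'_def q0_def)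
    have m0X: "m0 \<in> X" using m0 by (simp add: X_def)
    have q0m: "q0 \<in> mates m0" "q0 \<noteq> m0" using Mm(5)[OF m0(1)] matesD by (auto simp: q0_def)
    have m0F: "m0 \<in> F" using m0X XF by blast
    obtain t where t: "t \<noteq> q0" "mates m0 = {q0, t}" "mates q0 = {m0, t}" "mates t = {m0, q0}"
      using mates_pair[OF m0F q0m(1)] .
    have t': "t = rr m0" using t(1,2) Mm(1,2)[OF m0(1)] by (auto simp: q0_def)
    show ?thesis
    proof (rule star_reduction[OF b N(1) X'N, of M' qq rr])
      show "X' \<noteq> {}" by (simp add: X'_def)
      show "M' \<subseteq> X'" by (auto simp: X'_def X_def M'_def)
      show "N - X' \<subseteq> qq ` M'" using NX by (auto simp: X'_def M'_def q0_def)
      show "mates m = {qq m, rr m} \<and> qq m \<noteq> rr m \<and> rr m \<notin> N \<and> qq m \<notin> X'" if m: "m \<in> M'" for m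
      proof -
        have m1: "m \<in> M" "m \<noteq> m0" using m by (auto simp: M'_def)
        have "qq m \<in> cell m" "q0 \<in> cell m0" using Mm(5)[OF m1(1)] q0m by (auto simp: cell_def)
        then have "qq m \<noteq> q0" using inj[OF m1(1) m0(1) m1(2)] by blast
        then show ?thesis using Mm[OF m1(1)] qX[OF m1(1)] by (simp add: X'_def)
      qed
      show "cell m \<inter> cell m' = {}" if "m \<in> M'" "m' \<in> M'" "m \<noteq> m'" for m m'
        using inj that by (auto simp: M'_def)
      show "even (card X')" using odd cX' by simp
      fix A assume A: "A \<subseteq> X'" "card (X' - A) \<le> card A" "X' - A \<noteq> {}"
        "\<And>a. a \<in> X' - A \<Longrightarrow> a \<notin> M' \<and> mates a \<noteq> {} \<and> mates a \<inter> X' \<subseteq> A"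
      define L where "L = X' - A"
      have fA: "finite A" using A(1) fX' finite_subset by blast
      have LF: "L \<subseteq> F" using X'N NF by (auto simp: L_def)
      \<comment> \<open>The triangle of \<open>m0\<close> brings in \<open>t\<close>, which lies
        outside \<open>N\<close> and costs one in the count. As \<open>card X'\<close> is even, the
        required bound can fail only for \<open>card L = card A = 1\<close>; then \<open>b\<close>
        sees just two vertices of one triangle, against \<open>not_tri\<close>.\<close>
      have sub: "(\<Union>a\<in>L. mates a) \<subseteq> insert t A"
      proof
        fix s assume "s \<in> (\<Union>a\<in>L. mates a)"
        then obtain a where a: "a \<in> X' - A" "s \<in> mates a" by (auto simp: L_def)
        show "s \<in> insert t A"
        proof (cases "a \<in> {m0, q0}")
          case True
          then have "s \<in> {q0, t} \<or> s \<in> {m0, t}" using a(2) t(2,3) by blast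
          then have "s = t \<or> s \<in> X'" using m0X by (auto simp: X'_def)
          then show ?thesis using A(4)[OF a(1)] a(2) by blast
        next
          case False
          then have "a \<in> X" "a \<notin> M" using a(1) A(4)[OF a(1)] by (auto simp: X'_def M'_def)
          then have "s \<in> X'" using full a(2) by (auto simp: X'_def)
          then show ?thesis using A(4)[OF a(1)] a(2) by blast
        qed
      qed
      have "card (\<Union>a\<in>L. mates a) = 2 * card L"
      proof (rule card_UN_mates[OF LF])
        show "mates a \<noteq> {}" if "a \<in> L" for a using A(4) that by (auto simp: L_def)
        show "mates a \<inter> L = {}" if "a \<in> L" for a using A(4) that by (auto simp: L_def)
      qed
      then have cA: "2 * card L \<le> card A + 1"
        using card_mono[OF _ sub] fA by (auto simp: card_insert_if split: if_splits)
      have cX: "card X' = card A + card L"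
        using card_mono[OF fX' A(1)] A(1) fA by (simp add: L_def card_Diff_subset)
      have ev: "even (card A + card L)" using cX' cX odd by simp
      have "card L \<noteq> 0" using A(3) fX' by (simp add: L_def)
      have "\<not> (card L = 1 \<and> card A = 1)"
      proof
        assume "card L = 1 \<and> card A = 1"
        then have c2: "card X' = 2" using cX by simp
        have "{m0, q0} \<subseteq> X'" using m0X by (auto simp: X'_def)
        then have XC: "X' = {m0, q0}" using c2 fX' q0m(2) card_subset_eq[of X' "{m0, q0}"] by simp
        then have "X = {m0}" using q0X m0X by (auto simp: X'_def)
        then have "M = {m0}" using m0(1) by (auto simp: X_def)
        then have "N \<subseteq> {m0, q0}" using NX \<open>X = {m0}\<close> by (auto simp: q0_def)
        then have "N \<subseteq> cell m0" using q0m by (auto simp: cell_def)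
        moreover have "2 \<le> card N" using card_mono[OF fN X'N] c2 by simp
        ultimately show False using not_tri[of m0] m0X XN by auto
      qed
      then have "card L + 2 \<le> card A + 1"
        using cA \<open>card L \<noteq> 0\<close> ev by (cases "card L = 1"; cases "card A = 2") auto
      then show "card (X' - A) + 2 \<le> card A + of_bool (even (card X'))"
        using odd cX' unfolding L_def[symmetric] by simp
    qed
  qed
qed

text \<open>Together with an edge from \<open>w\<close> to another odd vertex, the set \<open>B\<close> is removed in the cases below: it
  makes the triangle \<open>T\<close> odd, and adding it again leaves \<open>w\<close> with two ends.\<close>

definition attaches :: "'a \<Rightarrow> 'a set \<Rightarrow> 'a set set \<Rightarrow> bool" where
  "attaches w T B \<longleftrightarrow> B \<subseteq> E \<and> odd (card (nb B w)) \<and> nb B w \<subseteq> T \<and> (\<forall>t\<in>T. card (nb B t) = 1) \<and>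
     (\<forall>t. t \<notin> T \<longrightarrow> t \<noteq> w \<longrightarrow> nb B t = {}) \<and>
     (\<forall>E' P. path_system E' P \<longrightarrow> E' \<subseteq> E - B \<longrightarrow> (\<forall>x\<in>insert w T. 1 \<le> ends_at P x) \<longrightarrow>
       (\<forall>y\<in>insert w T. \<forall>x\<in>nb E' y - F. 1 \<le> ends_at P x) \<longrightarrow>
       (\<exists>P'. path_system (E' \<union> B) P' \<and> card P' = card P \<and> 2 \<le> ends_at P' w \<and>
         (\<forall>x. x \<notin> insert w T \<longrightarrow> ends_at P' x = ends_at P x)))"

lemma attachesD:
  assumes "attaches w T B"
  shows "B \<subseteq> E" "odd (card (nb B w))" "nb B w \<subseteq> T" "\<And>t. t \<in> T \<Longrightarrow> card (nb B t) = 1"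
    "\<And>t. t \<notin> T \<Longrightarrow> t \<noteq> w \<Longrightarrow> nb B t = {}"
  using assms unfolding attaches_def by blast+

lemma attaches_restore:
  assumes "attaches w T B" "path_system E' P" "E' \<subseteq> E - B" "\<And>x. x \<in> insert w T \<Longrightarrow> 1 \<le> ends_at P x"
    and "\<And>x y. y \<in> insert w T \<Longrightarrow> x \<in> nb E' y \<Longrightarrow> x \<notin> F \<Longrightarrow> 1 \<le> ends_at P x"
  shows "\<exists>P'. path_system (E' \<union> B) P' \<and> card P' = card P \<and> 2 \<le> ends_at P' w \<and>
    (\<forall>x. x \<notin> insert w T \<longrightarrow> ends_at P' x = ends_at P x)"
  using assms unfolding attaches_def by blast

lemma attachesI:
  assumes "B \<subseteq> E" "odd (card (nb B w))" "nb B w \<subseteq> T" "\<And>t. t \<in> T \<Longrightarrow> card (nb B t) = 1"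
    and "\<And>t. t \<notin> T \<Longrightarrow> t \<noteq> w \<Longrightarrow> nb B t = {}"
    and "\<And>E' P. path_system E' P \<Longrightarrow> E' \<subseteq> E - B \<Longrightarrow> (\<And>x. x \<in> insert w T \<Longrightarrow> 1 \<le> ends_at P x) \<Longrightarrow>
      (\<And>x y. y \<in> insert w T \<Longrightarrow> x \<in> nb E' y \<Longrightarrow> x \<notin> F \<Longrightarrow> 1 \<le> ends_at P x) \<Longrightarrow>
      \<exists>P'. path_system (E' \<union> B) P' \<and> card P' = card P \<and> 2 \<le> ends_at P' w \<and>
        (\<forall>x. x \<notin> insert w T \<longrightarrow> ends_at P' x = ends_at P x)"
  shows "attaches w T B"
  unfolding attaches_def using assms by blast

text \<open>If \<open>w\<close> is adjacent to all of \<open>T\<close>, the three edges between them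
  are taken. If it misses the vertex \<open>r\<close>, then \<open>B\<close> consists of
  \<open>wp\<close> and the edge \<open>qr\<close>: \<open>qr\<close> returns at \<open>q\<close>,
  and \<open>r\<close>, which alone may lose its last end, is no neighbour of \<open>w\<close> when
  \<open>wp\<close> returns at \<open>w\<close>.\<close>

lemma attaches_exists:
  assumes u: "u \<in> F" "mates u \<noteq> {}" and T: "T = cell u" and w: "w \<in> V" "w \<notin> F"
    and N: "nb E w \<inter> F \<subseteq> T" "2 \<le> card (nb E w \<inter> F)"
  shows "\<exists>B. attaches w T B"
proof (cases "nb E w \<inter> F = T")
  case True
  define B where "B = star w T"
  have TF: "T \<subseteq> F" using True by blast
  have fT: "finite T" using TF finite_F finite_subset by blast
  have wT: "w \<notin> T" using TF w by blast
  have "card (mates u) = 2" "u \<notin> mates u" using card_mates u matesD by blast+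
  then have cT: "card T = 3" using finite_F by (simp add: T cell_def mates_def)
  have nbB: "nb B t = (if t = w then T else if t \<in> T then {w} else {})" for t
    using wT by (simp add: B_def nb_star)
  show ?thesis
  proof (intro exI[of _ B] attachesI)
    show "B \<subseteq> E" using True by (auto simp: B_def star_def nb_def)
    show "odd (card (nb B w))" "nb B w \<subseteq> T" using cT by (simp_all add: nbB)
    show "card (nb B t) = 1" if "t \<in> T" for t using that wT by (auto simp: nbB)
    show "nb B t = {}" if "t \<notin> T" "t \<noteq> w" for t using that by (simp add: nbB)
    fix E' P assume PS: "path_system E' P" and E': "E' \<subseteq> E - B" and ge: "\<And>x. x \<in> insert w T \<Longrightarrow> 1 \<le> ends_at P x"
      and odd: "\<And>x y. y \<in> insert w T \<Longrightarrow> x \<in> nb E' y \<Longrightarrow> x \<notin> F \<Longrightarrow> 1 \<le> ends_at P x"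
    have sub: "nb E' t \<subseteq> nb E t - nb B t" for t using E' by (auto simp: nb_def)
    obtain A P1 where A: "A \<subseteq> T" "card (T - A) \<le> card A" "path_system (E' \<union> star w A) P1"
      "card P1 = card P" "ends_at P1 w = ends_at P w + card A"
      "\<And>x. x \<noteq> w \<Longrightarrow> x \<notin> A \<Longrightarrow> ends_at P1 x = ends_at P x"
    proof (rule add_star[OF PS fT wT])
      show "T \<inter> nb E' w = {}" using sub[of w] by (auto simp: nbB)
      show "1 \<le> ends_at P x" if "x \<in> T" for x using ge that by simp
      show "1 \<le> ends_at P x" if "x \<in> nb E' w" for x
        using odd[of w x] that ge[of x] sub[of w] N(1) by blast
    qed blast
    define L where "L = T - A"
    have f: "finite A" "finite L" using A(1) fT finite_subset by (auto simp: L_def)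
    have wA: "w \<notin> A" "w \<notin> L" using wT A(1) by (auto simp: L_def)
    have c: "card A + card L = 3"
      using card_mono[OF fT A(1)] A(1) f cT by (simp add: L_def card_Diff_subset)
    \<comment> \<open>\<open>w\<close> has one end at the start, gains at least two from
      \<open>A\<close> and pays at most one for \<open>L\<close>. So two ends remain, and up to two
      mates without ends are tolerated at the last vertex.\<close>
    have "card L \<le> 1" using c A(2) by (simp add: L_def)
    then have en: "card L + 2 \<le> ends_at P1 w" using A(5) c ge[of w] by simp
    have nbw: "L \<inter> nb (E' \<union> star w A) w = {}"
      using wA sub[of w] by (auto simp: nb_star L_def nbB)
    have z: "card {x \<in> nb (E' \<union> star w A) a. ends_at P1 x = 0} \<le> 2" if a: "a \<in> L" for a
    proof -
      have aT: "a \<in> T" "a \<noteq> w" "a \<notin> A" using a wT by (auto simp: L_def)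
      have nba: "nb (E' \<union> star w A) a = nb E' a" using aT wA by (simp add: nb_star)
      have "{x \<in> nb (E' \<union> star w A) a. ends_at P1 x = 0} \<subseteq> nb E a \<inter> F"
      proof
        fix x assume "x \<in> {x \<in> nb (E' \<union> star w A) a. ends_at P1 x = 0}"
        then have x: "x \<in> nb E' a" "ends_at P1 x = 0" using nba by auto
        then have xw: "x \<in> nb E a" "x \<noteq> w" using sub[of a] aT by (auto simp: nbB)
        have "x \<in> F"
        proof (rule ccontr)
          assume "x \<notin> F"
          then have "x \<notin> A" using A(1) TF by blast
          then show False using A(6)[OF xw(2)] odd[of a x] x aT \<open>x \<notin> F\<close> by simp
        qed
        then show "x \<in> nb E a \<inter> F" using xw by blast
      qed
      then have "card {x \<in> nb (E' \<union> star w A) a. ends_at P1 x = 0} \<le> card (nb E a \<inter> F)"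
        using finite_F by (intro card_mono) auto
      then show ?thesis using le2[of a] aT TF by auto
    qed
    obtain P2 where P2: "path_system (E' \<union> star w A \<union> star w L) P2" "card P2 = card P1"
      "ends_at P2 w + card L = ends_at P1 w" "\<And>x. x \<noteq> w \<Longrightarrow> x \<notin> L \<Longrightarrow> ends_at P2 x = ends_at P1 x"
      using add_leaves[OF f(2) A(3) wA(2) nbw z en] by blast
    have "star w A \<union> star w L = B" using A(1) by (simp flip: star_Un add: L_def B_def Un_absorb1)
    then have "E' \<union> star w A \<union> star w L = E' \<union> B" by blast
    moreover have "\<forall>x. x \<notin> insert w T \<longrightarrow> ends_at P2 x = ends_at P x"
      using P2(4) A(1,6) by (auto simp: L_def)
    moreover have "2 \<le> ends_at P2 w" using P2(3) en by simp
    ultimately show "\<exists>P'. path_system (E' \<union> B) P' \<and> card P' = card P \<and> 2 \<le> ends_at P' w \<and>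
        (\<forall>x. x \<notin> insert w T \<longrightarrow> ends_at P' x = ends_at P x)"
      using P2(1,2) A(4) by (intro exI[of _ P2]) simp
  qed
next
  case False
  then obtain r where r: "r \<in> T" "r \<notin> nb E w \<inter> F" using N(1) by blast
  have TF: "T \<subseteq> F" using u matesD by (auto simp: T cell_def)
  have rF: "r \<in> F" using r TF by blast
  have Tr: "cell r = T" using cell_eq[OF u(1)] r T by simp
  have "mates r \<noteq> {}"
  proof
    assume "mates r = {}"
    then have "T = {r}" using Tr by (simp add: cell_def)
    then show False using u T matesD by (auto simp: cell_def)
  qed
  then obtain p where "p \<in> mates r" by blast
  then obtain q where pq: "q \<noteq> p" "mates r = {p, q}" "mates p = {r, q}" "mates q = {r, p}"
    using mates_pair[OF rF] by metis
  have Teq: "T = {r, p, q}" using Tr pq by (simp add: cell_def)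
  have rpq: "r \<noteq> p" "r \<noteq> q" using pq(2) matesD by blast+
  have "nb E w \<inter> F \<subseteq> {p, q}" using N(1) Teq r(2) by auto
  then have Npq: "nb E w \<inter> F = {p, q}"
    using N(2) card_seteq[of "{p, q}" "nb E w \<inter> F"] pq(1) by simp
  have wT: "w \<notin> T" using TF w by blast
  have wpq: "w \<noteq> p" "w \<noteq> q" "w \<noteq> r" using wT Teq by auto
  define B where "B = {{w, p}, {q, r}}"
  have nbB: "nb B t = (if t = w then {p} else if t = p then {w} else if t = q then {r} else if t = r then {q} else {})" for t
    using wpq rpq pq(1) by (auto simp: B_def nb_insert)
  have qr: "r \<in> nb E q" using pq(4) matesD by blast
  show ?thesis
  proof (intro exI[of _ B] attachesI)
    show "B \<subseteq> E" using Npq qr by (auto simp: B_def nb_def)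
    show "odd (card (nb B w))" "nb B w \<subseteq> T" using Teq by (simp_all add: nbB)
    show "card (nb B t) = 1" if "t \<in> T" for t using that wpq by (auto simp: nbB Teq)
    show "nb B t = {}" if "t \<notin> T" "t \<noteq> w" for t using that by (auto simp: nbB Teq)
    fix E' P assume PS: "path_system E' P" and E': "E' \<subseteq> E - B" and ge: "\<And>x. x \<in> insert w T \<Longrightarrow> 1 \<le> ends_at P x"
      and odd: "\<And>x y. y \<in> insert w T \<Longrightarrow> x \<in> nb E' y \<Longrightarrow> x \<notin> F \<Longrightarrow> 1 \<le> ends_at P x"
    have sub: "nb E' t \<subseteq> nb E t - nb B t" for t using E' by (auto simp: nb_def)
    have inT: "x \<in> T" if "x \<in> nb E' y" "y \<in> insert w T" "x \<in> F" for x y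
    proof (cases "y = w")
      case True
      then show ?thesis using that sub[of y] N(1) by blast
    next
      case False
      then have "x \<in> mates y" "cell y = T" using that sub[of y] cell_eq[OF u(1)] T by (auto simp: mates_def)
      then show ?thesis by (auto simp: cell_def)
    qed
    have ge': "1 \<le> ends_at P x" if "x \<in> nb E' y" "y \<in> insert w T" for x y
      using odd[OF that(2,1)] inT[OF that] ge[of x] by (cases "x \<in> F") auto
    have rq: "r \<notin> nb E' q" using sub[of q] wpq pq(1) by (auto simp: nbB)
    obtain P1 where P1: "path_system (insert {q, r} E') P1" "shifts_end P P1 r q"
    proof (rule add_edge_good[OF PS])
      show "{q, r} \<notin> E'" using rq by (simp add: edge_iff_nb)
      show "q \<noteq> r" "1 \<le> ends_at P r" using rpq ge Teq by auto
      show "1 \<le> ends_at P x" if "x \<in> nb E' q" for x using ge'[OF that] Teq by simp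
    qed blast
    note s = P1(2)[unfolded shifts_end_def]
    have nbw: "nb (insert {q, r} E') w = nb E' w" using wpq rpq by (simp add: nb_insert)
    have pw: "p \<notin> nb E' w" using sub[of w] by (auto simp: nbB)
    obtain P2 where P2: "path_system (insert {w, p} (insert {q, r} E')) P2" "shifts_end P1 P2 p w"
    proof (rule add_edge_good[OF P1(1)])
      show "{w, p} \<notin> insert {q, r} E'" unfolding edge_iff_nb nbw by (rule pw)
      show "w \<noteq> p" by (rule wpq)
      show "1 \<le> ends_at P1 p" using s rpq pq(1) ge[of p] Teq by auto
      fix x assume "x \<in> nb (insert {q, r} E') w"
      then have x: "x \<in> nb E' w" using nbw by simp
      then have "x \<noteq> r" using sub[of w] r(2) rF by blast
      then show "1 \<le> ends_at P1 x" using s ge'[OF x] by (cases "x = q") auto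
    qed blast
    note s2 = P2(2)[unfolded shifts_end_def]
    have "insert {w, p} (insert {q, r} E') = E' \<union> B" by (auto simp: B_def)
    moreover have "2 \<le> ends_at P2 w" using s s2 wpq ge[of w] by simp
    moreover have "\<forall>x. x \<notin> insert w T \<longrightarrow> ends_at P2 x = ends_at P x"
      using s s2 Teq by simp
    ultimately show "\<exists>P'. path_system (E' \<union> B) P' \<and> card P' = card P \<and> 2 \<le> ends_at P' w \<and>
        (\<forall>x. x \<notin> insert w T \<longrightarrow> ends_at P' x = ends_at P x)"
      using P2(1) s s2 by (intro exI[of _ P2]) simp
  qed
qed

text \<open>Removing \<open>wv\<close> in addition to \<open>Bw\<close> keeps \<open>w\<close> odd,
  so \<open>w\<close> has the end required by \<open>attaches_restore\<close>. The price is that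
  \<open>v\<close> becomes even and may lack ends. This is harmless: without \<open>wv\<close>,
  \<open>v\<close> is adjacent neither to \<open>w\<close> nor to the triangle, and when
  \<open>wv\<close> returns at \<open>v\<close>, all its other neighbours are odd.\<close>

lemma case_pendant:
  assumes u: "u \<in> F" "mates u \<noteq> {}" and T: "T = cell u" and w: "w \<in> V" "w \<notin> F"
    and N: "nb E w \<inter> F \<subseteq> T" "2 \<le> card (nb E w \<inter> F)"
    and v: "v \<in> nb E w" "v \<notin> F" "nb E v \<inter> F = {}"
  shows "decomposable V E"
proof -
  obtain Bw where att: "attaches w T Bw" using attaches_exists[OF u T w N] by blast
  note Bw = attachesD[OF att]
  have TF: "T \<subseteq> F" using u matesD by (auto simp: T cell_def)
  have wv: "w \<noteq> v" "w \<notin> T" "v \<notin> T" "v \<in> V" using v grD(5)[of w] grD(3)[OF v(1)] TF w by auto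
  define B where "B = insert {w, v} Bw"
  have BE: "B \<subseteq> E" "B \<noteq> {}" using Bw(1) v by (auto simp: B_def nb_def)
  have nbB: "nb B w = insert v (nb Bw w)" "nb B v = {w}" "\<And>t. t \<noteq> w \<Longrightarrow> t \<noteq> v \<Longrightarrow> nb B t = nb Bw t"
    using wv Bw(5)[of v] by (auto simp: B_def nb_insert)
  have ew: "even (card (nb B w))"
    using Bw(1-3) wv grD(8)[OF Bw(1), of w] by (auto simp: nbB(1) card_insert_if)
  have F': "x = v \<or> x \<in> F \<and> x \<notin> T" if "x \<in> evens V (E - B)" for x
  proof -
    have x: "x \<in> F \<longleftrightarrow> even (card (nb B x))" using that evens_Diff[OF gr BE(1)] by blast
    show ?thesis using x nbB(3)[of x] Bw(4,5)[of x] ew w TF by (cases "x = v"; cases "x = w"; cases "x \<in> T") auto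
  qed
  have vw': "v \<notin> nb (E - B) w" by (simp add: nb_Diff nbB(1))
  obtain P where P: "path_system (E - B) P" "card P \<le> card V"
  proof (rule reduce_two[OF le2 BE])
    fix t assume "nb B t \<noteq> {}"
    then consider "t = w" | "t = v" | "t \<in> T" using nbB(3)[of t] Bw(5)[of t] by blast
    then show "nb (E - B) t \<inter> evens V (E - B) = {} \<or> t \<in> F \<and> t \<notin> evens V (E - B)"
    proof cases
      case 1
      then show ?thesis using F' N(1) vw' by (auto simp: nb_Diff)
    next
      case 2
      then show ?thesis using F' v(3) grD(5)[of v] by (auto simp: nb_Diff)
    next
      case 3
      then show ?thesis using F'[of t] TF wv by auto
    qed
  qed auto
  have good: "1 \<le> ends_at P x" if "x \<in> V" "x \<noteq> v" "x \<notin> F \<or> x \<in> T" for x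
    using ends_odd[OF P(1) that(1)] F'[of x] that by blast
  have "\<exists>P'. path_system (E - B \<union> Bw) P' \<and> card P' = card P \<and> 2 \<le> ends_at P' w \<and>
        (\<forall>x. x \<notin> insert w T \<longrightarrow> ends_at P' x = ends_at P x)"
  proof (rule attaches_restore[OF att P(1)])
    show "E - B \<subseteq> E - Bw" by (auto simp: B_def)
    show "1 \<le> ends_at P x" if "x \<in> insert w T" for x
      using good[of x] that w wv TF evens_in_V[of x V E] by blast
    fix x y assume xy: "y \<in> insert w T" "x \<in> nb (E - B) y" "x \<notin> F"
    have "x \<noteq> v"
    proof
      assume "x = v"
      then have "y \<noteq> w" using xy vw' by auto
      then have "y \<in> nb E v \<inter> F" using xy \<open>x = v\<close> in_nb_sym[of y E v] TF by (auto simp: nb_Diff)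
      then show False using v by blast
    qed
    then show "1 \<le> ends_at P x" using good[of x] xy grD(3)[of x y] by (auto simp: nb_Diff)
  qed
  then obtain P1 where P1: "path_system (E - B \<union> Bw) P1" "card P1 = card P" "2 \<le> ends_at P1 w"
    "\<And>x. x \<notin> insert w T \<Longrightarrow> ends_at P1 x = ends_at P x" by blast
  have nbv: "nb (E - B \<union> Bw) v = nb E v - {w}" using Bw(5)[of v] wv by (simp add: nb_Diff nbB(2))
  obtain P2 where P2: "path_system (insert {v, w} (E - B \<union> Bw)) P2" "shifts_end P1 P2 w v"
  proof (rule add_edge_good[OF P1(1)])
    show "{v, w} \<notin> E - B \<union> Bw" unfolding edge_iff_nb nbv by simp
    show "v \<noteq> w" "1 \<le> ends_at P1 w" using wv P1(3) by auto
    fix x assume "x \<in> nb (E - B \<union> Bw) v"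
    then have x: "x \<in> nb E v" "x \<noteq> w" using nbv by auto
    then have "x \<notin> F" "x \<noteq> v" "x \<in> V" using v(3) grD(5)[of v] grD(3)[OF x(1)] by auto
    moreover have "x \<notin> T" using \<open>x \<notin> F\<close> TF by blast
    ultimately show "1 \<le> ends_at P1 x" using P1(4)[of x] good[of x] x by auto
  qed blast
  have "insert {v, w} (E - B \<union> Bw) = E" using BE Bw(1) by (auto simp: B_def insert_commute)
  then show ?thesis using P2 P1(2) P(2) decomposableI[of P2] by (simp add: shifts_end_def)
qed

text \<open>\<open>v\<close> sees \<open>p\<close> and \<open>q\<close> of a second triangle.
  Besides \<open>Bw\<close> and \<open>wv\<close>, the edges \<open>vp\<close> and \<open>qr\<close>
  are removed, so \<open>v\<close> loses two edges and stays odd like \<open>w\<close>. After the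
  return of \<open>qr\<close> only \<open>r\<close> in \<open>T'\<close> may lack ends. The two ends
  that \<open>attaches_restore\<close> leaves at \<open>w\<close> outweigh \<open>r\<close> when
  \<open>wv\<close> returns at \<open>v\<close>; \<open>v\<close> then has two ends itself, which
  outweigh \<open>r\<close> when \<open>vp\<close> returns at \<open>p\<close>. As \<open>w\<close>
  is not adjacent to \<open>p\<close>, its loss of an end does no harm there.\<close>

lemma case_linked:
  assumes u: "u \<in> F" "mates u \<noteq> {}" and T: "T = cell u" and w: "w \<in> V" "w \<notin> F"
    and N: "nb E w \<inter> F \<subseteq> T" "2 \<le> card (nb E w \<inter> F)"
    and v: "v \<in> nb E w" "v \<notin> F" and u': "u' \<in> F" "u' \<notin> T" and T': "T' = cell u'"
    and N': "nb E v \<inter> F \<subseteq> T'" "2 \<le> card (nb E v \<inter> F)"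
  shows "decomposable V E"
proof -
  obtain Bw where att: "attaches w T Bw" using attaches_exists[OF u T w N] by blast
  note Bw = attachesD[OF att]
  have TF: "T \<subseteq> F" "T' \<subseteq> F" using u u' matesD by (auto simp: T T' cell_def)
  have TT': "T \<inter> T' = {}"
  proof (rule ccontr)
    assume "T \<inter> T' \<noteq> {}"
    then have "cell u = cell u'" using cell_eq u(1) u'(1) T T' by blast
    then show False using u'(2) T by (simp add: cell_def)
  qed
  obtain p q where pq: "p \<in> nb E v \<inter> F" "q \<in> nb E v \<inter> F" "p \<noteq> q"
  proof -
    have "\<not> nb E v \<inter> F \<subseteq> {x}" for x using N'(2) card_mono[of "{x}" "nb E v \<inter> F"] by auto
    then show ?thesis using that by (metis insertI1 subsetI subset_singletonD)
  qed
  have pT: "cell p = T'" "cell q = T'" using cell_eq[OF u'(1)] pq N'(1) T' by blast+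
  then have "q \<in> cell p" by (auto simp: cell_def)
  then have "q \<in> mates p" using pq(3) by (simp add: cell_def)
  then obtain r where r: "r \<noteq> q" "mates p = {q, r}" "mates q = {p, r}" "mates r = {p, q}"
    using mates_pair pq(1) by blast
  have Teq: "T' = {p, q, r}" using pT(1) r by (simp add: cell_def)
  have pqF: "p \<in> F" "q \<in> F" "r \<in> F" "r \<noteq> p" using Teq TF r(2) matesD by blast+
  have nT: "p \<notin> T" "q \<notin> T" "r \<notin> T" using TT' Teq by auto
  have V: "p \<in> V" "q \<in> V" "r \<in> V" "v \<in> V" using pqF evens_in_V[of _ V E] grD(3)[OF v(1)] by auto
  have d: "w \<noteq> v" "w \<notin> T" "v \<notin> T" "w \<noteq> p" "w \<noteq> q" "w \<noteq> r" "v \<noteq> p" "v \<noteq> q" "v \<noteq> r"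
    using v grD(5)[of w] TF w pqF by auto
  have qr: "r \<in> nb E q" using r(3) matesD by blast
  define B where "B = insert {w, v} (insert {v, p} (insert {q, r} Bw))"
  have BE: "B \<subseteq> E" "B \<noteq> {}" using Bw(1) v(1) pq qr by (auto simp: B_def nb_def)
  have nbB: "nb B w = insert v (nb Bw w)" "nb B v = {w, p}" "nb B p = {v}" "nb B q = {r}" "nb B r = {q}"
    "\<And>t. t \<notin> {w, v, p, q, r} \<Longrightarrow> nb B t = nb Bw t"
    using d pq(3) pqF(4) r(1) nT Bw(5)[of v] Bw(5)[of p] Bw(5)[of q] Bw(5)[of r]
    by (simp_all add: B_def nb_insert)
  have ew: "even (card (nb B w))"
    using Bw(1-3) d grD(8)[OF Bw(1), of w] by (auto simp: nbB(1) card_insert_if)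
  have F': "x \<in> F \<and> x \<notin> T \<and> x \<notin> T'" if "x \<in> evens V (E - B)" for x
  proof -
    have x: "x \<in> F \<longleftrightarrow> even (card (nb B x))" using that evens_Diff[OF gr BE(1)] by blast
    consider "x = w" | "x = v" | "x \<in> T'" | "x \<in> T" "x \<notin> {w, v, p, q, r}" | "x \<notin> T" "x \<notin> {w, v, p, q, r}"
      using Teq TT' d by blast
    then show ?thesis
    proof cases
      case 1
      then show ?thesis using x ew w by simp
    next
      case 2
      then show ?thesis using x v d by (simp add: nbB(2))
    next
      case 3
      then show ?thesis using x Teq pqF by (auto simp: nbB)
    next
      case 4
      then show ?thesis using x nbB(6)[of x] Bw(4)[of x] TF by auto
    next
      case 5
      then show ?thesis using x nbB(6)[of x] Bw(5)[of x] Teq by auto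
    qed
  qed
  obtain P where P: "path_system (E - B) P" "card P \<le> card V"
  proof (rule reduce_two[OF le2 BE])
    fix t assume "nb B t \<noteq> {}"
    then consider "t = w" | "t = v" | "t \<in> T \<union> T'" using nbB(6)[of t] Bw(5)[of t] Teq by blast
    then show "nb (E - B) t \<inter> evens V (E - B) = {} \<or> t \<in> F \<and> t \<notin> evens V (E - B)"
    proof cases
      case 1
      then show ?thesis using F' N(1) by (auto simp: nb_Diff)
    next
      case 2
      then show ?thesis using F' N'(1) by (auto simp: nb_Diff)
    next
      case 3
      then show ?thesis using F'[of t] TF by auto
    qed
  qed auto
  have good: "1 \<le> ends_at P x" if "x \<in> V" "x \<notin> F \<or> x \<in> T \<union> T'" for x
    using ends_odd[OF P(1) that(1)] F'[of x] that by blast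
  have nbq: "nb (E - B) q = nb E q - {r}" by (simp add: nb_Diff nbB)
  obtain P1 where P1: "path_system (insert {q, r} (E - B)) P1" "shifts_end P P1 r q"
  proof (rule add_edge_good[OF P(1)])
    show "{q, r} \<notin> E - B" unfolding edge_iff_nb nbq by simp
    show "q \<noteq> r" "1 \<le> ends_at P r" using r(1) good[of r] V Teq by auto
    fix x assume "x \<in> nb (E - B) q"
    then have x: "x \<in> nb E q" "x \<noteq> r" using nbq by auto
    have "x \<in> T'" if "x \<in> F" using that x r(3) Teq by (auto simp: mates_def)
    then show "1 \<le> ends_at P x" using good[of x] grD(3)[OF x(1)] by blast
  qed blast
  note s1 = P1(2)[unfolded shifts_end_def]
  have good1: "1 \<le> ends_at P1 x" if "x \<in> V" "x \<notin> F \<or> x \<in> T \<union> {p, q}" for x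
  proof -
    have "x \<noteq> r" using that nT pqF r(1) by auto
    then show ?thesis using s1 good[of x] that Teq by (cases "x = q") auto
  qed
  define E1 where "E1 = insert {q, r} (E - B)"
  have "\<exists>P'. path_system (E1 \<union> Bw) P' \<and> card P' = card P1 \<and> 2 \<le> ends_at P' w \<and>
        (\<forall>x. x \<notin> insert w T \<longrightarrow> ends_at P' x = ends_at P1 x)"
  proof (rule attaches_restore[OF att])
    show "path_system E1 P1" using P1(1) by (simp add: E1_def)
    have "{q, r} \<notin> Bw" using Bw(5)[of q] nT d by (auto simp: edge_iff_nb)
    moreover have "{q, r} \<in> E" using qr by (simp add: edge_iff_nb)
    ultimately show "E1 \<subseteq> E - Bw" by (auto simp: B_def E1_def)
    show "1 \<le> ends_at P1 x" if "x \<in> insert w T" for x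
      using good1[of x] that w TF evens_in_V[of x V E] by blast
    fix x y assume xy: "y \<in> insert w T" "x \<in> nb E1 y" "x \<notin> F"
    then have "x \<in> nb E y" using \<open>{q, r} \<in> E\<close> by (auto simp: E1_def nb_def)
    then show "1 \<le> ends_at P1 x" using good1[of x] grD(3)[of x y] xy(3) by blast
  qed
  then obtain P2 where P2: "path_system (E1 \<union> Bw) P2" "card P2 = card P1" "2 \<le> ends_at P2 w"
    "\<And>x. x \<notin> insert w T \<Longrightarrow> ends_at P2 x = ends_at P1 x" by blast
  define E2 where "E2 = E1 \<union> Bw"
  have nb2v: "nb E2 v = nb E v - {w, p}" and nb2p: "nb E2 p = nb E p - {v}"
    using d pq(3) pqF(4) r(1) nT Bw(5)[of v] Bw(5)[of p]
    by (simp_all add: E2_def E1_def nb_insert nb_Diff nbB)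
  have one: "card {x \<in> S. f x = 0} \<le> 1" if "{x \<in> S. f x = 0} \<subseteq> {r}" for S and f :: "'a \<Rightarrow> nat"
    using card_mono[OF _ that] by simp
  have good2: "1 \<le> ends_at P2 x" if "x \<in> V" "x \<noteq> w" "x \<notin> F \<or> x \<in> {p, q}" for x
  proof -
    have "x \<notin> insert w T" using that nT TF by auto
    then show ?thesis using P2(4)[of x] good1[of x] that by auto
  qed
  obtain P3 where P3: "path_system (insert {v, w} E2) P3" "shifts_end P2 P3 w v"
  proof (rule add_edge[of E2 P2 v w])
    show "path_system E2 P2" using P2(1) by (simp add: E2_def)
    show "{v, w} \<notin> E2" unfolding edge_iff_nb nb2v by simp
    show "v \<noteq> w" using d by simp
    have "{x \<in> nb E2 v. ends_at P2 x = 0} \<subseteq> {r}"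
    proof
      fix x assume x: "x \<in> {x \<in> nb E2 v. ends_at P2 x = 0}"
      then have x': "x \<in> nb E v" "x \<noteq> w" "x \<noteq> p" using nb2v by auto
      show "x \<in> {r}"
        using x x' good2[of x] grD(3)[OF x'(1)] N'(1) Teq by (cases "x \<in> F") auto
    qed
    from one[OF this] show "card {x \<in> nb E2 v. ends_at P2 x = 0} < ends_at P2 w" using P2(3) by simp
  qed blast
  note s3 = P3(2)[unfolded shifts_end_def]
  have nb3p: "nb (insert {v, w} E2) p = nb E p - {v}" using d nb2p by (auto simp: nb_insert)
  have wp: "w \<notin> nb E p" using N(1) pqF nT in_nb_sym[of w E p] by blast
  obtain P4 where P4: "path_system (insert {p, v} (insert {v, w} E2)) P4" "shifts_end P3 P4 v p"
  proof (rule add_edge[OF P3(1)])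
    show "{p, v} \<notin> insert {v, w} E2" unfolding edge_iff_nb nb3p by simp
    show "p \<noteq> v" using d by simp
    have "{x \<in> nb (insert {v, w} E2) p. ends_at P3 x = 0} \<subseteq> {r}"
    proof
      fix x assume x: "x \<in> {x \<in> nb (insert {v, w} E2) p. ends_at P3 x = 0}"
      then have x': "x \<in> nb E p" "x \<noteq> v" using nb3p by auto
      then have xw: "x \<noteq> w" using wp by blast
      have "x \<in> {q, r}" if "x \<in> F" using that x'(1) r(2) by (auto simp: mates_def)
      moreover have "ends_at P3 x = ends_at P2 x" using s3 x'(2) xw by simp
      ultimately show "x \<in> {r}"
        using x good2[OF grD(3)[OF x'(1)] xw] by (cases "x \<in> F") auto
    qed
    from one[OF this] show "card {x \<in> nb (insert {v, w} E2) p. ends_at P3 x = 0} < ends_at P3 v"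
      using s3 good2[of v] V d v by simp
  qed blast
  have "insert {p, v} (insert {v, w} E2) = E" using BE(1) by (auto simp: E2_def E1_def B_def insert_commute)
  then show ?thesis
    using P4 s3 s1 P2(2) P(2) decomposableI[of P4] by (simp add: shifts_end_def)
qed

end

section \<open>Graphs without even vertices\<close>

lemma path_system_single:
  assumes "distinct c" "2 \<le> length c"
  shows "path_system (path_edges c) {c, rev c}"
  using assms by (auto simp: path_system_def)

lemma path_system_Un:
  assumes "path_system E1 P1" "path_system E2 P2" "E1 \<inter> E2 = {}"
  shows "path_system (E1 \<union> E2) (P1 \<union> P2)"
proof -
  note D1 = path_systemD[OF assms(1)] and D2 = path_systemD[OF assms(2)]
  have cross: "path_edges p \<inter> path_edges q = {}" if "p \<in> P1" "q \<in> P2" for p q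
    using D1(7)[OF that(1)] D2(7)[OF that(2)] assms(3) by blast
  show ?thesis
    unfolding path_system_def
  proof (intro conjI ballI impI)
    show "finite (P1 \<union> P2)" using D1(1) D2(1) by simp
    show "(\<Union>p\<in>P1 \<union> P2. path_edges p) = E1 \<union> E2"
      using assms(1,2) by (simp add: path_system_def Union_Un_distrib)
  next
    fix p assume "p \<in> P1 \<union> P2"
    then show "distinct p" "2 \<le> length p" "rev p \<in> P1 \<union> P2" using D1(2-4) D2(2-4) by auto
  next
    fix p q assume "p \<in> P1 \<union> P2" "q \<in> P1 \<union> P2" "path_edges p \<inter> path_edges q \<noteq> {}"
    then show "q = p \<or> q = rev p" using D1(8) D2(8) cross[of p q] cross[of q p] by blast
  qed
qed

lemma ends_at_pair:
  assumes "distinct c" "2 \<le> length c"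
  shows "ends_at {c, rev c} x = of_bool (x = hd c) + of_bool (x = last c)"
proof -
  have "c \<noteq> []" using assms(2) by auto
  then have "ends_at {c, rev c} x =
      ends_at ({c, rev c} - {c, rev c}) x + of_bool (hd c = x) + of_bool (last c = x)"
    using rev_neq_self[OF assms] by (intro ends_at_split) auto
  moreover have "ends_at {} x = 0" by (simp add: ends_at_def)
  ultimately show ?thesis by (simp add: eq_commute[of x])
qed

lemma sum_ends_at:
  assumes "path_system E P" "graph_on V E"
  shows "(\<Sum>x\<in>V. ends_at P x) = card P"
proof -
  note D = path_systemD[OF assms(1)]
  have "hd p \<in> V" if p: "p \<in> P" for p
  proof -
    obtain a b q where "p = a # b # q" using D(3)[OF p] by (cases p; cases "tl p") auto
    then have "b \<in> nb E a" "hd p = a" using D(7)[OF p] by (auto simp: nb_def)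
    then show ?thesis using graph_onD(4)[OF assms(2)] by simp
  qed
  then have "P = (\<Union>x\<in>V. {p \<in> P. hd p = x})" by auto
  then have "card P = card (\<Union>x\<in>V. {p \<in> P. hd p = x})" by simp
  also have "\<dots> = (\<Sum>x\<in>V. ends_at P x)"
    unfolding ends_at_def using graph_onD(1)[OF assms(2)] D(1) by (subst card_UN_disjoint) auto
  finally show ?thesis by simp
qed

text \<open>Adding the edges of a cycle in cyclic order, each at its first vertex, leaves only the current
  vertex possibly without ends. The surplus end at the start \<open>h\<close> pays for the closing edge.\<close>

lemma restore_path:
  assumes "path_system E P" "graph_on V (E \<union> path_edges (cur # rest))" "distinct (cur # rest)"
    and "path_edges (cur # rest) \<inter> E = {}" "h \<notin> set (cur # rest)" "2 \<le> ends_at P h"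
    and "\<And>x. x \<in> V \<Longrightarrow> x \<noteq> cur \<Longrightarrow> 1 \<le> ends_at P x"
  shows "\<exists>P'. path_system (E \<union> path_edges (cur # rest)) P' \<and> card P' = card P \<and> 2 \<le> ends_at P' h \<and>
    (\<forall>x\<in>V. x \<noteq> last (cur # rest) \<longrightarrow> 1 \<le> ends_at P' x)"
  using assms
proof (induction rest arbitrary: cur E P)
  case Nil
  then show ?case by auto
next
  case (Cons y ys)
  have g: "graph_on V E" by (rule graph_onD(7)[OF Cons.prems(2)]) blast
  have "y \<in> nb (E \<union> path_edges (cur # y # ys)) cur" by (simp add: nb_def)
  then have yV: "y \<in> V" using graph_onD(3)[OF Cons.prems(2)] by blast
  obtain P1 where P1: "path_system (insert {cur, y} E) P1" "shifts_end P P1 y cur"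
  proof (rule add_edge_good[OF Cons.prems(1)])
    show "{cur, y} \<notin> E" "cur \<noteq> y" "1 \<le> ends_at P y"
      using Cons.prems(3,4) Cons.prems(7)[OF yV] by auto
    show "1 \<le> ends_at P w" if "w \<in> nb E cur" for w
      using Cons.prems(7)[of w] graph_onD(3)[OF g that] graph_onD(5)[OF g, of cur] that by auto
  qed blast
  note s = P1(2)[unfolded shifts_end_def]
  have e: "insert {cur, y} E \<union> path_edges (y # ys) = E \<union> path_edges (cur # y # ys)" by auto
  have "\<exists>P'. path_system (insert {cur, y} E \<union> path_edges (y # ys)) P' \<and> card P' = card P1 \<and>
    2 \<le> ends_at P' h \<and> (\<forall>x\<in>V. x \<noteq> last (y # ys) \<longrightarrow> 1 \<le> ends_at P' x)"
  proof (rule Cons.IH[OF P1(1)])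
    show "graph_on V (insert {cur, y} E \<union> path_edges (y # ys))" using Cons.prems(2) e by simp
    show "distinct (y # ys)" "h \<notin> set (y # ys)" using Cons.prems by auto
    have "{cur, y} \<notin> path_edges (y # ys)" using path_edges_subset[of "{cur, y}" "y # ys"] Cons.prems(3) by auto
    then show "path_edges (y # ys) \<inter> insert {cur, y} E = {}" using Cons.prems(4) by auto
    show "2 \<le> ends_at P1 h" using s Cons.prems(5,6) by auto
    fix x assume "x \<in> V" "x \<noteq> y"
    then show "1 \<le> ends_at P1 x" using s Cons.prems(7)[of x] by (cases "x = cur") auto
  qed
  then show ?case using e s by auto
qed

text \<open>All neighbours of the start of a longest path lie on the path, and one other than its
  second vertex closes a cycle. The cycle is returned as a path with a closing edge, the form in
  which it is restored.\<close>

lemma exists_cycle: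
  assumes g: "graph_on V E" and "V \<noteq> {}" and two: "\<And>x. x \<in> V \<Longrightarrow> 2 \<le> card (nb E x)"
  obtains h as z where "as \<noteq> []" "distinct (h # as @ [z])" "set (h # as @ [z]) \<subseteq> V"
    "path_edges (h # as @ [z]) \<subseteq> E" "{z, h} \<in> E"
proof -
  let ?S = "{p. p \<noteq> [] \<and> distinct p \<and> set p \<subseteq> V \<and> path_edges p \<subseteq> E}"
  have "?S \<subseteq> {p. set p \<subseteq> V \<and> distinct p}" by blast
  then have fS: "finite ?S"
    using finite_subset_distinct[OF graph_onD(1)[OF g]] finite_subset by blast
  obtain v where "v \<in> V" using assms(2) by blast
  then have "[v] \<in> ?S" by simp
  then have "Max (length ` ?S) \<in> length ` ?S" using fS by (intro Max_in) blast+
  then obtain p where p: "p \<in> ?S" "length p = Max (length ` ?S)" by (metis (no_types, lifting) imageE)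
  have max: "length q \<le> length p" if "q \<in> ?S" for q
    unfolding p(2) using that fS by (intro Max_ge) auto
  obtain h ps where hp: "p = h # ps" using p(1) by (cases p) auto
  have hV: "h \<in> V" using p(1) hp by auto
  have nbp: "nb E h \<subseteq> set ps"
  proof
    fix z assume z: "z \<in> nb E h"
    show "z \<in> set ps"
    proof (rule ccontr)
      assume "z \<notin> set ps"
      then have "z # p \<in> ?S"
        using p(1) z graph_onD(3,5)[OF g] hp in_nb_sym[of z E h] by (auto simp: nb_def)
      then show False using max by fastforce
    qed
  qed
  have "\<not> nb E h \<subseteq> {hd ps}" using two[OF hV] card_mono[of "{hd ps}" "nb E h"] by auto
  then obtain z where z: "z \<in> nb E h" "z \<noteq> hd ps" by blast
  then obtain as bs where ps: "ps = as @ z # bs" using nbp by (meson split_list subsetD)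
  then have "as \<noteq> []" using z(2) by auto
  have "path_edges (h # as @ [z]) \<subseteq> path_edges p"
  proof (cases bs)
    case Nil
    then show ?thesis using hp ps by simp
  next
    case (Cons b bs')
    then show ?thesis using path_edges_append[of "h # as" z b bs'] hp ps by auto
  qed
  then show ?thesis using that[of as h z] \<open>as \<noteq> []\<close> p(1) hp ps z(1) by (auto simp: nb_def insert_commute)
qed

context connected_step
begin

text \<open>Without the leaf, \<open>p\<close> is the only even vertex. The number of odd vertices
  is even, so \<open>card V'\<close> is odd, while \<open>card P\<close> is even. Hence
  \<open>card P\<close> is at most \<open>card V - 2\<close>, and there is room for the path
  \<open>lp\<close> in both orientations.\<close>

lemma case_leaf:
  assumes F: "F = {}" and l: "l \<in> V" "nb E l = {p}"
  shows "decomposable V E"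
proof -
  define V' where "V' = V - {l}"
  define E' where "E' = E - {{l, p}}"
  have pl: "p \<in> nb E l" "l \<in> nb E p" "p \<noteq> l" "p \<in> V"
    using l grD(5)[of l] in_nb_sym[of p E l] grD(3)[of p l] by auto
  have pE: "{l, p} \<in> E" using pl by (simp add: nb_def)
  have nb': "nb E' x = (if x = p then nb E p - {l} else nb E x)" if "x \<noteq> l" for x
    using pl that by (auto simp: E'_def nb_Diff nb_insert)
  have nbl: "nb E' l = {}" using l pl by (simp add: E'_def nb_Diff nb_insert)
  have gr': "graph_on V' E'"
    unfolding graph_on_def
  proof (intro conjI subsetI)
    show "finite V'" using grD(1) by (simp add: V'_def)
    fix e assume e: "e \<in> E'"
    then obtain u v where uv: "e = {u, v}" "u \<in> V" "v \<in> V" "u \<noteq> v"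
      using gr unfolding E'_def graph_on_def by blast
    have "u \<noteq> l" "v \<noteq> l" using e nbl uv by (auto simp: nb_def insert_commute)
    then show "e \<in> {{u, v} |u v. u \<in> V' \<and> v \<in> V' \<and> u \<noteq> v}" using uv by (auto simp: V'_def)
  qed
  have odd: "odd (card (nb E x))" if "x \<in> V" for x using F that by (auto simp: evens_def)
  have odd': "odd (card (nb E' x)) \<longleftrightarrow> x \<noteq> p" if "x \<in> V'" for x
  proof (cases "x = p")
    case True
    have "card (nb E p) = Suc (card (nb E p - {l}))" using card.remove[OF grD(6)[of p] pl(2)] .
    then show ?thesis using odd[OF pl(4)] True pl(3) nb'[of p] by simp
  next
    case False
    then show ?thesis using odd[of x] that nb'[of x] by (simp add: V'_def)
  qed
  then have ev: "evens V' E' \<subseteq> {p}" by (auto simp: evens_def)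
  have "sparse_evens V' E'"
    unfolding sparse_evens_def
  proof
    fix v
    have "card (nb E' v \<inter> evens V' E') \<le> card {p}" using ev by (intro card_mono) auto
    then show "card (nb E' v \<inter> evens V' E') \<le> 3" by simp
  qed
  moreover have "SET_free V' E'"
    unfolding SET_free_def
  proof (intro allI impI notI)
    fix C assume "SET_part V' E' C"
    then obtain a b c where "a \<noteq> b" "C \<inter> evens V' E' = {a, b, c}" unfolding SET_part_def by auto
    then have "{a, b} \<subseteq> {p}" using ev by blast
    then show False using \<open>a \<noteq> b\<close> by auto
  qed
  moreover have "card E' < card E" using pE grD(2) unfolding E'_def by (intro psubset_card_mono) auto
  moreover have cV: "card V = card V' + 1" using card.remove[OF grD(1) l(1)] by (simp add: V'_def)
  ultimately obtain P where P: "path_system E' P" "card P \<le> card V'"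
    using IH[OF gr'] by (auto simp: decomposable_def)
  have "{x \<in> V'. odd (ends_at P x)} = V' - {p}"
  proof -
    have "odd (ends_at P x) \<longleftrightarrow> x \<noteq> p" if "x \<in> V'" for x
      using odd'[OF that] even_degree_plus_ends[OF P(1), of x] by simp
    then show ?thesis by auto
  qed
  moreover have "even (\<Sum>x\<in>V'. ends_at P x)"
    using sum_ends_at[OF P(1) gr'] even_card_path_system[OF P(1)] by simp
  ultimately have "even (card (V' - {p}))"
    using even_sum_iff[of V' "ends_at P"] grD(1) by (simp add: V'_def)
  moreover have "card V' = card (V' - {p}) + 1"
    using pl(3,4) grD(1) card.remove[of V' p] by (simp add: V'_def)
  ultimately have "card P + 2 \<le> card V"
    using P(2) even_card_path_system[OF P(1)] cV by (cases "card P = card V'") auto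
  moreover have PS: "path_system ({{l, p}} \<union> E') ({[l, p], [p, l]} \<union> P)"
    using path_system_Un[OF path_system_single[of "[l, p]"] P(1)] pl(3) by (simp add: E'_def)
  moreover have "{{l, p}} \<union> E' = E" using pE by (auto simp: E'_def)
  moreover have "card ({[l, p], [p, l]} \<union> P) \<le> card P + 2"
    using card_Un_le[of "{[l, p], [p, l]}" P] pl(3) by simp
  ultimately show ?thesis using decomposableI by auto
qed

text \<open>Removing a cycle changes no parity: every vertex stays odd and has an end, and without
  even vertices no SET part can arise. The first edge returns at \<open>h\<close>, giving
  \<open>h\<close> the second end that finally pays for the closing edge.\<close>

lemma case_cycle:
  assumes F: "F = {}" "V \<noteq> {}" and two: "\<And>x. x \<in> V \<Longrightarrow> 2 \<le> card (nb E x)"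
  shows "decomposable V E"
proof -
  obtain h as z where c: "as \<noteq> []" "distinct (h # as @ [z])" "set (h # as @ [z]) \<subseteq> V"
    "path_edges (h # as @ [z]) \<subseteq> E" "{z, h} \<in> E"
    using exists_cycle[OF gr F(2) two] by metis
  obtain a as' where as: "as = a # as'" using c(1) by (cases as) auto
  define rest where "rest = as' @ [z]"
  have hr: "h # as @ [z] = h # a # rest" by (simp add: as rest_def)
  note c = c[unfolded hr]
  have z: "last (a # rest) = z" "z \<in> set rest" "rest \<noteq> []" by (auto simp: rest_def)
  let ?c = "h # a # rest"
  have PSc: "path_system (path_edges ?c) {?c, rev ?c}" using c(2) by (intro path_system_single) auto
  have zn: "{z, h} \<notin> path_edges ?c"
    using path_edges_subset[of "{z, h}" "a # rest"] c(2) z by (auto simp: doubleton_eq_iff)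
  have hz: "h \<noteq> z" using c(2) z by auto
  define B where "B = insert {z, h} (path_edges ?c)"
  have BE: "B \<subseteq> E" "B \<noteq> {}" using c by (auto simp: B_def)
  \<comment> \<open>The path from \<open>h\<close> to \<open>z\<close>, taken as a system of its
    own, has ends only at \<open>h\<close> and \<open>z\<close>; exactly there the closing edge
    corrects the parity.\<close>
  have evB: "even (card (nb B x))" for x
  proof -
    have "even (card (nb (path_edges ?c) x) + ends_at {?c, rev ?c} x)"
      by (rule even_degree_plus_ends[OF PSc])
    moreover have "ends_at {?c, rev ?c} x = of_bool (x = h) + of_bool (x = z)"
      using ends_at_pair[of ?c x] c(2) z by simp
    moreover have "nb B x = (if x = z then insert h (nb (path_edges ?c) x) else
        if x = h then insert z (nb (path_edges ?c) x) else nb (path_edges ?c) x)"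
      using hz by (simp add: B_def nb_insert)
    moreover have "h \<notin> nb (path_edges ?c) z" "z \<notin> nb (path_edges ?c) h"
      using zn by (simp_all add: nb_def insert_commute)
    moreover have "finite (nb (path_edges ?c) x)" by (rule finite_nb[OF PSc])
    ultimately show ?thesis using hz by (auto split: if_splits)
  qed
  have ev: "evens V (E - B) = {}" using F evB by (auto simp: evens_Diff[OF gr BE(1)])
  obtain P where P: "path_system (E - B) P" "card P \<le> card V"
    using IH_Diff[OF BE] ev by (auto simp: sparse_evens_def SET_free_def SET_part_def)
  have good: "1 \<le> ends_at P x" if "x \<in> V" for x using ends_odd[OF P(1) that] ev by simp
  have hE: "{h, a} \<in> B" by (simp add: B_def)
  have av: "a \<in> V" "h \<in> V" "z \<in> V" using c(3) z by auto
  obtain P1 where P1: "path_system (insert {h, a} (E - B)) P1" "shifts_end P P1 a h"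
  proof (rule add_edge_good[OF P(1)])
    show "{h, a} \<notin> E - B" "h \<noteq> a" "1 \<le> ends_at P a" using hE c(2) good av by auto
    show "1 \<le> ends_at P w" if "w \<in> nb (E - B) h" for w
      using good grD(3)[of w h] that by (auto simp: nb_Diff)
  qed blast
  note s = P1(2)[unfolded shifts_end_def]
  define E1 where "E1 = insert {h, a} (E - B)"
  have E1E: "E1 \<union> path_edges (a # rest) = E - {{z, h}}"
  proof -
    have "path_edges ?c = insert {h, a} (path_edges (a # rest))" by simp
    then show ?thesis using BE zn unfolding B_def E1_def by blast
  qed
  have "\<exists>P'. path_system (E1 \<union> path_edges (a # rest)) P' \<and> card P' = card P1 \<and> 2 \<le> ends_at P' h \<and>
    (\<forall>x\<in>V. x \<noteq> last (a # rest) \<longrightarrow> 1 \<le> ends_at P' x)"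
  proof (rule restore_path)
    show "path_system E1 P1" using P1(1) by (simp add: E1_def)
    show "graph_on V (E1 \<union> path_edges (a # rest))" unfolding E1E by (rule grD(7)) blast
    show "distinct (a # rest)" "h \<notin> set (a # rest)" using c(2) by auto
    have "{h, a} \<notin> path_edges (a # rest)" using path_edges_subset[of "{h, a}" "a # rest"] c(2) by auto
    then show "path_edges (a # rest) \<inter> E1 = {}" by (auto simp: E1_def B_def)
    show "2 \<le> ends_at P1 h" using s good[OF av(2)] by simp
    fix x assume "x \<in> V" "x \<noteq> a"
    then show "1 \<le> ends_at P1 x" using s good[of x] by (cases "x = h") auto
  qed
  then obtain P2 where P2: "path_system (E - {{z, h}}) P2" "card P2 = card P1" "2 \<le> ends_at P2 h"
    "\<And>x. x \<in> V \<Longrightarrow> x \<noteq> z \<Longrightarrow> 1 \<le> ends_at P2 x" using E1E z(1) by auto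
  obtain P3 where P3: "path_system (insert {z, h} (E - {{z, h}})) P3" "shifts_end P2 P3 h z"
  proof (rule add_edge_good[OF P2(1)])
    show "{z, h} \<notin> E - {{z, h}}" "z \<noteq> h" "1 \<le> ends_at P2 h" using hz P2(3) by auto
    show "1 \<le> ends_at P2 w" if "w \<in> nb (E - {{z, h}}) z" for w
      using P2(4)[of w] that grD(3)[of w z] grD(5)[of z] by (auto simp: nb_Diff)
  qed blast
  have "insert {z, h} (E - {{z, h}}) = E" using c(5) by auto
  then show ?thesis using P3 P2(2) s P(2) decomposableI[of P3] by (simp add: shifts_end_def)
qed

end

section \<open>Splitting along unions of components\<close>

lemma part_inherits:
  assumes CV: "C \<subseteq> V" and E': "E' \<subseteq> E" and nb: "\<And>x. x \<in> C \<Longrightarrow> nb E' x = nb E x"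
    and g: "graph_on V E"
  shows "sparse_evens V E \<Longrightarrow> sparse_evens C E'" "SET_free V E \<Longrightarrow> SET_free C E'"
proof -
  have ev: "evens C E' = C \<inter> evens V E" using CV nb by (auto simp: evens_def)
  show "sparse_evens C E'" if "sparse_evens V E"
    unfolding sparse_evens_def
  proof
    fix v assume "v \<in> evens C E'"
    then have v: "v \<in> C" "v \<in> evens V E" using ev by auto
    have "card (nb E' v \<inter> evens C E') \<le> card (nb E v \<inter> evens V E)"
      using nb[OF v(1)] ev graph_onD(6)[OF g] by (intro card_mono) auto
    then show "card (nb E' v \<inter> evens C E') \<le> 3" using that v by (force simp: sparse_evens_def)
  qed
  show "SET_free C E'" if "SET_free V E"
    unfolding SET_free_def
  proof (intro allI impI notI)
    fix D assume D: "D \<subseteq> C" "closed_part E' D" "SET_part C E' D"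
    then obtain a b c where abc: "a \<noteq> b" "b \<noteq> c" "a \<noteq> c" "{a, b} \<in> E'" "{b, c} \<in> E'" "{a, c} \<in> E'"
      "D \<inter> evens C E' = {a, b, c}" "\<And>v. v \<in> D - {a, b, c} \<Longrightarrow> 2 \<le> card (nb E' v \<inter> {a, b, c})"
      unfolding SET_part_def by auto
    have nbD: "nb E' x = nb E x" if "x \<in> D" for x using nb that D(1) by blast
    have "closed_part E D" using D(2) nbD by (simp add: closed_part_def)
    moreover have "SET_part V E D"
      unfolding SET_part_def
      using abc E' nbD ev D(1) by (intro exI[of _ a] exI[of _ b] exI[of _ c]) auto
    ultimately show False using that D(1) CV by (auto simp: SET_free_def)
  qed
qed

lemma split_parts:
  assumes g: "graph_on V E" and C: "C \<subseteq> V" "closed_part E C"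
  obtains E1 E2 where "E1 \<union> E2 = E" "E1 \<inter> E2 = {}" "graph_on C E1" "graph_on (V - C) E2"
    "\<And>x. x \<in> C \<Longrightarrow> nb E1 x = nb E x" "\<And>x. x \<in> V - C \<Longrightarrow> nb E2 x = nb E x"
proof -
  define E1 where "E1 = {e \<in> E. e \<subseteq> C}"
  have edge: "\<exists>u v. e = {u, v} \<and> u \<in> V \<and> v \<in> V \<and> u \<noteq> v" if "e \<in> E" for e
    using g that by (auto simp: graph_on_def)
  have closed: "u \<in> C \<longleftrightarrow> v \<in> C" if "{u, v} \<in> E" for u v
    using C(2) that in_nb_sym[of u E v] unfolding closed_part_def edge_iff_nb by blast
  have f: "finite C" "finite (V - C)" using graph_onD(1)[OF g] C(1) finite_subset by auto
  show ?thesis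
  proof (rule that[of E1 "E - E1"])
    show "E1 \<union> (E - E1) = E" "E1 \<inter> (E - E1) = {}" by (auto simp: E1_def)
    show "graph_on C E1" unfolding graph_on_def using f edge by (fastforce simp: E1_def)
    show "graph_on (V - C) (E - E1)"
      unfolding graph_on_def
    proof (intro conjI subsetI f(2))
      fix e assume e: "e \<in> E - E1"
      then obtain u v where uv: "e = {u, v}" "u \<in> V" "v \<in> V" "u \<noteq> v" using edge by blast
      then have "u \<notin> C" "v \<notin> C" using e closed[of u v] by (auto simp: E1_def)
      then show "e \<in> {{u, v} |u v. u \<in> V - C \<and> v \<in> V - C \<and> u \<noteq> v}" using uv by blast
    qed
    show "nb E1 x = nb E x" if "x \<in> C" for x using that closed by (auto simp: E1_def nb_def)
    show "nb (E - E1) x = nb E x" if "x \<in> V - C" for x using that by (auto simp: E1_def nb_def)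
  qed
qed

section \<open>The induction\<close>

text \<open>If \<open>case_star\<close> applies nowhere, each odd vertex with an even neighbour sees
  at least two vertices of one triangle and no other even vertices. For a triangle \<open>T\<close>
  let \<open>X\<close> be the odd vertices seeing it in this way. If \<open>T \<union> X\<close>
  were closed, the whole graph would be a SET part. So some edge \<open>wv\<close> leaves it,
  necessarily from \<open>w\<close> in \<open>X\<close> to an odd \<open>v\<close>, and
  \<open>v\<close> sees no even vertex or another triangle.\<close>

lemma (in triangle_step) triangles_decomposable:
  assumes SF: "SET_free V E" and E0: "E \<noteq> {}"
  shows "decomposable V E"
proof (cases "\<exists>b\<in>V - F. nb E b \<inter> F \<noteq> {} \<and> (\<forall>u\<in>nb E b \<inter> F. nb E b \<inter> F \<subseteq> cell u \<longrightarrow> card (nb E b \<inter> F) < 2)")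
  case True
  then obtain b where b: "b \<in> V" "b \<notin> F" "nb E b \<inter> F \<noteq> {}"
    "\<And>u. u \<in> nb E b \<inter> F \<Longrightarrow> nb E b \<inter> F \<subseteq> cell u \<Longrightarrow> card (nb E b \<inter> F) < 2" by blast
  show ?thesis by (rule case_star[OF b(1,2) refl b(3)]) (rule b(4))
next
  case False
  have attached: "\<exists>u\<in>nb E b \<inter> F. nb E b \<inter> F \<subseteq> cell u \<and> 2 \<le> card (nb E b \<inter> F)"
    if "b \<in> V" "b \<notin> F" "nb E b \<inter> F \<noteq> {}" for b
  proof -
    have "b \<in> V - F" using that by blast
    with False that(3) have "\<exists>u\<in>nb E b \<inter> F. nb E b \<inter> F \<subseteq> cell u \<and> \<not> card (nb E b \<inter> F) < 2" by blast
    then show ?thesis unfolding not_less .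
  qed
  obtain e where "e \<in> E" using E0 by blast
  then obtain x y where xy: "x \<in> V" "y \<in> V" "x \<noteq> y" "{x, y} \<in> E"
    using gr unfolding graph_on_def by blast
  show ?thesis
  proof (cases "F = {}")
    case True
    show ?thesis
    proof (cases "\<exists>l\<in>V. card (nb E l) = 1")
      case True
      then obtain l p where "l \<in> V" "nb E l = {p}" by (auto simp: card_1_singleton_iff)
      then show ?thesis by (rule case_leaf[OF \<open>F = {}\<close>])
    next
      case F: False
      have "2 \<le> card (nb E v)" if "v \<in> V" for v
      proof -
        have "odd (card (nb E v))" using True that by (auto simp: evens_def)
        moreover have "card (nb E v) \<noteq> 1" using F that by blast
        ultimately show ?thesis by (cases "card (nb E v)"; cases "card (nb E v) - 1") auto
      qed
      then show ?thesis using case_cycle[OF True] xy by blast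
    qed
  next
    case False
    then obtain u where u: "u \<in> F" by blast
    then have uV: "u \<in> V" by (simp add: evens_def)
    define T where "T = cell u"
    have cellT: "cell x = T" if "x \<in> T" for x using cell_eq[OF u] that by (simp add: T_def)
    have TF: "T \<subseteq> F" using u matesD by (auto simp: T_def cell_def)
    \<comment> \<open>A neighbour of an isolated even vertex \<open>u\<close> would need two even
      neighbours inside the cell \<open>{u}\<close>.\<close>
    have mu: "mates u \<noteq> {}"
    proof
      assume m: "mates u = {}"
      show False
      proof (cases "nb E u = {}")
        case True
        then have "closed_part E {u}" by (simp add: closed_part_def)
        then have "{u} = V" using conn[of "{u}"] uV by simp
        then show False using xy by blast
      next
        case False
        then obtain b where b: "b \<in> nb E u" by blast
        then have bF: "b \<in> V" "b \<notin> F" using m grD(3) by (auto simp: mates_def)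
        have "u \<in> nb E b \<inter> F" using b u in_nb_sym[of b E u] by blast
        then obtain u' where u': "u' \<in> nb E b \<inter> F" "nb E b \<inter> F \<subseteq> cell u'" "2 \<le> card (nb E b \<inter> F)"
          using attached[OF bF] by blast
        then have "cell u = cell u'" using cell_eq[of u' u] \<open>u \<in> nb E b \<inter> F\<close> by blast
        then have "nb E b \<inter> F \<subseteq> {u}" using u'(2) m by (simp add: cell_def)
        then show False using u'(3) card_mono[of "{u}" "nb E b \<inter> F"] by simp
      qed
    qed
    define X where "X = {w \<in> V - F. nb E w \<inter> F \<subseteq> T \<and> 2 \<le> card (nb E w \<inter> F)}"
    have CV: "T \<union> X \<subseteq> V" using TF evens_in_V[of _ V E] by (auto simp: X_def)
    have toX: "v \<in> X" if "v \<in> V" "v \<notin> F" "u' \<in> nb E v \<inter> F" "nb E v \<inter> F \<subseteq> cell u'"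
      "2 \<le> card (nb E v \<inter> F)" "x \<in> T" "x \<in> cell u'" for v u' x
    proof -
      have "cell x = cell u'" using cell_eq[of u' x] that by blast
      then have "cell u' = T" using cellT that by simp
      then show ?thesis using that by (simp add: X_def)
    qed
    have nclosed: "\<not> closed_part E (T \<union> X)"
    proof
      assume cl: "closed_part E (T \<union> X)"
      then have VC: "V = T \<union> X" using conn[OF CV] by (auto simp: T_def cell_def)
      obtain s where s: "s \<in> mates u" using mu by blast
      obtain t where t: "t \<noteq> s" "mates u = {s, t}" "mates s = {u, t}" "mates t = {u, s}"
        using mates_pair[OF u s] .
      have Teq: "T = {u, s, t}" using t by (simp add: T_def cell_def)
      have su: "s \<noteq> u" "t \<noteq> u" using t(2) matesD by blast+
      have ed: "{u, s} \<in> E" "{s, t} \<in> E" "{u, t} \<in> E"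
        using t matesD[of s u] matesD[of t s] matesD[of t u] by (auto simp: nb_def)
      have "V \<inter> F = {u, s, t}" using VC TF Teq by (auto simp: X_def)
      moreover have "2 \<le> card (nb E v \<inter> {u, s, t})" if "v \<in> V - {u, s, t}" for v
      proof -
        have "v \<in> X" using that VC Teq by blast
        then have "nb E v \<inter> F \<subseteq> T" "2 \<le> card (nb E v \<inter> F)" by (auto simp: X_def)
        moreover have "nb E v \<inter> T = nb E v \<inter> F" using TF calculation(1) by blast
        ultimately show ?thesis using Teq by simp
      qed
      ultimately have "SET_part V E V"
        unfolding SET_part_def using su t(1) ed by (intro exI[of _ u] exI[of _ s] exI[of _ t]) auto
      then show False using SF cl VC by (auto simp: SET_free_def)
    qed
    then obtain w v where wv: "w \<in> T \<union> X" "v \<in> nb E w" "v \<notin> T \<union> X"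
      by (auto simp: closed_part_def)
    have vV: "v \<in> V" using grD(3)[OF wv(2)] .
    have wX: "w \<in> X"
    proof (rule ccontr)
      assume "w \<notin> X"
      then have wT: "w \<in> T" using wv by blast
      have "v \<notin> F"
      proof
        assume "v \<in> F"
        then have "v \<in> cell w" using wv(2) by (simp add: cell_def mates_def)
        then show False using cellT[OF wT] wv(3) by blast
      qed
      moreover have w: "w \<in> nb E v \<inter> F" using wT TF wv(2) in_nb_sym[of v E w] by blast
      ultimately obtain u' where "u' \<in> nb E v \<inter> F" "nb E v \<inter> F \<subseteq> cell u'" "2 \<le> card (nb E v \<inter> F)"
        using attached[OF vV] by blast
      then show False using toX[OF vV \<open>v \<notin> F\<close>, of u' w] wT w wv(3) by blast
    qed
    then have w: "w \<in> V" "w \<notin> F" "nb E w \<inter> F \<subseteq> T" "2 \<le> card (nb E w \<inter> F)" by (auto simp: X_def)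
    have vF: "v \<notin> F" using w(3) wv(2,3) by blast
    show ?thesis
    proof (cases "nb E v \<inter> F = {}")
      case True
      then show ?thesis using case_pendant[OF u mu T_def w wv(2) vF] by blast
    next
      case False
      then obtain u' where u': "u' \<in> nb E v \<inter> F" "nb E v \<inter> F \<subseteq> cell u'" "2 \<le> card (nb E v \<inter> F)"
        using attached[OF vV vF] by blast
      have "u' \<notin> T"
      proof
        assume "u' \<in> T"
        then show False using toX[OF vV vF u', of u'] wv(3) by (simp add: cell_def)
      qed
      then show ?thesis
        using case_linked[OF u mu T_def w wv(2) vF _ _ refl u'(2,3)] u'(1) by blast
    qed
  qed
qed

lemma (in connected_step) connected_decomposable:
  assumes sp: "sparse_evens V E" and SF: "SET_free V E" and E0: "E \<noteq> {}"
  shows "decomposable V E"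
proof (cases "\<exists>x\<in>F. card (nb E x \<inter> F) = 3")
  case True
  then obtain x where x: "x \<in> F" "card (nb E x \<inter> F) = 3" by blast
  show ?thesis
  proof (cases "\<exists>a b c d. diamond a b c d")
    case True
    then obtain a b c d where "diamond a b c d" by blast
    then have d: "a \<in> F" "b \<in> F" "c \<in> F" "d \<in> F" "c \<noteq> d" "b \<in> nb E a" "a \<in> nb E c" "b \<in> nb E c"
      "a \<in> nb E d" "b \<in> nb E d" by (auto simp: diamond_def)
    then have s: "c \<in> nb E a" "d \<in> nb E a" "c \<in> nb E b" "d \<in> nb E b"
      using in_nb_sym by fast+
    have ne: "b \<noteq> c" "b \<noteq> d" using d grD(5) by auto
    \<comment> \<open>In a diamond the bound 3 leaves \<open>a\<close> exactly the even neighbours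
      \<open>b\<close>, \<open>c\<close>, \<open>d\<close>, each adjacent to another of them. This
      makes \<open>a\<close> a valid choice of \<open>x\<close> in
      \<open>case_degree_three\<close>.\<close>
    have "{b, c, d} \<subseteq> nb E a \<inter> F" using d s by auto
    moreover have "card (nb E a \<inter> F) \<le> 3" using sp d by (auto simp: sparse_evens_def)
    moreover have "card {b, c, d} = 3" using ne d(5) by simp
    ultimately have N: "nb E a \<inter> F = {b, c, d}"
      using card_seteq[of "nb E a \<inter> F" "{b, c, d}"] grD(6)[of a] by auto
    have "\<forall>v\<in>nb E a \<inter> F. nb E v \<inter> nb E a \<inter> F \<noteq> {}"
      unfolding Int_assoc N using d s by blast
    then show ?thesis using case_degree_three[OF sp d(1)] N ne d(5) by simp
  next
    case False
    then show ?thesis using case_degree_three[OF sp x] by blast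
  qed
next
  case False
  have le2: "card (nb E u \<inter> F) \<le> 2" if "u \<in> F" for u
  proof -
    have "card (nb E u \<inter> F) \<le> 3" "card (nb E u \<inter> F) \<noteq> 3" using sp False that by (auto simp: sparse_evens_def)
    then show ?thesis by simp
  qed
  show ?thesis
  proof (cases "\<exists>a\<in>F. card (nb E a \<inter> F) = 1")
    case True
    then obtain a x where a: "a \<in> F" "nb E a \<inter> F = {x}" by (auto simp: card_1_singleton_iff)
    show ?thesis by (rule case_degree_one[OF le2 a])
  next
    case no1: False
    have two: "card (nb E u \<inter> F) = 2" if "u \<in> F" "s \<in> nb E u \<inter> F" for u s
    proof -
      have "card (nb E u \<inter> F) \<noteq> 0" using that grD(6)[of u] by auto
      moreover have "card (nb E u \<inter> F) \<noteq> 1" using no1 that by blast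
      ultimately show ?thesis using le2[OF that(1)] by linarith
    qed
    \<comment> \<open>An even vertex with an even neighbour now has exactly two. If they are not
      adjacent, they extend to the path \<open>z\<close>, \<open>x\<close>, \<open>u\<close>,
      \<open>y\<close>, where \<open>y\<close> and \<open>z\<close> differ because only
      \<open>z\<close> is adjacent to \<open>x\<close>.\<close>
    show ?thesis
    proof (cases "\<exists>u\<in>F. \<exists>x y. x \<noteq> y \<and> nb E u \<inter> F = {x, y} \<and> y \<notin> nb E x")
      case True
      then obtain u x y where u: "u \<in> F" "nb E u \<inter> F = {x, y}" "x \<noteq> y" "y \<notin> nb E x" by blast
      have xF: "x \<in> F" "u \<in> nb E x \<inter> F" using u in_nb_sym[of u E x] by auto
      obtain z where z: "nb E x \<inter> F = {z, u}" "z \<noteq> u"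
      proof -
        obtain s t where st: "nb E x \<inter> F = {s, t}" "s \<noteq> t" using two[OF xF] by (auto simp: card_2_iff)
        then show ?thesis using that[of s] that[of t] xF(2) by auto
      qed
      have "y \<noteq> z" using z u(4) by blast
      show ?thesis by (rule case_path[OF le2 u(1,2) z(1) u(3) z(2) \<open>y \<noteq> z\<close>])
    next
      case False
      interpret triangle_step V E
      proof
        fix u assume u: "u \<in> F"
        show "nb E u \<inter> F = {} \<or> (\<exists>s t. s \<noteq> t \<and> nb E u \<inter> F = {s, t} \<and> t \<in> nb E s)"
        proof (cases "nb E u \<inter> F = {}")
          case ne: False
          then have "card (nb E u \<inter> F) = 2" using two[OF u] by blast
          then obtain s t where "nb E u \<inter> F = {s, t}" "s \<noteq> t" by (auto simp: card_2_iff)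
          then show ?thesis using False u by blast
        qed simp
      qed
      show ?thesis by (rule triangles_decomposable[OF SF E0])
    qed
  qed
qed

text \<open>Removals may disconnect the graph, so the statement excludes SET graphs component by
  component. The doubled count makes the bound additive over components. The measure includes the
  vertices, since splitting off an isolated vertex loses no edge.\<close>

theorem sparse_SET_free_decomposable:
  assumes "graph_on V E" "sparse_evens V E" "SET_free V E"
  shows "decomposable V E"
  using assms
proof (induction "card E + card V" arbitrary: V E rule: less_induct)
  case less
  note g = less.prems(1)
  consider "E = {}" | "E \<noteq> {}" "\<exists>C\<subseteq>V. closed_part E C \<and> C \<noteq> {} \<and> C \<noteq> V"
    | "E \<noteq> {}" "\<And>C. C \<subseteq> V \<Longrightarrow> closed_part E C \<Longrightarrow> C = {} \<or> C = V" by blast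
  then show ?case
  proof cases
    case 1
    then have "path_system E {}" by (simp add: path_system_def)
    then show ?thesis by (force simp: decomposable_def)
  next
    case 2
    then obtain C where C: "C \<subseteq> V" "closed_part E C" "C \<noteq> {}" "C \<noteq> V" by blast
    obtain E1 E2 where E: "E1 \<union> E2 = E" "E1 \<inter> E2 = {}" "graph_on C E1" "graph_on (V - C) E2"
      "\<And>x. x \<in> C \<Longrightarrow> nb E1 x = nb E x" "\<And>x. x \<in> V - C \<Longrightarrow> nb E2 x = nb E x"
      using split_parts[OF g C(1,2)] by metis
    have sub: "E1 \<subseteq> E" "E2 \<subseteq> E" using E(1) by auto
    have fV: "finite V" "finite E" using graph_onD[OF g] by auto
    have cV: "card V = card C + card (V - C)"
      using C(1) fV card_mono[OF fV(1) C(1)] by (simp add: card_Diff_subset finite_subset)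
    have lt: "card C < card V" "card (V - C) < card V"
      using C fV by (auto intro!: psubset_card_mono)
    have "decomposable C E1"
    proof (rule less.hyps[OF _ E(3)])
      show "card E1 + card C < card E + card V" using lt card_mono[OF fV(2) sub(1)] by simp
      show "sparse_evens C E1" "SET_free C E1"
        using part_inherits[OF C(1) sub(1) E(5) g] less.prems by blast+
    qed
    moreover have "decomposable (V - C) E2"
    proof (rule less.hyps[OF _ E(4)])
      show "card E2 + card (V - C) < card E + card V" using lt card_mono[OF fV(2) sub(2)] by simp
      show "sparse_evens (V - C) E2" "SET_free (V - C) E2"
        using part_inherits[OF Diff_subset sub(2) E(6) g] less.prems by blast+
    qed
    ultimately obtain P1 P2 where P: "path_system E1 P1" "card P1 \<le> card C"
      "path_system E2 P2" "card P2 \<le> card (V - C)" by (auto simp: decomposable_def)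
    have "path_system E (P1 \<union> P2)" using path_system_Un[OF P(1,3) E(2)] E(1) by simp
    moreover have "card (P1 \<union> P2) \<le> card V" using P(2,4) cV card_Un_le[of P1 P2] by linarith
    ultimately show ?thesis by (auto simp: decomposable_def)
  next
    case 3
    interpret connected_step V E
      by unfold_locales (use g 3(2) less.hyps in auto)
    show ?thesis by (rule connected_decomposable[OF less.prems(2,3) 3(1)])
  qed
qed

section \<open>From oriented path systems to path decompositions\<close>

lemma decomposable_imp_Gallai:
  assumes G: "simple_graph G" and dec: "decomposable (verts G) (edges G)"
  shows "Gallai_graph G"
proof -
  obtain P where PS: "path_system (edges G) P" and card: "card P \<le> card (verts G)"
    using dec by (auto simp: decomposable_def)
  note D = path_systemD[OF PS]
  have edge: "e \<subseteq> verts G" if "e \<in> edges G" for e using G that by (auto simp: simple_graph_def)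
  \<comment> \<open>The choice is made from the unordered pair, so both orientations of a path get
    the same value and \<open>Q\<close> contains exactly one of them.\<close>
  define f :: "'a list \<Rightarrow> 'a list" where "f p = (SOME q. q \<in> {p, rev p})" for p
  have f: "f p \<in> {p, rev p}" for p unfolding f_def by (rule someI[of _ p]) simp
  have frev: "f (rev p) = f p" for p by (simp add: f_def insert_commute)
  have ff: "f (f p) = f p" for p using f[of p] frev[of p] by auto
  define Q where "Q = f ` P"
  have QP: "Q \<subseteq> P" using f D(4) by (auto simp: Q_def) (metis insertE singletonD)
  have fQ: "f q = q" if "q \<in> Q" for q using that ff by (auto simp: Q_def)
  have norev: "rev q \<notin> Q" if "q \<in> Q" for q
    using fQ[of q] fQ[of "rev q"] frev[of q] that D(6)[of q] QP by auto
  have PQ: "P = Q \<union> rev ` Q"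
  proof
    show "Q \<union> rev ` Q \<subseteq> P" using QP D(4) by auto
    show "P \<subseteq> Q \<union> rev ` Q"
    proof
      fix p assume p: "p \<in> P"
      then have "f p \<in> Q" by (simp add: Q_def)
      moreover have "p = f p \<or> p = rev (f p)" using f[of p] by auto
      ultimately show "p \<in> Q \<union> rev ` Q" by (metis UnI1 UnI2 imageI)
    qed
  qed
  have fin: "finite Q" using QP D(1) finite_subset by blast
  have "card P = card Q + card (rev ` Q)"
    unfolding PQ using fin norev by (intro card_Un_disjoint) auto
  moreover have "card (rev ` Q) = card Q" by (rule card_image) simp
  ultimately have cQ: "card Q \<le> card (verts G) div 2" using card by simp
  have "path_decomposition G Q"
    unfolding path_decomposition_def
  proof (intro conjI ballI impI)
    show "finite Q" by (rule fin)
    have "(\<Union>p\<in>Q. path_edges p) = (\<Union>p\<in>P. path_edges p)" unfolding PQ by auto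
    then show "(\<Union>p\<in>Q. path_edges p) = edges G" using PS by (simp add: path_system_def)
  next
    fix p assume p: "p \<in> Q"
    then have pP: "p \<in> P" using QP by blast
    have "set p \<subseteq> verts G"
    proof
      fix x assume x: "x \<in> set p"
      \<comment> \<open>Members have at least two vertices, so each vertex lies on an edge of the
        path and hence in the graph.\<close>
      have "\<exists>e\<in>path_edges p. x \<in> e" using x D(3)[OF pP]
      proof (induction p rule: path_edges.induct)
        case (1 a b q)
        show ?case
        proof (cases "x = a \<or> x = b")
          case False
          then have "x \<in> set (b # q)" "2 \<le> length (b # q)" using 1(2) by (cases q, auto)+
          then show ?thesis using 1(1) by auto
        qed auto
      qed auto
      then show "x \<in> verts G" using D(7)[OF pP] edge by blast
    qed
    then show "is_path G p" using D(2,5,7)[OF pP] by (simp add: is_path_def)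
  next
    fix p q assume pq: "p \<in> Q" "q \<in> Q" "p \<noteq> q"
    show "path_edges p \<inter> path_edges q = {}"
    proof (rule ccontr)
      assume "path_edges p \<inter> path_edges q \<noteq> {}"
      then have "q = p \<or> q = rev p" using D(8)[of p q] pq QP by blast
      then show False using pq norev[of p] by auto
    qed
  qed
  then have "pn G \<le> card Q" unfolding pn_def by (intro Least_le) blast
  then show ?thesis using cQ by (simp add: Gallai_graph_def)
qed

lemma connected_graph_closed_part:
  assumes "connected_graph G" "C \<subseteq> verts G" "closed_part (edges G) C" "C \<noteq> {}"
  shows "C = verts G"
proof
  show "verts G \<subseteq> C"
  proof
    fix v assume v: "v \<in> verts G"
    obtain u where u: "u \<in> C" using assms(4) by blast
    obtain p where p: "is_path G p" "hd p = u" "last p = v"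
      using assms(1,2) u v unfolding connected_graph_def by blast
    have "set p \<subseteq> C" if "hd p \<in> C" "path_edges p \<subseteq> edges G" for p
      using that
    proof (induction p rule: path_edges.induct)
      case (1 a b q)
      have "b \<in> nb (edges G) a" using 1(3) by (simp add: nb_def)
      then have "b \<in> C" using 1(2) assms(3) by (auto simp: closed_part_def)
      then show ?case using 1 by auto
    qed auto
    then have "set p \<subseteq> C" using p u by (auto simp: is_path_def)
    then show "v \<in> C" using p last_in_set[of p] by (auto simp: is_path_def)
  qed
qed (use assms in blast)

theorem theorem3p1:
  fixes G :: "'a ugraph"
  assumes "simple_graph G"
    and "connected_graph G"
    and "max_degree (EV G) \<le> 3"
  shows "Gallai_graph G \<or> SET_graph G"
proof (rule disjCI)
  assume notSET: "\<not> SET_graph G"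
  let ?V = "verts G" and ?E = "edges G"
  have g: "graph_on ?V ?E" using assms(1) by (simp add: simple_graph_def graph_on_def)
  have neighbors: "neighbors G v = nb ?E v" for v
    using graph_onD(3)[OF g] by (auto simp: neighbors_def nb_def)
  have ev: "even_vertices G = evens ?V ?E"
    by (simp add: even_vertices_def evens_def degree_def neighbors)
  have evV: "evens ?V ?E \<subseteq> ?V" by (auto simp: evens_def)
  have vEV: "verts (EV G) = evens ?V ?E"
    using evV by (auto simp: EV_def induced_subgraph_def ev)
  have eEV: "edges (EV G) = {e \<in> ?E. e \<subseteq> evens ?V ?E}"
    by (simp add: EV_def induced_subgraph_def ev)
  have "sparse_evens ?V ?E"
    unfolding sparse_evens_def
  proof
    fix v assume v: "v \<in> evens ?V ?E"
    have "neighbors (EV G) v = nb ?E v \<inter> evens ?V ?E"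
      using v by (auto simp: neighbors_def vEV eEV nb_def)
    then have "card (nb ?E v \<inter> evens ?V ?E) = degree (EV G) v" by (simp add: degree_def)
    also have "\<dots> \<le> max_degree (EV G)"
      unfolding max_degree_def
    proof (rule Max_ge)
      show "finite (insert 0 (degree (EV G) ` verts (EV G)))"
        unfolding vEV using evV graph_onD(1)[OF g] finite_subset by blast
    qed (use v vEV in simp)
    finally show "card (nb ?E v \<inter> evens ?V ?E) \<le> 3" using assms(3) by simp
  qed
  moreover have "SET_free ?V ?E"
    unfolding SET_free_def
  proof (intro allI impI notI)
    fix C assume C: "C \<subseteq> ?V" "closed_part ?E C" "SET_part ?V ?E C"
    then obtain a b c where abc: "a \<noteq> b" "b \<noteq> c" "a \<noteq> c" "{a, b} \<in> ?E" "{b, c} \<in> ?E" "{a, c} \<in> ?E"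
      "C \<inter> evens ?V ?E = {a, b, c}" "\<And>v. v \<in> C - {a, b, c} \<Longrightarrow> 2 \<le> card (nb ?E v \<inter> {a, b, c})"
      unfolding SET_part_def by auto
    have "C \<noteq> {}" using abc(7) by auto
    \<comment> \<open>Connectedness leaves the whole graph as the only candidate for a SET part, and
      as a SET part it would be a SET graph.\<close>
    then have CV: "C = ?V" using connected_graph_closed_part[OF assms(2) C(1,2)] by blast
    then have F: "evens ?V ?E = {a, b, c}" using abc(7) evV by blast
    have "edges (EV G) = {{a, b}, {b, c}, {a, c}}"
    proof
      show "edges (EV G) \<subseteq> {{a, b}, {b, c}, {a, c}}"
      proof
        fix e assume e: "e \<in> edges (EV G)"
        then obtain x y where "e = {x, y}" "x \<noteq> y" using g unfolding eEV graph_on_def by blast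
        moreover have "e \<subseteq> {a, b, c}" using e by (simp add: eEV F)
        ultimately show "e \<in> {{a, b}, {b, c}, {a, c}}" by (auto simp: insert_commute)
      qed
    qed (use abc in \<open>auto simp: eEV F\<close>)
    then have "is_triangle (EV G)"
      unfolding is_triangle_def using abc(1-3) vEV F by blast
    moreover have "2 \<le> card (neighbors G v \<inter> even_vertices G)" if "v \<in> ?V" "odd (degree G v)" for v
    proof -
      have "v \<notin> evens ?V ?E" using that by (simp add: evens_def degree_def neighbors)
      then show ?thesis using abc(8)[of v] that(1) CV F by (simp add: neighbors ev)
    qed
    ultimately show False using notSET by (auto simp: SET_graph_def)
  qed
  ultimately show "Gallai_graph G"
    using sparse_SET_free_decomposable[OF g] decomposable_imp_Gallai[OF assms(1)] by blast
qed

end
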